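(* Let $S\in\mathcal H_0^+$. Let $A_2\subset\tilde D$ be closed in $D$, let $A_1\subset\tilde D\setminus A_2$, and suppose that the minimization problem $P(A_1,A_2)$ has a weak solution (weak minimizer) $\gamma^\star\in\tilde\Gamma_{A_1}^{A_2}$. Denoting by $\hat x$ the first hitting point of $A_2$ by $\gamma^\star$, assume also that $\hat x\in\tilde D^\circ$ and that the flow $\psi$ of some natural drift $b$ of $S$ fulfills $$\psi\big(\hat x,(-\tau,\tau)\big)\subset A_2\qquad\text{for some }\tau>0.$$ (In particular, these conditions on $\hat x$ are fulfilled if $A_2\subset\tilde D^\circ$ and if $A_2$ is flow-invariant under $b$.) Then $\hat x$ is a critical point.
   Context: $D\subseteq\mathbb R^n$ is open and connected; $\tilde D\subseteq D$ is connected and closed in $D$; $\tilde D^\circ$ is its interior in $\mathbb R^n$. Curves. An unparameterized oriented curve in $D$ is an equivalence class of functions $\varphi\in C([0,T],D)$, $T>0$, that are identical up to continuous non-decreasing changes of parameterization (their Fréchet distance vanishes); the representatives are its parameterizations. $\gamma\subset G$ means that the image of $\gamma$ lies in $G$. $\Gamma$ is the set of rectifiable curves. $\tilde C(0,1)$ is the set of $\varphi\in C([0,1],D)$ that are absolutely continuous in neighborhoods of all but at most finitely many $\alpha_i\in[0,1]$, and $\tilde\Gamma\supset\Gamma$ is the set of curves that can be parameterized by some $\varphi\in\tilde C(0,1)$. For $A_1,A_2\subset\tilde D$, $\Gamma_{A_1}^{A_2}$ (resp. $\tilde\Gamma_{A_1}^{A_2}$) is the set of $\gamma\in\Gamma$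 (resp. $\tilde\Gamma$) with $\gamma\subset\tilde D$ that start in $A_1$ and end in $A_2$; $\Gamma_x^w:=\Gamma_{\{x\}}^{\{w\}}$. Standing assumption on $\tilde D$: $\forall x\in\tilde D\ \forall\nu>0\ \exists r>0\ \forall w\in\bar B_r(x)\cap\tilde D\ \exists\gamma\in\Gamma_x^w$ with $\operatorname{length}(\gamma)\le\nu$. The class $\mathcal H_0^+$. Consider Hamiltonians $H\in C(D\times\mathbb R^n,\mathbb R)$, $H=H(x,\theta)$, with the properties: (H1) $H(x,0)\le0$ for all $x\in D$; (H2) $H_\theta,H_{\theta\theta}$ exist and are continuous in $(x,\theta)$; (H3) for every compact $K\subset D$ there is $m_K>0$ with $\langle\xi,H_{\theta\theta}(x,\theta)\xi\rangle\ge m_K|\xi|^2$ for all $x\in K$, $\theta,\xi\in\mathbb R^n$. Such $H$ induces the local action $\ell(x,y):=\max\{\langle y,\theta\rangle\mid\theta\in\mathbb R^n,\ H(x,\theta)\le0\}$ and the geometric action $S(\gamma):=\int_0^1\ell(\varphi,\varphi')\,d\alpha$ for $\gamma\in\tilde\Gamma$, with $\varphi\in\tilde C(0,1)$ any parameterization of $\gamma$. $\mathcal H$ is the class of all actions so induced. $\mathcal H_0^+\subset\mathcal H$ is the class of actions induced by some Hamiltonian satisfying (H1') $H(x,0)=0$ for all $x\in D$, (H2') the derivatives $H_x$, $H_\theta$, $H_{x\theta}=(H_{\theta x})^T$, $H_{\theta\theta}$, $H_{x\theta\theta}$ exist and are continuous in $(x,\theta)$, and (H3). A natural drift of $S\in\mathcal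 H$ is a vector field $b(x):=H_\theta(x,0)$ with $H$ any Hamiltonian (satisfying (H1)-(H3)) inducing $S$, provided $b$ is $C^1$. Its flow $\psi$ solves $\partial_t\psi(x,t)=b(\psi(x,t))$, $\psi(x,0)=x$; flows are assumed throughout to be defined for all $t\in\mathbb R$. A point $x\in D$ is critical if $\ell(x,y)=0$ for all $y\in\mathbb R^n$. $P(A_1,A_2)$ denotes the problem $\inf_{\gamma\in\Gamma_{A_1}^{A_2}}S(\gamma)$; a weak solution (weak minimizer) is $\gamma^\star\in\tilde\Gamma_{A_1}^{A_2}$ with $S(\gamma^\star)=\inf_{\gamma\in\Gamma_{A_1}^{A_2}}S(\gamma)$. The first hitting point of a set closed in $D$ is the first point along the oriented curve lying in that set. *)

theory Defs
  imports "HOL-Analysis.Analysis"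
begin

section \<open>Curves\<close>

text \<open>A parameterization is a pair \<open>(T, \<phi>)\<close>; only the values of \<open>\<phi>\<close> on \<open>{0..T}\<close> matter.\<close>

type_synonym 'n param = "real \<times> (real \<Rightarrow> real ^ 'n)"

type_synonym 'n curve = "'n param set"

definition params :: "(real ^ 'n) set \<Rightarrow> 'n param set" where
  "params D = {(T, \<phi>). 0 < T \<and> continuous_on {0..T} \<phi> \<and> \<phi> ` {0..T} \<subseteq> D}"

definition reparam :: "real \<Rightarrow> (real \<Rightarrow> real) \<Rightarrow> bool" where
  "reparam T \<alpha> \<longleftrightarrow> continuous_on {0..1} \<alpha> \<and> mono_on {0..1} \<alpha> \<and> \<alpha> 0 = 0 \<and> \<alpha> 1 = T"

definition frechet_dist :: "'n::finite param \<Rightarrow> 'n param \<Rightarrow> real" where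
  "frechet_dist p q =
     (INF (\<alpha>, \<beta>) \<in> {(\<alpha>, \<beta>). reparam (fst p) \<alpha> \<and> reparam (fst q) \<beta>}.
        SUP t \<in> {0..1}. dist (snd p (\<alpha> t)) (snd q (\<beta> t)))"

definition curve_rel :: "(real ^ 'n::finite) set \<Rightarrow> ('n param \<times> 'n param) set" where
  "curve_rel D = {(p, q). p \<in> params D \<and> q \<in> params D \<and> frechet_dist p q = 0}"

definition curves :: "(real ^ 'n::finite) set \<Rightarrow> 'n curve set" where
  "curves D = params D // curve_rel D"

definition param_length :: "'n::finite param \<Rightarrow> ennreal" where
  "param_length p =
     (SUP d \<in> {d. d division_of {0..fst p}}. ennreal (\<Sum>k\<in>d. norm (snd p (Sup k) - snd p (Inf k))))"

text \<open>The length does not depend on the choice of the representative.\<close>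

definition curve_length :: "'n::finite curve \<Rightarrow> ennreal" where
  "curve_length \<gamma> = param_length (SOME p. p \<in> \<gamma>)"

text \<open>The set \<open>\<Gamma>\<close> of rectifiable curves in \<open>D\<close>.\<close>

definition rect_curves :: "(real ^ 'n::finite) set \<Rightarrow> 'n curve set" where
  "rect_curves D = {\<gamma> \<in> curves D. curve_length \<gamma> < \<infinity>}"

text \<open>In the following definition, \<open>d\<close> ranges over the finite families of non-overlapping
  compact subintervals of \<open>I\<close>.\<close>

definition abs_cont_on :: "real set \<Rightarrow> (real \<Rightarrow> real ^ 'n::finite) \<Rightarrow> bool" where
  "abs_cont_on I \<phi> \<longleftrightarrow>
     (\<forall>\<epsilon>>0. \<exists>\<delta>>0. \<forall>d. d division_of \<Union>d \<and> \<Union>d \<subseteq> I \<and> (\<Sum>k\<in>d. measure lborel k) < \<delta> \<longrightarrow>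
        (\<Sum>k\<in>d. norm (\<phi> (Sup k) - \<phi> (Inf k))) < \<epsilon>)"

text \<open>The set of functions \<open>C\<^sup>~(0,1)\<close> with values in \<open>D\<close>, and the set \<open>\<Gamma>\<^sup>~\<close> of curves that can be
  parameterized by one of them.\<close>

definition Ct :: "(real ^ 'n::finite) set \<Rightarrow> (real \<Rightarrow> real ^ 'n) set" where
  "Ct D = {\<phi>. continuous_on {0..1} \<phi> \<and> \<phi> ` {0..1} \<subseteq> D \<and>
     (\<exists>F. finite F \<and> (\<forall>\<alpha>\<in>{0..1} - F. \<exists>r>0. abs_cont_on ({0..1} \<inter> cball \<alpha> r) \<phi>))}"

definition gen_curves :: "(real ^ 'n::finite) set \<Rightarrow> 'n curve set" where
  "gen_curves D = {\<gamma> \<in> curves D. \<exists>\<phi>\<in>Ct D. (1, \<phi>) \<in> \<gamma>}"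

text \<open>The members of a class have the same image, start point and end point.\<close>

definition connects ::
    "'n::finite curve \<Rightarrow> (real ^ 'n) set \<Rightarrow> (real ^ 'n) set \<Rightarrow> (real ^ 'n) set \<Rightarrow> bool" where
  "connects \<gamma> G A\<^sub>1 A\<^sub>2 \<longleftrightarrow>
     (\<forall>(T, \<phi>)\<in>\<gamma>. \<phi> ` {0..T} \<subseteq> G \<and> \<phi> 0 \<in> A\<^sub>1 \<and> \<phi> T \<in> A\<^sub>2)"

definition rect_curves_between ::
    "(real ^ 'n::finite) set \<Rightarrow> (real ^ 'n) set \<Rightarrow> (real ^ 'n) set \<Rightarrow> (real ^ 'n) set \<Rightarrow> 'n curve set" where
  "rect_curves_between D Dt A\<^sub>1 A\<^sub>2 = {\<gamma> \<in> rect_curves D. connects \<gamma> Dt A\<^sub>1 A\<^sub>2}"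

definition gen_curves_between ::
    "(real ^ 'n::finite) set \<Rightarrow> (real ^ 'n) set \<Rightarrow> (real ^ 'n) set \<Rightarrow> (real ^ 'n) set \<Rightarrow> 'n curve set" where
  "gen_curves_between D Dt A\<^sub>1 A\<^sub>2 = {\<gamma> \<in> gen_curves D. connects \<gamma> Dt A\<^sub>1 A\<^sub>2}"

definition first_hitting_point :: "'n::finite curve \<Rightarrow> (real ^ 'n) set \<Rightarrow> real ^ 'n \<Rightarrow> bool" where
  "first_hitting_point \<gamma> A x \<longleftrightarrow>
     (\<exists>(T, \<phi>)\<in>\<gamma>. \<exists>t\<in>{0..T}. \<phi> t = x \<and> x \<in> A \<and> (\<forall>s\<in>{0..<t}. \<phi> s \<notin> A))"

definition locally_rect_connected :: "(real ^ 'n::finite) set \<Rightarrow> (real ^ 'n) set \<Rightarrow> bool" where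
  "locally_rect_connected D Dt \<longleftrightarrow>
     (\<forall>x\<in>Dt. \<forall>\<nu>>0. \<exists>r>0. \<forall>w\<in>cball x r \<inter> Dt.
        \<exists>\<gamma>\<in>rect_curves_between D Dt {x} {w}. curve_length \<gamma> \<le> ennreal \<nu>)"


section \<open>Hamiltonians\<close>

text \<open>\<open>has_theta_derivs D H H\<^sub>\<theta> H\<^sub>\<theta>\<^sub>\<theta>\<close>: the gradient and the Hessian of \<open>H\<close> in the second argument
  exist and are the given functions, which are jointly continuous.\<close>

definition has_theta_derivs ::
    "(real ^ 'n::finite) set \<Rightarrow> (real ^ 'n \<Rightarrow> real ^ 'n \<Rightarrow> real) \<Rightarrow>
     (real ^ 'n \<Rightarrow> real ^ 'n \<Rightarrow> real ^ 'n) \<Rightarrow> (real ^ 'n \<Rightarrow> real ^ 'n \<Rightarrow> real ^ 'n ^ 'n) \<Rightarrow> bool" where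
  "has_theta_derivs D H H\<^sub>\<theta> H\<^sub>\<theta>\<^sub>\<theta> \<longleftrightarrow>
     (\<forall>x\<in>D. \<forall>\<theta>. GDERIV (H x) \<theta> :> H\<^sub>\<theta> x \<theta>) \<and>
     (\<forall>x\<in>D. \<forall>\<theta>. (H\<^sub>\<theta> x has_derivative (\<lambda>h. H\<^sub>\<theta>\<^sub>\<theta> x \<theta> *v h)) (at \<theta>)) \<and>
     continuous_on (D \<times> UNIV) (\<lambda>(x, \<theta>). H\<^sub>\<theta> x \<theta>) \<and>
     continuous_on (D \<times> UNIV) (\<lambda>(x, \<theta>). H\<^sub>\<theta>\<^sub>\<theta> x \<theta>)"

definition hamiltonian ::
    "(real ^ 'n::finite) set \<Rightarrow> (real ^ 'n \<Rightarrow> real ^ 'n \<Rightarrow> real) \<Rightarrow> bool" where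
  "hamiltonian D H \<longleftrightarrow>
     continuous_on (D \<times> UNIV) (\<lambda>(x, \<theta>). H x \<theta>) \<and>
     (\<forall>x\<in>D. H x 0 \<le> 0) \<and>
     (\<exists>H\<^sub>\<theta> H\<^sub>\<theta>\<^sub>\<theta>. has_theta_derivs D H H\<^sub>\<theta> H\<^sub>\<theta>\<^sub>\<theta> \<and>
        (\<forall>K. compact K \<and> K \<subseteq> D \<longrightarrow>
           (\<exists>m>0. \<forall>x\<in>K. \<forall>\<theta> \<xi>. \<xi> \<bullet> (H\<^sub>\<theta>\<^sub>\<theta> x \<theta> *v \<xi>) \<ge> m * (norm \<xi>)\<^sup>2)))"

text \<open>Indices are read from left to right: \<open>H\<^sub>x\<^sub>\<theta>\<close> is the \<open>\<theta>\<close>-derivative of the gradient \<open>H\<^sub>x\<close>, and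
  \<open>H\<^sub>x\<^sub>\<theta>\<^sub>\<theta>\<close> is the \<open>\<theta>\<close>-derivative of \<open>H\<^sub>x\<^sub>\<theta>\<close>.  The continuity of \<open>H\<^sub>\<theta>\<close> and \<open>H\<^sub>\<theta>\<^sub>\<theta>\<close> is part of
  \<open>hamiltonian\<close>.\<close>

definition hamiltonian0 ::
    "(real ^ 'n::finite) set \<Rightarrow> (real ^ 'n \<Rightarrow> real ^ 'n \<Rightarrow> real) \<Rightarrow> bool" where
  "hamiltonian0 D H \<longleftrightarrow>
     hamiltonian D H \<and>
     (\<forall>x\<in>D. H x 0 = 0) \<and>
     (\<exists>(H\<^sub>x :: real ^ 'n \<Rightarrow> real ^ 'n \<Rightarrow> real ^ 'n) (H\<^sub>\<theta> :: real ^ 'n \<Rightarrow> real ^ 'n \<Rightarrow> real ^ 'n)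
        (H\<^sub>x\<^sub>\<theta> :: real ^ 'n \<Rightarrow> real ^ 'n \<Rightarrow> real ^ 'n ^ 'n)
        (H\<^sub>x\<^sub>\<theta>\<^sub>\<theta> :: real ^ 'n \<Rightarrow> real ^ 'n \<Rightarrow> (real ^ 'n) \<Rightarrow>\<^sub>L (real ^ 'n ^ 'n)).
        (\<forall>x\<in>D. \<forall>\<theta>.
           GDERIV (\<lambda>x. H x \<theta>) x :> H\<^sub>x x \<theta> \<and>
           GDERIV (H x) \<theta> :> H\<^sub>\<theta> x \<theta> \<and>
           (H\<^sub>x x has_derivative (\<lambda>h. H\<^sub>x\<^sub>\<theta> x \<theta> *v h)) (at \<theta>) \<and>
           ((\<lambda>x. H\<^sub>\<theta> x \<theta>) has_derivative (\<lambda>h. transpose (H\<^sub>x\<^sub>\<theta> x \<theta>) *v h)) (at x) \<and>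
           (H\<^sub>x\<^sub>\<theta> x has_derivative blinfun_apply (H\<^sub>x\<^sub>\<theta>\<^sub>\<theta> x \<theta>)) (at \<theta>)) \<and>
        continuous_on (D \<times> UNIV) (\<lambda>(x, \<theta>). H\<^sub>x x \<theta>) \<and>
        continuous_on (D \<times> UNIV) (\<lambda>(x, \<theta>). H\<^sub>x\<^sub>\<theta> x \<theta>) \<and>
        continuous_on (D \<times> UNIV) (\<lambda>(x, \<theta>). H\<^sub>x\<^sub>\<theta>\<^sub>\<theta> x \<theta>))"


section \<open>Actions\<close>

text \<open>For a Hamiltonian, the set \<open>{\<theta>. H x \<theta> \<le> 0}\<close> is non-empty and compact, so the supremum below is
  a maximum, and it is non-negative.\<close>

definition local_action :: "(real ^ 'n::finite \<Rightarrow> real ^ 'n \<Rightarrow> real) \<Rightarrow> real ^ 'n \<Rightarrow> real ^ 'n \<Rightarrow> real" where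
  "local_action H x y = (SUP \<theta> \<in> {\<theta>. H x \<theta> \<le> 0}. y \<bullet> \<theta>)"

text \<open>The action may be infinite.  The derivative is taken where it exists, that is, almost everywhere
  for functions in \<open>Ct D\<close>; elsewhere \<open>vector_derivative\<close> has some fixed value.\<close>

definition param_action ::
    "(real ^ 'n::finite \<Rightarrow> real ^ 'n \<Rightarrow> real) \<Rightarrow> (real \<Rightarrow> real ^ 'n) \<Rightarrow> ennreal" where
  "param_action H \<phi> =
     (\<integral>\<^sup>+\<alpha>\<in>{0..1}. ennreal (local_action H (\<phi> \<alpha>) (vector_derivative \<phi> (at \<alpha>))) \<partial>lborel)"

text \<open>The Hamiltonian \<open>H\<close> induces the action \<open>S\<close>, a functional on \<open>gen_curves D\<close>, whose value may be
  computed with any parameterization in \<open>Ct D\<close>.  The values of \<open>S\<close> elsewhere are irrelevant.\<close>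

definition induces ::
    "(real ^ 'n::finite) set \<Rightarrow> (real ^ 'n \<Rightarrow> real ^ 'n \<Rightarrow> real) \<Rightarrow> ('n curve \<Rightarrow> ennreal) \<Rightarrow> bool" where
  "induces D H S \<longleftrightarrow>
     (\<forall>\<gamma>\<in>gen_curves D. \<forall>\<phi>\<in>Ct D. (1, \<phi>) \<in> \<gamma> \<longrightarrow> S \<gamma> = param_action H \<phi>)"

definition actions0 :: "(real ^ 'n::finite) set \<Rightarrow> ('n curve \<Rightarrow> ennreal) set" where
  "actions0 D = {S. \<exists>H. hamiltonian0 D H \<and> induces D H S}"

text \<open>The local action on \<open>D\<close> is determined by \<open>S\<close>, so the choice of \<open>H\<close> does not matter.\<close>

definition critical_point ::
    "(real ^ 'n::finite) set \<Rightarrow> ('n curve \<Rightarrow> ennreal) \<Rightarrow> real ^ 'n \<Rightarrow> bool" where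
  "critical_point D S x \<longleftrightarrow>
     x \<in> D \<and> (\<forall>H. hamiltonian D H \<and> induces D H S \<longrightarrow> (\<forall>y. local_action H x y = 0))"

definition C1_field_on :: "(real ^ 'n::finite) set \<Rightarrow> (real ^ 'n \<Rightarrow> real ^ 'n) \<Rightarrow> bool" where
  "C1_field_on D b \<longleftrightarrow>
     (\<exists>b' :: real ^ 'n \<Rightarrow> (real ^ 'n) \<Rightarrow>\<^sub>L (real ^ 'n).
        (\<forall>x\<in>D. (b has_derivative blinfun_apply (b' x)) (at x)) \<and> continuous_on D b')"

definition natural_drift ::
    "(real ^ 'n::finite) set \<Rightarrow> ('n curve \<Rightarrow> ennreal) \<Rightarrow> (real ^ 'n \<Rightarrow> real ^ 'n) \<Rightarrow> bool" where
  "natural_drift D S b \<longleftrightarrow>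
     C1_field_on D b \<and>
     (\<exists>H. hamiltonian D H \<and> induces D H S \<and> (\<forall>x\<in>D. GDERIV (H x) 0 :> b x))"

definition is_flow ::
    "(real ^ 'n::finite) set \<Rightarrow> (real ^ 'n \<Rightarrow> real ^ 'n) \<Rightarrow> (real ^ 'n \<Rightarrow> real \<Rightarrow> real ^ 'n) \<Rightarrow> bool" where
  "is_flow D b \<psi> \<longleftrightarrow>
     (\<forall>x\<in>D. \<psi> x 0 = x \<and>
        (\<forall>t. \<psi> x t \<in> D \<and> (\<psi> x has_vector_derivative b (\<psi> x t)) (at t)))"

definition flow_invariant :: "(real ^ 'n \<Rightarrow> real \<Rightarrow> real ^ 'n) \<Rightarrow> (real ^ 'n) set \<Rightarrow> bool" where
  "flow_invariant \<psi> A \<longleftrightarrow> (\<forall>x\<in>A. \<forall>t. \<psi> x t \<in> A)"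

definition weak_minimizer ::
    "(real ^ 'n::finite) set \<Rightarrow> (real ^ 'n) set \<Rightarrow> ('n curve \<Rightarrow> ennreal) \<Rightarrow>
     (real ^ 'n) set \<Rightarrow> (real ^ 'n) set \<Rightarrow> 'n curve \<Rightarrow> bool" where
  "weak_minimizer D Dt S A\<^sub>1 A\<^sub>2 \<gamma> \<longleftrightarrow>
     \<gamma> \<in> gen_curves_between D Dt A\<^sub>1 A\<^sub>2 \<and> S \<gamma> = (INF \<gamma>'\<in>rect_curves_between D Dt A\<^sub>1 A\<^sub>2. S \<gamma>')"

end

theory Submission
  imports Defs
begin

text \<open>
  The argument is direct: it compares the minimizer with a single competitor.

  For a Hamiltonian that vanishes at \<open>\<theta> = 0\<close>, the set \<open>{\<theta>. H x \<theta> \<le> 0}\<close> lies between two balls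
  touching each other at the origin, with inner normals opposite to the drift \<open>b x\<close>.  Locally uniformly
  in \<open>x\<close>, the local action of a velocity \<open>y\<close> is therefore comparable to the excess
  \<open>norm y * norm (b x) - y \<bullet> b x\<close> (lemma \<open>local_action_comparison\<close>).  This applies to the Hamiltonian
  of the natural drift, because any Hamiltonian inducing the given action vanishes at \<open>\<theta> = 0\<close>; short
  straight segments show this (lemma \<open>hamiltonian_zero_at_zero\<close>).  In the same way it is seen that
  points with zero drift are critical (lemma \<open>critical_point_if_drift_zero\<close>).

  Suppose that the drift does not vanish at the first hitting point \<open>p\<close>.  Near \<open>p\<close> the trajectory through
  \<open>p\<close> is a graph over the direction of the drift, and it lies in \<open>A\<^sub>2\<close>.  Before it hits \<open>p\<close>, the minimizer
  is not on this graph.  Cut it shortly before it reaches \<open>p\<close>, at a time when its transversal distance \<open>Z\<close>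
  from the graph is maximal, and let \<open>R\<close> be its distance from \<open>p\<close> there.  Its remaining part has to
  overcome the distance \<open>Z\<close> while its length is of order \<open>R\<close> unless the action is large anyway.  Since the
  excess is quadratic in the transversal velocity, this part costs at least a multiple of \<open>Z\<^sup>2 / R\<close> (lemma
  \<open>act_lower_bound\<close>).  The competitor follows the drift over a fixed distance beyond \<open>p\<close> and slowly
  approaches the graph; it ends in \<open>A\<^sub>2\<close> and costs at most a multiple of \<open>Z\<^sup>2\<close> (lemma
  \<open>act_upper_bound\<close>).  For small \<open>R\<close> this contradicts minimality (lemma \<open>drift_vanishes_at_first_hit\<close>).

  Three analytic facts support this comparison.  An absolutely continuous function is differentiable
  almost everywhere, and its increments are bounded by the integral of any upper bound for its
  derivative (lemmas \<open>ac_on_differentiable_almost_everywhere\<close> and \<open>ac_on_increment_le_nn_integral\<close>).  A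
  curve with finitely many exceptional points can be replaced by a rectifiable one at arbitrarily small
  cost (lemma \<open>rectifiable_approximation\<close>), so that the infimum over rectifiable curves also bounds the
  action of the modified minimizer.  The first hitting point does not depend on the parameterization
  (lemma \<open>first_hitting_time\<close>).
\<close>

section \<open>Absolutely continuous functions\<close>

text \<open>Absolute continuity, as in \<^const>\<open>abs_cont_on\<close>, for functions with values in an arbitrary normed
space.  The scalar case is needed for the components of a curve and for scalar functions along it.\<close>

definition ac_on :: "real set \<Rightarrow> (real \<Rightarrow> 'a::real_normed_vector) \<Rightarrow> bool" where
  "ac_on I f \<longleftrightarrow>
     (\<forall>\<epsilon>>0. \<exists>\<delta>>0. \<forall>d. d division_of \<Union>d \<and> \<Union>d \<subseteq> I \<and> (\<Sum>k\<in>d. measure lborel k) < \<delta> \<longrightarrow>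
        (\<Sum>k\<in>d. norm (f (Sup k) - f (Inf k))) < \<epsilon>)"

lemma abs_cont_on_iff_ac_on: "abs_cont_on I \<phi> \<longleftrightarrow> ac_on I \<phi>"
  unfolding abs_cont_on_def ac_on_def ..

lemma division_elemE:
  fixes d :: "real set set"
  assumes "d division_of S" "k \<in> d"
  obtains u v where "u \<le> v" "k = {u..v}" "Inf k = u" "Sup k = v" "measure lborel k = v - u" "{u..v} \<subseteq> S"
proof -
  obtain u v where k: "k = cbox u v" using division_ofD(4)[OF assms] by blast
  have ne: "u \<le> v" using division_ofD(3)[OF assms] k by auto
  show thesis
    by (rule that[of u v]) (use ne k division_ofD(2)[OF assms] in auto)
qed

lemma division_elem:
  fixes d :: "real set set"
  assumes "d division_of S" "k \<in> d"
  shows "Inf k \<le> Sup k" "k = {Inf k..Sup k}" "measure lborel k = Sup k - Inf k" "Inf k \<in> S" "Sup k \<in> S"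
proof -
  obtain u v where "u \<le> v" "k = {u..v}" "Inf k = u" "Sup k = v" "measure lborel k = v - u" "{u..v} \<subseteq> S"
    using assms by (rule division_elemE)
  then show "Inf k \<le> Sup k" "k = {Inf k..Sup k}" "measure lborel k = Sup k - Inf k" "Inf k \<in> S" "Sup k \<in> S"
    by auto
qed

lemma ac_onD:
  assumes "ac_on I f" "\<epsilon> > 0"
  obtains \<delta> where "\<delta> > 0" "\<And>d. d division_of \<Union>d \<Longrightarrow> \<Union>d \<subseteq> I \<Longrightarrow> (\<Sum>k\<in>d. measure lborel k) < \<delta> \<Longrightarrow>
        (\<Sum>k\<in>d. norm (f (Sup k) - f (Inf k))) < \<epsilon>"
proof -
  have "\<exists>\<delta>>0. \<forall>d. d division_of \<Union>d \<and> \<Union>d \<subseteq> I \<and> (\<Sum>k\<in>d. measure lborel k) < \<delta> \<longrightarrow>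
        (\<Sum>k\<in>d. norm (f (Sup k) - f (Inf k))) < \<epsilon>"
    using assms(1)[unfolded ac_on_def, rule_format, OF assms(2)] .
  then show thesis using that by blast
qed

lemma ac_on_subset: "ac_on I f \<Longrightarrow> J \<subseteq> I \<Longrightarrow> ac_on J f"
  unfolding ac_on_def by (meson subset_trans)

text \<open>The workhorse for closure properties: sums, components, and compositions with Lipschitz functions are
all dominated in this sense.\<close>

lemma ac_on_dominated:
  assumes "ac_on I f" "ac_on I g" "C \<ge> 0"
    and dom: "\<And>x y. x \<in> I \<Longrightarrow> y \<in> I \<Longrightarrow> x \<le> y \<Longrightarrow> norm (h y - h x) \<le> C * (norm (f y - f x) + norm (g y - g x))"
  shows "ac_on I h"
  unfolding ac_on_def
proof (intro allI impI)
  fix \<epsilon> :: real assume "\<epsilon> > 0"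
  then have e: "\<epsilon> / (2 * (C + 1)) > 0" using \<open>C \<ge> 0\<close> by simp
  obtain d1 where d1: "d1 > 0" "\<And>d. d division_of \<Union>d \<Longrightarrow> \<Union>d \<subseteq> I \<Longrightarrow> (\<Sum>k\<in>d. measure lborel k) < d1 \<Longrightarrow>
        (\<Sum>k\<in>d. norm (f (Sup k) - f (Inf k))) < \<epsilon> / (2 * (C + 1))"
    by (rule ac_onD[OF assms(1) e]) blast
  obtain d2 where d2: "d2 > 0" "\<And>d. d division_of \<Union>d \<Longrightarrow> \<Union>d \<subseteq> I \<Longrightarrow> (\<Sum>k\<in>d. measure lborel k) < d2 \<Longrightarrow>
        (\<Sum>k\<in>d. norm (g (Sup k) - g (Inf k))) < \<epsilon> / (2 * (C + 1))"
    by (rule ac_onD[OF assms(2) e]) blast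
  show "\<exists>\<delta>>0. \<forall>d. d division_of \<Union>d \<and> \<Union>d \<subseteq> I \<and> (\<Sum>k\<in>d. measure lborel k) < \<delta> \<longrightarrow>
        (\<Sum>k\<in>d. norm (h (Sup k) - h (Inf k))) < \<epsilon>"
  proof (intro exI[of _ "min d1 d2"] conjI allI impI)
    fix d assume d: "d division_of \<Union>d \<and> \<Union>d \<subseteq> I \<and> (\<Sum>k\<in>d. measure lborel k) < min d1 d2"
    have "(\<Sum>k\<in>d. norm (h (Sup k) - h (Inf k))) \<le>
        (\<Sum>k\<in>d. C * (norm (f (Sup k) - f (Inf k)) + norm (g (Sup k) - g (Inf k))))"
    proof (rule sum_mono)
      fix k assume k: "k \<in> d"
      have "Inf k \<le> Sup k" "Inf k \<in> I" "Sup k \<in> I"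
        using division_elem[of d "\<Union>d" k] d k by blast+
      then show "norm (h (Sup k) - h (Inf k)) \<le> C * (norm (f (Sup k) - f (Inf k)) + norm (g (Sup k) - g (Inf k)))"
        using dom by blast
    qed
    also have "\<dots> = C * ((\<Sum>k\<in>d. norm (f (Sup k) - f (Inf k))) + (\<Sum>k\<in>d. norm (g (Sup k) - g (Inf k))))"
      by (simp add: sum_distrib_left[symmetric] sum.distrib)
    also have "\<dots> \<le> C * (\<epsilon> / (2 * (C + 1)) + \<epsilon> / (2 * (C + 1)))"
      using d1(2)[of d] d2(2)[of d] d \<open>C \<ge> 0\<close> by (intro mult_left_mono add_mono) auto
    also have "\<dots> = C / (C + 1) * \<epsilon>" using \<open>C \<ge> 0\<close> by (simp add: divide_simps)
    also have "\<dots> < 1 * \<epsilon>" using \<open>\<epsilon> > 0\<close> \<open>C \<ge> 0\<close> by (intro mult_strict_right_mono) auto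
    also have "\<dots> = \<epsilon>" by simp
    finally show "(\<Sum>k\<in>d. norm (h (Sup k) - h (Inf k))) < \<epsilon>" .
  qed (use d1 d2 in auto)
qed

lemma ac_on_ident: "ac_on I (\<lambda>x::real. x)"
  unfolding ac_on_def
proof (intro allI impI)
  fix \<epsilon> :: real assume "\<epsilon> > 0"
  show "\<exists>\<delta>>0. \<forall>d. d division_of \<Union>d \<and> \<Union>d \<subseteq> I \<and> (\<Sum>k\<in>d. measure lborel k) < \<delta> \<longrightarrow>
        (\<Sum>k\<in>d. norm (Sup k - Inf k)) < \<epsilon>"
  proof (intro exI[of _ "\<epsilon>"] conjI allI impI)
    fix d assume d: "d division_of \<Union>d \<and> \<Union>d \<subseteq> I \<and> (\<Sum>k\<in>d. measure lborel k) < \<epsilon>"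
    have "(\<Sum>k\<in>d. norm (Sup k - Inf k)) = (\<Sum>k\<in>d. measure lborel k)"
    proof (rule sum.cong[OF refl])
      fix k assume k: "k \<in> d"
      have "measure lborel k = Sup k - Inf k" "Inf k \<le> Sup k"
        using division_elem[of d "\<Union>d" k] d k by blast+
      then show "norm (Sup k - Inf k) = measure lborel k" by simp
    qed
    with d show "(\<Sum>k\<in>d. norm (Sup k - Inf k)) < \<epsilon>" by simp
  qed fact
qed

lemma ac_on_lipschitz:
  assumes "C \<ge> 0" and "\<And>x y. x \<in> I \<Longrightarrow> y \<in> I \<Longrightarrow> x \<le> y \<Longrightarrow> norm (h y - h x) \<le> C * (y - x)"
  shows "ac_on I h"
proof (rule ac_on_dominated[OF ac_on_ident ac_on_ident \<open>C \<ge> 0\<close>])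
  fix x y assume "x \<in> I" "y \<in> I" "x \<le> y"
  then have "norm (h y - h x) \<le> C * (y - x)" by (rule assms(2))
  also have "\<dots> \<le> C * (norm (y - x) + norm (y - x))"
    using \<open>x \<le> y\<close> \<open>C \<ge> 0\<close> by (intro mult_left_mono) auto
  finally show "norm (h y - h x) \<le> C * (norm (y - x) + norm (y - x))" .
qed

lemma division_increment:
  fixes f :: "real \<Rightarrow> 'a::real_normed_vector"
  assumes "a \<le> b" "d division_of {a..b}"
  shows "(\<Sum>k\<in>d. f (Sup k) - f (Inf k)) = f b - f a"
proof -
  let ?f = "(\<lambda>K::real set. if K = {} then 0 else f(interval_upperbound K) - f(interval_lowerbound K))"
  interpret operative_real plus 0 ?f
    rewrites "comm_monoid_set.F (+) 0 = sum"
    by standard[1] (auto simp add: sum_def)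
  have "(\<Sum>k\<in>d. f (Sup k) - f (Inf k)) = sum ?f d"
  proof (rule sum.cong[OF refl])
    fix k assume k: "k \<in> d"
    obtain u v where uv: "u \<le> v" "k = {u..v}" "Inf k = u" "Sup k = v"
      using assms(2) k by (rule division_elemE)
    then show "f (Sup k) - f (Inf k) = ?f k" by simp
  qed
  also have "\<dots> = ?f (cbox a b)"
    using division[of d a b] assms(2) by simp
  also have "\<dots> = f b - f a" using assms by simp
  finally show ?thesis .
qed

lemma division_length:
  fixes d :: "real set set"
  assumes "a \<le> b" "d division_of {a..b}"
  shows "(\<Sum>k\<in>d. measure lborel k) = b - a"
proof -
  have "(\<Sum>k\<in>d. measure lborel k) = (\<Sum>k\<in>d. Sup k - Inf k)"
  proof (rule sum.cong[OF refl])
    fix k assume k: "k \<in> d"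
    show "measure lborel k = Sup k - Inf k" using division_elem[OF assms(2) k] by blast
  qed
  also have "\<dots> = b - a" using division_increment[OF assms, of "\<lambda>x. x"] by simp
  finally show ?thesis .
qed

section \<open>Differentiability almost everywhere\<close>

text \<open>A finite form of the Vitali covering theorem on the line: if every point of \<open>N\<close> lies in arbitrarily
short intervals with the property \<open>P\<close>, finitely many non-overlapping ones cover \<open>N\<close> up to measure
\<open>\<epsilon>\<close>.\<close>

lemma vitali_finite_division:
  fixes N G :: "real set"
  assumes N: "N \<in> lmeasurable" and "open G" "N \<subseteq> G" "\<epsilon> > 0"
    and fine: "\<And>x \<eta>. x \<in> N \<Longrightarrow> \<eta> > 0 \<Longrightarrow> \<exists>u v. u < x \<and> x < v \<and> v - u < \<eta> \<and> P u v"
  obtains d where "d division_of \<Union>d" "\<Union>d \<subseteq> G" "\<And>k. k \<in> d \<Longrightarrow> \<exists>u v. u < v \<and> k = {u..v} \<and> P u v"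
    "measure lebesgue (N - \<Union>d) < \<epsilon>"
proof -
  define K where "K = {(u,v). u < v \<and> {u..v} \<subseteq> G \<and> P u v}"
  define c r where "c = (\<lambda>(u,v). (u + v) / 2 :: real)" and "r = (\<lambda>(u,v). (v - u) / 2 :: real)"
  have cb: "cball (c (u,v)) (r (u,v)) = {u..v}" for u v
    unfolding c_def r_def cball_eq_atLeastAtMost by (simp add: field_simps)
  have K1: "\<exists>i. i \<in> K \<and> x \<in> cball (c i) (r i) \<and> r i < e" if "x \<in> N" "e > 0" for x e
  proof -
    obtain e' where e': "e' > 0" "cball x e' \<subseteq> G" using \<open>open G\<close> \<open>N \<subseteq> G\<close> \<open>x \<in> N\<close> by (meson open_contains_cball subsetD)
    obtain u v where uv: "u < x" "x < v" "v - u < min e e'" "P u v" using fine[OF \<open>x \<in> N\<close>, of "min e e'"] e'(1) \<open>e > 0\<close> by (metis min_less_iff_conj)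
    have "{u..v} \<subseteq> cball x e'" using uv by (auto simp: cball_def dist_real_def)
    then have "(u,v) \<in> K" using uv e' by (auto simp: K_def)
    moreover have "r (u,v) < e" using uv by (auto simp: r_def)
    ultimately show ?thesis using cb[of u v] uv by (intro exI[of _ "(u,v)"]) auto
  qed
  have K0: "0 < r i" if "i \<in> K" for i using that by (auto simp: K_def r_def)
  obtain C where C: "countable C" "C \<subseteq> K"
     "pairwise (\<lambda>i j. disjnt (cball (c i) (r i)) (cball (c j) (r j))) C"
     "negligible (N - (\<Union>i \<in> C. cball (c i) (r i)))"
    by (rule Vitali_covering_theorem_cballs[of K r N c, OF K0 K1])
  define \<D> where "\<D> = (\<lambda>i. N \<inter> cball (c i) (r i)) ` C"
  have UD: "\<Union>\<D> = N \<inter> (\<Union>i\<in>C. cball (c i) (r i))" by (auto simp: \<D>_def)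
  have meas: "measure lebesgue (\<Union>\<D>) = measure lebesgue N"
  proof (rule measure_negligible_symdiff[OF N])
    show "negligible (N - \<Union>\<D> \<union> (\<Union>\<D> - N))"
      unfolding UD by (rule negligible_subset[OF C(4)]) blast
  qed
  have lm: "x \<in> lmeasurable" if "x \<in> \<D>" for x
  proof -
    obtain i where "x = N \<inter> cball (c i) (r i)" using \<open>x \<in> \<D>\<close> by (auto simp: \<D>_def)
    then show ?thesis using N by (simp add: fmeasurable_Int_fmeasurable)
  qed
  obtain D' where D': "D' \<subseteq> \<D>" "finite D'" "measure lebesgue (\<Union>\<D>) - \<epsilon> < measure lebesgue (\<Union>D')"
  proof (rule measure_countable_Union_approachable[of \<D> \<epsilon> "measure lebesgue N"])
    show "countable \<D>" using C by (simp add: \<D>_def)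
    show "measure lebesgue (\<Union>D') \<le> measure lebesgue N" if "D' \<subseteq> \<D>" "finite D'" for D'
      using that lm N by (intro measure_mono_fmeasurable fmeasurableD fmeasurable.finite_Union) (auto simp: \<D>_def)
  qed (use lm \<open>\<epsilon> > 0\<close> in auto)
  obtain C' where C': "C' \<subseteq> C" "finite C'" "D' = (\<lambda>i. N \<inter> cball (c i) (r i)) ` C'"
    using D'(1,2) unfolding \<D>_def by (meson finite_subset_image)
  define d where "d = (\<lambda>i. cball (c i) (r i)) ` C'"
  have dK: "\<exists>u v. u < v \<and> k = {u..v} \<and> P u v \<and> {u..v} \<subseteq> G" if "k \<in> d" for k
  proof -
    obtain i where "i \<in> C'" "k = cball (c i) (r i)" using \<open>k \<in> d\<close> unfolding d_def by blast
    moreover obtain u v where "i = (u,v)" by (cases i)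
    ultimately show ?thesis using C'(1) C(2) cb[of u v] by (auto simp: K_def)
  qed
  have div: "d division_of \<Union>d"
  proof (rule division_ofI)
    show "finite d" using C' by (simp add: d_def)
    show "k \<noteq> {}" if "k \<in> d" for k using dK[OF that] by auto
    show "\<exists>a b. k = cbox a b" if "k \<in> d" for k using dK[OF that] by auto
    show "interior k1 \<inter> interior k2 = {}" if k: "k1 \<in> d" "k2 \<in> d" "k1 \<noteq> k2" for k1 k2
    proof -
      obtain i where i: "i \<in> C'" "k1 = cball (c i) (r i)" using k(1) unfolding d_def by blast
      obtain j where j: "j \<in> C'" "k2 = cball (c j) (r j)" using k(2) unfolding d_def by blast
      have ij: "i \<in> C" "j \<in> C" "i \<noteq> j" using i j C'(1) k(3) by auto
      have "disjnt k1 k2" using C(3) ij unfolding pairwise_def i j by blast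
      then show ?thesis using interior_subset[of k1] interior_subset[of k2] unfolding disjnt_def by blast
    qed
  qed auto
  have sub: "\<Union>d \<subseteq> G" using dK by fastforce
  have ND: "N \<inter> \<Union>d = \<Union>D'" by (auto simp: C'(3) d_def)
  have lmD: "\<Union>D' \<in> lmeasurable" using D'(1,2) lm by (intro fmeasurable.finite_Union) auto
  have "N - \<Union>d = N - \<Union>D'" using ND by auto
  then have "measure lebesgue (N - \<Union>d) = measure lebesgue N - measure lebesgue (\<Union>D')"
    using ND measurable_measure_Diff[OF N fmeasurableD[OF lmD]] by auto
  with D'(3) meas have "measure lebesgue (N - \<Union>d) < \<epsilon>" by simp
  with div sub dK that show thesis by meson
qed

text \<open>Suppose that every point of \<open>N\<close> lies in arbitrarily short intervals on which \<open>f\<close> has slope at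
least \<open>\<eta>\<close>, and in others with slope at most \<open>- \<eta>\<close>.  Cover \<open>N\<close> almost exactly by intervals of the
second kind, and then cover \<open>N\<close> inside each of them by intervals of the first kind.  On the part
that is left over, which has small measure, \<open>f\<close> must decrease by about \<open>2 * \<eta>\<close> times the measure of
\<open>N\<close>.  Absolute continuity permits this only if \<open>N\<close> has measure zero.\<close>

lemma ac_on_oscillation_negligible:
  fixes f :: "real \<Rightarrow> real"
  assumes ac: "ac_on {a..b} f" and N: "N \<in> lmeasurable" "N \<subseteq> {a<..<b}" and "\<eta> > 0"
    and up: "\<And>x \<delta>. x \<in> N \<Longrightarrow> \<delta> > 0 \<Longrightarrow> \<exists>u v. u < x \<and> x < v \<and> v - u < \<delta> \<and> \<eta> * (v - u) \<le> f v - f u"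
    and dn: "\<And>x \<delta>. x \<in> N \<Longrightarrow> \<delta> > 0 \<Longrightarrow> \<exists>u v. u < x \<and> x < v \<and> v - u < \<delta> \<and> f v - f u \<le> - \<eta> * (v - u)"
  shows "negligible N"
proof -
  define \<mu> where "\<mu> = measure lebesgue N"
  have "\<mu> = 0"
  proof (rule ccontr)
    assume "\<mu> \<noteq> 0"
    then have \<mu>: "\<mu> > 0" unfolding \<mu>_def by (simp add: zero_less_measure_iff)
    then have pos: "\<eta> * \<mu> / 2 > 0" using \<open>\<eta> > 0\<close> by simp
    obtain \<delta>0 where \<delta>0: "\<delta>0 > 0" "\<And>d. d division_of \<Union>d \<Longrightarrow> \<Union>d \<subseteq> {a..b} \<Longrightarrow> (\<Sum>k\<in>d. measure lborel k) < \<delta>0 \<Longrightarrow>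
        (\<Sum>k\<in>d. norm (f (Sup k) - f (Inf k))) < \<eta> * \<mu> / 2"
      by (rule ac_onD[OF ac pos]) blast
    define \<delta> where "\<delta> = min \<delta>0 \<mu> / 2"
    have \<delta>: "\<delta> > 0" "2 * \<delta> \<le> \<delta>0" "2 * \<delta> \<le> \<mu>" using \<delta>0(1) \<mu> by (auto simp: \<delta>_def)
    obtain T where T: "open T" "N \<subseteq> T" "T - N \<in> lmeasurable" "emeasure lebesgue (T - N) < ennreal \<delta>"
      using sets_lebesgue_outer_open[OF fmeasurableD[OF N(1)] \<delta>(1)] by blast
    have mT: "measure lebesgue (T - N) < \<delta>"
      using T(3,4) \<delta>(1) by (simp add: emeasure_eq_measure2 ennreal_less_iff)
    define G where "G = T \<inter> {a<..<b}"
    have G: "open G" "N \<subseteq> G" "G \<subseteq> {a<..<b}" using T N by (auto simp: G_def)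
    have GN: "G - N \<in> lmeasurable"
    proof -
      have "G - N = (T - N) \<inter> {a<..<b}" by (auto simp: G_def)
      then show ?thesis using T(3) by (simp add: fmeasurable_Int_fmeasurable)
    qed
    have mG: "measure lebesgue (G - N) < \<delta>"
    proof -
      have "measure lebesgue (G - N) \<le> measure lebesgue (T - N)"
        using GN T(3) by (intro measure_mono_fmeasurable fmeasurableD) (auto simp: G_def)
      with mT show ?thesis by simp
    qed
    \<comment> \<open>The first covering, by intervals on which \<open>f\<close> decreases.\<close>
    obtain \<I> where \<I>: "\<I> division_of \<Union>\<I>" "\<Union>\<I> \<subseteq> G"
      "\<And>k. k \<in> \<I> \<Longrightarrow> \<exists>u v. u < v \<and> k = {u..v} \<and> f v - f u \<le> - \<eta> * (v - u)"
      "measure lebesgue (N - \<Union>\<I>) < \<delta>"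
      by (rule vitali_finite_division[OF N(1) G(1,2) \<delta>(1) dn]) (assumption | rule that)+
    have fin: "finite \<I>" using \<I>(1) by (rule division_of_finite)
    have \<I>u: "Inf I < Sup I \<and> I = {Inf I..Sup I} \<and> f (Sup I) - f (Inf I) \<le> - \<eta> * (Sup I - Inf I)" if "I \<in> \<I>" for I
      using \<I>(3)[OF that] by force
    define c where "c = real (card \<I>) + 1"
    have c: "c > 0" "real (card \<I>) < c" by (auto simp: c_def)
    \<comment> \<open>The second covering, inside each of them, by intervals on which \<open>f\<close> increases; it is completed to a division.\<close>
    have "\<exists>q J. J \<subseteq> q \<and> q division_of I \<and> measure lebesgue (N \<inter> interior I - \<Union>J) < \<delta> / c \<and>
        (\<forall>k\<in>J. \<eta> * (Sup k - Inf k) \<le> f (Sup k) - f (Inf k))" if I: "I \<in> \<I>" for I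
    proof -
      have NI: "N \<inter> interior I \<in> lmeasurable" using N(1) by (simp add: fmeasurable_Int_fmeasurable)
      obtain J where J: "J division_of \<Union>J" "\<Union>J \<subseteq> interior I"
        "\<And>k. k \<in> J \<Longrightarrow> \<exists>u v. u < v \<and> k = {u..v} \<and> \<eta> * (v - u) \<le> f v - f u"
        "measure lebesgue (N \<inter> interior I - \<Union>J) < \<delta> / c"
        by (rule vitali_finite_division[OF NI open_interior[of I], where \<epsilon> = "\<delta> / c" and P = "\<lambda>u v. \<eta> * (v - u) \<le> f v - f u"])
          (use c \<delta> up in auto)
      have Ib: "cbox (Inf I) (Sup I) = I" using \<I>u[OF I] by simp
      have "\<Union>J \<subseteq> cbox (Inf I) (Sup I)" using J(2) interior_subset[of I] unfolding Ib by blast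
      then obtain q where "J \<subseteq> q" "q division_of cbox (Inf I) (Sup I)"
        by (rule partial_division_extend_interval[OF J(1)])
      moreover have "\<eta> * (Sup k - Inf k) \<le> f (Sup k) - f (Inf k)" if "k \<in> J" for k
        using J(3)[OF that] by force
      ultimately show ?thesis using J(4) unfolding Ib by blast
    qed
    then obtain q J where qJ: "\<And>I. I \<in> \<I> \<Longrightarrow> J I \<subseteq> q I" "\<And>I. I \<in> \<I> \<Longrightarrow> q I division_of I"
      "\<And>I. I \<in> \<I> \<Longrightarrow> measure lebesgue (N \<inter> interior I - \<Union>(J I)) < \<delta> / c"
      "\<And>I k. I \<in> \<I> \<Longrightarrow> k \<in> J I \<Longrightarrow> \<eta> * (Sup k - Inf k) \<le> f (Sup k) - f (Inf k)"
      by metis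
    have qfin: "finite (q I)" if "I \<in> \<I>" for I using qJ(2)[OF that] by (rule division_of_finite)
    define U where "U = (\<Union>I\<in>\<I>. q I)"
    \<comment> \<open>The intervals left over; neighbouring members of \<open>\<I>\<close> could share degenerate ones.\<close>
    define r where "r = (\<Union>I\<in>\<I>. {k \<in> q I - J I. interior k \<noteq> {}})"
    have interU: "interior k1 \<inter> interior k2 = {}" if "I1 \<in> \<I>" "I2 \<in> \<I>" "k1 \<in> q I1" "k2 \<in> q I2" "k1 \<noteq> k2" for I1 I2 k1 k2
    proof (cases "I1 = I2")
      case True
      then show ?thesis using division_ofD(5)[OF qJ(2)[OF that(1)]] that by blast
    next
      case False
      have "interior k1 \<subseteq> interior I1" "interior k2 \<subseteq> interior I2"
        using division_ofD(2)[OF qJ(2)] that by (auto intro!: interior_mono)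
      then show ?thesis using division_ofD(5)[OF \<I>(1) that(1,2) False] by blast
    qed
    have Udiv: "U division_of \<Union>\<I>"
      unfolding U_def
    proof (rule division_ofI)
      show "finite (\<Union>I\<in>\<I>. q I)" using fin qfin by auto
      show "k \<noteq> {}" if "k \<in> (\<Union>I\<in>\<I>. q I)" for k using that division_ofD(3)[OF qJ(2)] by blast
      show "\<exists>a b. k = cbox a b" if "k \<in> (\<Union>I\<in>\<I>. q I)" for k using that division_ofD(4)[OF qJ(2)] by blast
      show "interior k1 \<inter> interior k2 = {}" if "k1 \<in> (\<Union>I\<in>\<I>. q I)" "k2 \<in> (\<Union>I\<in>\<I>. q I)" "k1 \<noteq> k2" for k1 k2
        using that interU by blast
      have U1: "\<Union>(\<Union>I\<in>\<I>. q I) = (\<Union>I\<in>\<I>. \<Union>(q I))" by blast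
      show U2: "\<Union>(\<Union>I\<in>\<I>. q I) = \<Union>\<I>" unfolding U1 using division_ofD(6)[OF qJ(2)] by auto
      show "k \<subseteq> \<Union>\<I>" if "k \<in> (\<Union>I\<in>\<I>. q I)" for k using that U2 by blast
    qed
    have rU: "r \<subseteq> U" by (auto simp: r_def U_def)
    have Udiv': "U division_of \<Union>U" using Udiv division_ofD(6)[OF Udiv] by simp
    have rdiv: "r division_of \<Union>r" by (rule division_of_subset[OF Udiv' rU])
    have "\<Union>r \<subseteq> \<Union>\<I>" using Union_mono[OF rU] division_ofD(6)[OF Udiv] by simp
    then have "\<Union>r \<subseteq> {a<..<b}" using \<I>(2) G(3) by (meson subset_trans)
    then have rsub: "\<Union>r \<subseteq> {a..b}" using greaterThanLessThan_subseteq_atLeastAtMost_iff[of a b a b] by (meson order_refl subset_trans)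
    have disj: "{k \<in> q I1 - J I1. interior k \<noteq> {}} \<inter> {k \<in> q I2 - J I2. interior k \<noteq> {}} = {}"
      if "I1 \<in> \<I>" "I2 \<in> \<I>" "I1 \<noteq> I2" for I1 I2
    proof -
      have "interior k = {}" if "k \<in> q I1" "k \<in> q I2" for k
      proof -
        have "interior k \<subseteq> interior I1" "interior k \<subseteq> interior I2"
          using division_ofD(2)[OF qJ(2)] that \<open>I1 \<in> \<I>\<close> \<open>I2 \<in> \<I>\<close> by (auto intro!: interior_mono)
        then show ?thesis using division_ofD(5)[OF \<I>(1) \<open>I1 \<in> \<I>\<close> \<open>I2 \<in> \<I>\<close> \<open>I1 \<noteq> I2\<close>] by blast
      qed
      then show ?thesis by blast
    qed
    \<comment> \<open>Degenerate intervals contribute nothing to increments, so dropping them does no harm.\<close>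
    have sumr: "(\<Sum>k\<in>r. g (Sup k) - g (Inf k)) = 
      (\<Sum>I\<in>\<I>. g (Sup I) - g (Inf I) - (\<Sum>k\<in>J I. g (Sup k) - g (Inf k)))" for g :: "real \<Rightarrow> real"
    proof -
      have "(\<Sum>k\<in>r. g (Sup k) - g (Inf k)) = (\<Sum>I\<in>\<I>. \<Sum>k\<in>{k \<in> q I - J I. interior k \<noteq> {}}. g (Sup k) - g (Inf k))"
        unfolding r_def
      proof (rule sum.UNION_disjoint[OF fin])
        show "\<forall>I\<in>\<I>. finite {k \<in> q I - J I. interior k \<noteq> {}}" using qfin by simp
      qed (use disj in blast)
      also have "\<dots> = (\<Sum>I\<in>\<I>. g (Sup I) - g (Inf I) - (\<Sum>k\<in>J I. g (Sup k) - g (Inf k)))"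
      proof (rule sum.cong[OF refl])
        fix I assume I: "I \<in> \<I>"
        have "(\<Sum>k\<in>{k \<in> q I - J I. interior k \<noteq> {}}. g (Sup k) - g (Inf k)) = (\<Sum>k\<in>q I - J I. g (Sup k) - g (Inf k))"
        proof (rule sum.mono_neutral_left)
          show "\<forall>k\<in>q I - J I - {k \<in> q I - J I. interior k \<noteq> {}}. g (Sup k) - g (Inf k) = 0"
          proof
            fix k assume k: "k \<in> q I - J I - {k \<in> q I - J I. interior k \<noteq> {}}"
            then have kq: "k \<in> q I" "interior k = {}" by auto
            have e: "k = {Inf k..Sup k}" "Inf k \<le> Sup k" using division_elem[OF qJ(2)[OF I] kq(1)] by blast+
            have "{Inf k<..<Sup k} = {}" using kq(2) e by (metis interior_atLeastAtMost_real)
            then have "Sup k = Inf k" using e(2) by auto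
            then show "g (Sup k) - g (Inf k) = 0" by simp
          qed
        qed (use qfin[OF I] in auto)
        also have "\<dots> = (\<Sum>k\<in>q I. g (Sup k) - g (Inf k)) - (\<Sum>k\<in>J I. g (Sup k) - g (Inf k))"
          by (rule sum_diff[OF qfin[OF I] qJ(1)[OF I]])
        also have "(\<Sum>k\<in>q I. g (Sup k) - g (Inf k)) = g (Sup I) - g (Inf I)"
        proof (rule division_increment)
          show "Inf I \<le> Sup I" "q I division_of {Inf I..Sup I}" using \<I>u[OF I] qJ(2)[OF I] by auto
        qed
        finally show "(\<Sum>k\<in>{k \<in> q I - J I. interior k \<noteq> {}}. g (Sup k) - g (Inf k)) =
          g (Sup I) - g (Inf I) - (\<Sum>k\<in>J I. g (Sup k) - g (Inf k))" .
      qed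
      finally show ?thesis .
    qed
    have qel: "Inf k \<le> Sup k" "k = {Inf k..Sup k}" if "I \<in> \<I>" "k \<in> q I" for I k
      using division_elem[OF qJ(2)[OF that(1)] that(2)] by blast+
    have piece: "Sup I - Inf I - (\<Sum>k\<in>J I. Sup k - Inf k) \<le> \<delta> / c + measure lebesgue (interior I - N)" if I: "I \<in> \<I>" for I
    proof -
      have fJ: "finite (J I)" using qfin[OF I] qJ(1)[OF I] finite_subset by blast
      have Jm: "k \<in> lmeasurable" "measure lebesgue k = Sup k - Inf k" if "k \<in> J I" for k
      proof -
        have "k \<in> q I" using that qJ(1)[OF I] by blast
        note e = qel[OF I this]
        show "k \<in> lmeasurable" by (subst e(2)) (rule lmeasurable_interval)
        show "measure lebesgue k = Sup k - Inf k" using e(1) by (subst e(2)) simp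
      qed
      have UJ: "\<Union>(J I) \<in> lmeasurable" using fJ Jm by (intro fmeasurable.finite_Union) auto
      have iI: "interior I = {Inf I<..<Sup I}" using \<I>u[OF I] by (metis interior_atLeastAtMost_real)
      have lI: "interior I \<in> lmeasurable" unfolding iI by simp
      have NI: "N \<inter> interior I \<in> lmeasurable" using N(1) by (simp add: fmeasurable_Int_fmeasurable)
      have IN: "interior I - N \<in> lmeasurable" using lI N(1) by (intro fmeasurable.Diff) auto
      have "Sup I - Inf I = measure lebesgue (interior I)" unfolding iI using \<I>u[OF I] by simp
      also have "interior I = (N \<inter> interior I) \<union> (interior I - N)" by blast
      also have "measure lebesgue \<dots> \<le> measure lebesgue (N \<inter> interior I) + measure lebesgue (interior I - N)"
        using NI IN by (intro measure_Un_le fmeasurableD)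
      also have "measure lebesgue (N \<inter> interior I) \<le> measure lebesgue ((N \<inter> interior I - \<Union>(J I)) \<union> \<Union>(J I))"
        using NI UJ by (intro measure_mono_fmeasurable fmeasurableD fmeasurable.Un fmeasurable.Diff) auto
      also have "\<dots> \<le> measure lebesgue (N \<inter> interior I - \<Union>(J I)) + measure lebesgue (\<Union>(J I))"
        using NI UJ by (intro measure_Un_le fmeasurableD fmeasurable.Diff)
      also have "measure lebesgue (\<Union>(J I)) \<le> (\<Sum>k\<in>J I. measure lebesgue k)"
        using fJ Jm by (intro measure_Union_le) auto
      also have "\<dots> = (\<Sum>k\<in>J I. Sup k - Inf k)" using Jm by simp
      finally show ?thesis using qJ(3)[OF I] by simp
    qed
    have "(\<Sum>I\<in>\<I>. measure lebesgue (interior I - N)) = measure lebesgue (\<Union>I\<in>\<I>. interior I - N)"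
    proof (rule measure_finite_Union[symmetric, OF fin])
      have Im: "interior I - N \<in> lmeasurable" if "I \<in> \<I>" for I
      proof -
        have "interior I = {Inf I<..<Sup I}" using \<I>u[OF that] by (metis interior_atLeastAtMost_real)
        then show ?thesis using N(1) by (intro fmeasurable.Diff) auto
      qed
      then show "(\<lambda>I. interior I - N) ` \<I> \<subseteq> sets lebesgue" by auto
      show "emeasure lebesgue (interior I - N) \<noteq> \<infinity>" if "I \<in> \<I>" for I unfolding infinity_ennreal_def using Im[OF that] by (rule fmeasurableD2)
      show "disjoint_family_on (\<lambda>I. interior I - N) \<I>"
        using division_ofD(5)[OF \<I>(1)] by (auto simp: disjoint_family_on_def)
    qed
    also have "\<dots> \<le> measure lebesgue (G - N)"
    proof (rule measure_mono_fmeasurable[OF _ _ GN])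
      show "(\<Union>I\<in>\<I>. interior I - N) \<subseteq> G - N" using \<I>(2) interior_subset by blast
      show "(\<Union>I\<in>\<I>. interior I - N) \<in> sets lebesgue" using fin N(1) by (intro sets.finite_UN) auto
    qed
    finally have sI: "(\<Sum>I\<in>\<I>. measure lebesgue (interior I - N)) < \<delta>" using mG by simp
    have rel: "Inf k \<le> Sup k" "measure lborel k = Sup k - Inf k" if "k \<in> r" for k
      using division_elem[OF rdiv that] by blast+
    have "(\<Sum>k\<in>r. measure lborel k) = (\<Sum>k\<in>r. Sup k - Inf k)" using rel by simp
    also have "\<dots> = (\<Sum>I\<in>\<I>. Sup I - Inf I - (\<Sum>k\<in>J I. Sup k - Inf k))" using sumr[of "\<lambda>x. x"] .
    also have "\<dots> \<le> (\<Sum>I\<in>\<I>. \<delta> / c + measure lebesgue (interior I - N))" using piece by (rule sum_mono)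
    also have "\<dots> = real (card \<I>) * (\<delta> / c) + (\<Sum>I\<in>\<I>. measure lebesgue (interior I - N))" by (simp add: sum.distrib)
    also have "real (card \<I>) * (\<delta> / c) \<le> c * (\<delta> / c)" using c \<delta>(1) by (intro mult_right_mono) auto
    also have "c * (\<delta> / c) = \<delta>" using c by simp
    finally have "(\<Sum>k\<in>r. measure lborel k) < \<delta>0" using sI \<delta>(2) by simp
    from \<delta>0(2)[OF rdiv rsub this]
    have small: "(\<Sum>k\<in>r. norm (f (Sup k) - f (Inf k))) < \<eta> * \<mu> / 2" .
    have "\<mu> - measure lebesgue (N - \<Union>\<I>) \<le> measure lebesgue (\<Union>\<I>)"
    proof -
      have Im: "I \<in> lmeasurable" if "I \<in> \<I>" for I
        using \<I>u[OF that] by (metis lmeasurable_interval(1) box_real(2))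
      then have UI: "\<Union>\<I> \<in> lmeasurable" using fin by (intro fmeasurable.finite_Union) auto
      have "\<mu> \<le> measure lebesgue ((N - \<Union>\<I>) \<union> \<Union>\<I>)"
        unfolding \<mu>_def using N(1) UI by (intro measure_mono_fmeasurable fmeasurableD fmeasurable.Un fmeasurable.Diff) auto
      also have "\<dots> \<le> measure lebesgue (N - \<Union>\<I>) + measure lebesgue (\<Union>\<I>)"
        using N(1) UI by (intro measure_Un_le fmeasurableD fmeasurable.Diff)
      finally show ?thesis by simp
    qed
    also have "measure lebesgue (\<Union>\<I>) \<le> (\<Sum>I\<in>\<I>. measure lebesgue I)"
      using fin \<I>u by (intro measure_Union_le) (auto, metis sets_completionI_sets atLeastAtMost_borel sets_lborel)
    also have "\<dots> = (\<Sum>I\<in>\<I>. Sup I - Inf I)"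
    proof (rule sum.cong[OF refl])
      fix I assume I: "I \<in> \<I>"
      show "measure lebesgue I = Sup I - Inf I" using \<I>u[OF I] by (metis content_real less_imp_le measure_completion sets_lborel atLeastAtMost_borel)
    qed
    finally have big: "\<mu> / 2 \<le> (\<Sum>I\<in>\<I>. Sup I - Inf I)" using \<I>(4) \<delta>(3) by simp
    have "\<eta> * (\<mu> / 2) \<le> \<eta> * (\<Sum>I\<in>\<I>. Sup I - Inf I)" using big \<open>\<eta> > 0\<close> by simp
    also have "\<dots> = - (\<Sum>I\<in>\<I>. - \<eta> * (Sup I - Inf I))" by (simp add: sum_distrib_left sum_negf[symmetric] algebra_simps)
    also have "\<dots> \<le> - (\<Sum>k\<in>r. f (Sup k) - f (Inf k))"
      unfolding sumr
    proof (simp only: neg_le_iff_le, rule sum_mono)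
      fix I assume I: "I \<in> \<I>"
      have "0 \<le> (\<Sum>k\<in>J I. f (Sup k) - f (Inf k))"
      proof (rule sum_nonneg)
        fix k assume k: "k \<in> J I"
        have "Inf k \<le> Sup k" using qel[OF I] k qJ(1)[OF I] by blast
        then have "0 \<le> \<eta> * (Sup k - Inf k)" using \<open>\<eta> > 0\<close> by simp
        then show "0 \<le> f (Sup k) - f (Inf k)" using qJ(4)[OF I k] by linarith
      qed
      then show "f (Sup I) - f (Inf I) - (\<Sum>k\<in>J I. f (Sup k) - f (Inf k)) \<le> - \<eta> * (Sup I - Inf I)"
        using \<I>u[OF I] by linarith
    qed
    also have "\<dots> \<le> (\<Sum>k\<in>r. norm (f (Sup k) - f (Inf k)))"
      unfolding sum_negf[symmetric] by (rule sum_mono) auto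
    finally show False using small by simp
  qed
  then show ?thesis unfolding \<mu>_def using N(1) by (simp add: negligible_iff_measure0)
qed

text \<open>A function of bounded variation has unbounded difference quotients only on a null set.\<close>

lemma bounded_variation_steep_negligible:
  fixes f :: "real \<Rightarrow> real"
  assumes bv: "\<And>d. d division_of \<Union>d \<Longrightarrow> \<Union>d \<subseteq> {a..b} \<Longrightarrow> (\<Sum>k\<in>d. norm (f (Sup k) - f (Inf k))) \<le> B"
    and N: "N \<in> lmeasurable" "N \<subseteq> {a<..<b}"
    and steep: "\<And>x \<delta> K. x \<in> N \<Longrightarrow> \<delta> > 0 \<Longrightarrow> \<exists>u v. u < x \<and> x < v \<and> v - u < \<delta> \<and> K * (v - u) \<le> \<bar>f v - f u\<bar>"
  shows "negligible N"
proof -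
  define \<mu> where "\<mu> = measure lebesgue N"
  have "\<mu> = 0"
  proof (rule ccontr)
    assume "\<mu> \<noteq> 0"
    then have \<mu>: "\<mu> > 0" unfolding \<mu>_def by (simp add: zero_less_measure_iff)
    have B: "B \<ge> 0" using bv[of "{}"] by simp
    define K where "K = (2 * B + 2) / \<mu>"
    have K: "K \<ge> 0" using \<mu> B by (simp add: K_def)
    have \<mu>2: "\<mu> / 2 > 0" using \<mu> by simp
    obtain d where d: "d division_of \<Union>d" "\<Union>d \<subseteq> {a<..<b}" 
      "\<And>k. k \<in> d \<Longrightarrow> \<exists>u v. u < v \<and> k = {u..v} \<and> K * (v - u) \<le> \<bar>f v - f u\<bar>"
      "measure lebesgue (N - \<Union>d) < \<mu> / 2"
      by (rule vitali_finite_division[OF N(1) open_greaterThanLessThan[of a b] N(2) \<mu>2, of "\<lambda>u v. K * (v - u) \<le> \<bar>f v - f u\<bar>"])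
        (use steep in \<open>assumption | rule that | blast\<close>)+
    have fin: "finite d" using d(1) by (rule division_of_finite)
    have dk: "Inf k \<le> Sup k" "k = {Inf k..Sup k}" if "k \<in> d" for k
      using division_elem[OF d(1) that] by blast+
    have dm: "k \<in> lmeasurable" "measure lebesgue k = Sup k - Inf k" if "k \<in> d" for k
    proof -
      show "k \<in> lmeasurable" by (subst dk(2)[OF that]) (rule lmeasurable_interval)
      show "measure lebesgue k = Sup k - Inf k" using dk(1)[OF that] by (subst dk(2)[OF that]) simp
    qed
    have Ud: "\<Union>d \<in> lmeasurable" using fin dm by (intro fmeasurable.finite_Union) auto
    have "\<mu> \<le> measure lebesgue ((N - \<Union>d) \<union> \<Union>d)"
      unfolding \<mu>_def using N(1) Ud by (intro measure_mono_fmeasurable fmeasurableD fmeasurable.Un fmeasurable.Diff) auto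
    also have "\<dots> \<le> measure lebesgue (N - \<Union>d) + measure lebesgue (\<Union>d)"
      using N(1) Ud by (intro measure_Un_le fmeasurableD fmeasurable.Diff)
    also have "measure lebesgue (\<Union>d) \<le> (\<Sum>k\<in>d. measure lebesgue k)"
      using fin dm by (intro measure_Union_le) auto
    also have "\<dots> = (\<Sum>k\<in>d. Sup k - Inf k)" using dm by simp
    finally have "\<mu> / 2 \<le> (\<Sum>k\<in>d. Sup k - Inf k)" using d(4) by simp
    then have "K * (\<mu> / 2) \<le> K * (\<Sum>k\<in>d. Sup k - Inf k)" using K by (rule mult_left_mono)
    also have "\<dots> = (\<Sum>k\<in>d. K * (Sup k - Inf k))" by (simp add: sum_distrib_left)
    also have "\<dots> \<le> (\<Sum>k\<in>d. norm (f (Sup k) - f (Inf k)))"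
    proof (rule sum_mono)
      fix k assume "k \<in> d"
      show "K * (Sup k - Inf k) \<le> norm (f (Sup k) - f (Inf k))"
        using d(3)[OF \<open>k \<in> d\<close>] by force
    qed
    also have "\<dots> \<le> B"
    proof (rule bv[OF d(1)])
      show "\<Union>d \<subseteq> {a..b}" using d(2) by force
    qed
    finally have "K * (\<mu> / 2) \<le> B" .
    moreover have "K * (\<mu> / 2) = B + 1" using \<mu> by (simp add: K_def field_simps)
    ultimately show False by simp
  qed
  then show ?thesis unfolding \<mu>_def using N(1) by (simp add: negligible_iff_measure0)
qed

text \<open>The points of \<open>{a<..<b}\<close> that lie in arbitrarily short open intervals \<open>{u<..<v}\<close> with \<open>P u v\<close>.
Written as a countable intersection of open sets, so that measurability is evident.\<close>

definition fine_around :: "real \<Rightarrow> real \<Rightarrow> (real \<Rightarrow> real \<Rightarrow> bool) \<Rightarrow> real set" where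
  "fine_around a b P = (\<Inter>n::nat. \<Union>{{u<..<v} | u v. a < u \<and> v < b \<and> v - u < inverse (real (Suc n)) \<and> P u v})"

lemma fine_around_iff:
  "x \<in> fine_around a b P \<longleftrightarrow> (\<forall>\<delta>>0. \<exists>u v. a < u \<and> u < x \<and> x < v \<and> v < b \<and> v - u < \<delta> \<and> P u v)"
proof
  assume x: "x \<in> fine_around a b P"
  show "\<forall>\<delta>>0. \<exists>u v. a < u \<and> u < x \<and> x < v \<and> v < b \<and> v - u < \<delta> \<and> P u v"
  proof (intro allI impI)
    fix \<delta> :: real assume "\<delta> > 0"
    then obtain n where n: "inverse (real (Suc n)) < \<delta>" using reals_Archimedean by blast
    have "x \<in> \<Union>{{u<..<v} | u v. a < u \<and> v < b \<and> v - u < inverse (real (Suc n)) \<and> P u v}"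
      using x unfolding fine_around_def by blast
    then obtain u v where "x \<in> {u<..<v}" "a < u \<and> v < b \<and> v - u < inverse (real (Suc n)) \<and> P u v" by blast
    then show "\<exists>u v. a < u \<and> u < x \<and> x < v \<and> v < b \<and> v - u < \<delta> \<and> P u v" using n by (intro exI[of _ u] exI[of _ v]) auto
  qed
next
  assume R: "\<forall>\<delta>>0. \<exists>u v. a < u \<and> u < x \<and> x < v \<and> v < b \<and> v - u < \<delta> \<and> P u v"
  show "x \<in> fine_around a b P"
    unfolding fine_around_def
  proof (intro INT_I)
    fix n :: nat
    have "inverse (real (Suc n)) > 0" by simp
    then obtain u v where "a < u \<and> u < x \<and> x < v \<and> v < b \<and> v - u < inverse (real (Suc n)) \<and> P u v"
      using R by blast
    then show "x \<in> \<Union>{{u<..<v} | u v. a < u \<and> v < b \<and> v - u < inverse (real (Suc n)) \<and> P u v}"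
      by (intro UnionI[of "{u<..<v}"]) auto
  qed
qed

lemma fine_around_subset: "fine_around a b P \<subseteq> {a<..<b}"
proof
  fix x assume "x \<in> fine_around a b P"
  then have "\<exists>u v. a < u \<and> u < x \<and> x < v \<and> v < b \<and> v - u < 1 \<and> P u v" unfolding fine_around_iff by simp
  then show "x \<in> {a<..<b}" by auto
qed

lemma fine_around_lmeasurable: "fine_around a b P \<in> lmeasurable"
proof -
  have "fine_around a b P \<in> sets borel"
    unfolding fine_around_def
    by (intro sets.countable_INT) (auto intro!: borel_open open_Union)
  then have "fine_around a b P \<in> sets lebesgue" by (simp add: sets_completionI_sets)
  then show ?thesis
    by (rule bounded_set_imp_lmeasurable[rotated]) (rule bounded_subset[OF bounded_box[of a b, unfolded box_real] fine_around_subset])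
qed

text \<open>A derivative exists at \<open>x\<close> if the difference quotients over short intervals around \<open>x\<close> are bounded
and do not oscillate across any pair of rationals \<open>p < q\<close>.  Intervals with \<open>x\<close> in their interior
suffice, by continuity.\<close>

lemma has_real_derivative_if_quotients_bounded:
  fixes f :: "real \<Rightarrow> real"
  assumes cont: "isCont f x" and x: "a < x" "x < b"
    and lip: "\<exists>\<delta>>0. \<forall>u v. a < u \<and> u < x \<and> x < v \<and> v < b \<and> v - u < \<delta> \<longrightarrow> \<bar>f v - f u\<bar> \<le> K * (v - u)"
    and sep: "\<And>p q. p \<in> \<rat> \<Longrightarrow> q \<in> \<rat> \<Longrightarrow> p < q \<Longrightarrow>
      (\<exists>\<delta>>0. \<forall>u v. a < u \<and> u < x \<and> x < v \<and> v < b \<and> v - u < \<delta> \<longrightarrow> f v - f u \<le> q * (v - u)) \<or>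
      (\<exists>\<delta>>0. \<forall>u v. a < u \<and> u < x \<and> x < v \<and> v < b \<and> v - u < \<delta> \<longrightarrow> p * (v - u) \<le> f v - f u)"
  shows "\<exists>D. (f has_real_derivative D) (at x)"
proof -
  define In where "In \<delta> u v \<longleftrightarrow> a < u \<and> u < x \<and> x < v \<and> v < b \<and> v - u < \<delta>" for \<delta> u v :: real
  define up where "up q \<longleftrightarrow> (\<exists>\<delta>>0. \<forall>u v. In \<delta> u v \<longrightarrow> f v - f u \<le> q * (v - u))" for q
  define lo where "lo p \<longleftrightarrow> (\<exists>\<delta>>0. \<forall>u v. In \<delta> u v \<longrightarrow> p * (v - u) \<le> f v - f u)" for p
  have ex: "\<exists>u v. In \<delta>1 u v \<and> In \<delta>2 u v" if "\<delta>1 > 0" "\<delta>2 > 0" for \<delta>1 \<delta>2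
  proof -
    define e where "e = Min {\<delta>1, \<delta>2, x - a, b - x} / 3"
    have e: "e > 0" "3 * e \<le> \<delta>1" "3 * e \<le> \<delta>2" "3 * e \<le> x - a" "3 * e \<le> b - x"
      using that x by (auto simp: e_def)
    show ?thesis using e by (intro exI[of _ "x - e"] exI[of _ "x + e"]) (auto simp: In_def)
  qed
  have up_mono: "up q'" if "up q" "q \<le> q'" for q q'
  proof -
    obtain \<delta> where \<delta>: "\<delta> > 0" "\<And>u v. In \<delta> u v \<Longrightarrow> f v - f u \<le> q * (v - u)" using \<open>up q\<close> unfolding up_def by blast
    have "f v - f u \<le> q' * (v - u)" if "In \<delta> u v" for u v
    proof -
      have "q * (v - u) \<le> q' * (v - u)" using \<open>In \<delta> u v\<close> \<open>q \<le> q'\<close> by (intro mult_right_mono) (auto simp: In_def)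
      then show ?thesis using \<delta>(2)[OF \<open>In \<delta> u v\<close>] by linarith
    qed
    then show ?thesis using \<delta>(1) unfolding up_def by blast
  qed
  have lo_mono: "lo p'" if "lo p" "p' \<le> p" for p p'
  proof -
    obtain \<delta> where \<delta>: "\<delta> > 0" "\<And>u v. In \<delta> u v \<Longrightarrow> p * (v - u) \<le> f v - f u" using \<open>lo p\<close> unfolding lo_def by blast
    have "p' * (v - u) \<le> f v - f u" if "In \<delta> u v" for u v
    proof -
      have "p' * (v - u) \<le> p * (v - u)" using \<open>In \<delta> u v\<close> \<open>p' \<le> p\<close> by (intro mult_right_mono) (auto simp: In_def)
      then show ?thesis using \<delta>(2)[OF \<open>In \<delta> u v\<close>] by linarith
    qed
    then show ?thesis using \<delta>(1) unfolding lo_def by blast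
  qed
  have upK: "up K" and loK: "lo (- K)"
  proof -
    obtain \<delta> where \<delta>: "\<delta> > 0" "\<And>u v. In \<delta> u v \<Longrightarrow> \<bar>f v - f u\<bar> \<le> K * (v - u)"
      using lip unfolding In_def by blast
    show "up K" unfolding up_def using \<delta> by (intro exI[of _ \<delta>]) (auto simp: abs_le_iff)
    have "- K * (v - u) \<le> f v - f u" if "In \<delta> u v" for u v using \<delta>(2)[OF that] by auto
    then show "lo (- K)" unfolding lo_def using \<delta>(1) by blast
  qed
  define D where "D = Inf {q. up q}"
  have lo_up: "p \<le> q" if lop: "lo p" and upq: "up q" for p q
  proof -
    obtain \<delta>1 where \<delta>1: "\<delta>1 > 0" "\<And>u v. In \<delta>1 u v \<Longrightarrow> p * (v - u) \<le> f v - f u"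
      using lop unfolding lo_def by blast
    obtain \<delta>2 where \<delta>2: "\<delta>2 > 0" "\<And>u v. In \<delta>2 u v \<Longrightarrow> f v - f u \<le> q * (v - u)"
      using upq unfolding up_def by blast
    obtain u v where uv: "In \<delta>1 u v" "In \<delta>2 u v" using ex[OF \<delta>1(1) \<delta>2(1)] by blast
    have "p * (v - u) \<le> q * (v - u)" using \<delta>1(2)[OF uv(1)] \<delta>2(2)[OF uv(2)] by linarith
    moreover have "v - u > 0" using uv by (auto simp: In_def)
    ultimately show "p \<le> q" by simp
  qed
  have bdd: "bdd_below {q. up q}" using lo_up[OF loK] by (auto intro!: bdd_belowI[of _ "- K"])
  have upD: "up (D + \<epsilon>)" if "\<epsilon> > 0" for \<epsilon>
  proof -
    have "Inf {q. up q} < D + \<epsilon>" using that by (simp add: D_def)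
    then obtain q where "up q" "q < D + \<epsilon>" using cInf_lessD[of "{q. up q}"] upK by blast
    then show ?thesis using up_mono by simp
  qed
  have loD: "lo (D - \<epsilon>)" if "\<epsilon> > 0" for \<epsilon>
  proof -
    obtain q where q: "q \<in> \<rat>" "D - \<epsilon> < q" "q < D" using Rats_dense_in_real[of "D - \<epsilon>" D] \<open>\<epsilon> > 0\<close> by auto
    obtain p where p: "p \<in> \<rat>" "D - \<epsilon> < p" "p < q" using Rats_dense_in_real[of "D - \<epsilon>" q] q by auto
    have "\<not> up q" using q(3) cInf_lower[OF _ bdd, of q] unfolding D_def by force
    then have "lo p" using sep[OF p(1) q(1) p(3)] unfolding up_def lo_def In_def by blast
    then show ?thesis using lo_mono p by simp
  qed
  have key: "\<exists>\<delta>>0. \<forall>u v. a < u \<and> u \<le> x \<and> x \<le> v \<and> v < b \<and> u < v \<and> v - u < \<delta> \<longrightarrow> \<bar>f v - f u - D * (v - u)\<bar> \<le> \<epsilon> * (v - u)" if "\<epsilon> > 0" for \<epsilon>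
  proof -
    obtain \<delta>1 where \<delta>1: "\<delta>1 > 0" "\<And>u v. In \<delta>1 u v \<Longrightarrow> (D - \<epsilon>) * (v - u) \<le> f v - f u"
      using loD[OF \<open>\<epsilon> > 0\<close>] unfolding lo_def by blast
    obtain \<delta>2 where \<delta>2: "\<delta>2 > 0" "\<And>u v. In \<delta>2 u v \<Longrightarrow> f v - f u \<le> (D + \<epsilon>) * (v - u)"
      using upD[OF \<open>\<epsilon> > 0\<close>] unfolding up_def by blast
    have strict: "\<bar>f v - f u - D * (v - u)\<bar> \<le> \<epsilon> * (v - u)" if "In (min \<delta>1 \<delta>2) u v" for u v
    proof -
      have "In \<delta>1 u v" "In \<delta>2 u v" using that by (auto simp: In_def)
      then show ?thesis using \<delta>1(2)[of u v] \<delta>2(2)[of u v] by (auto simp: abs_le_iff algebra_simps)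
    qed
    have "\<bar>f v - f u - D * (v - u)\<bar> \<le> \<epsilon> * (v - u)"
      if uv: "a < u" "u \<le> x" "x \<le> v" "v < b" "u < v" "v - u < min \<delta>1 \<delta>2" for u v
    proof -
      consider "u < x" "x < v" | "u = x" "x < v" | "u < x" "v = x" using uv by linarith
      then show ?thesis
      proof cases
        case 1 then show ?thesis using strict[of u v] uv by (auto simp: In_def)
      next
        case 2
        have "\<bar>f v - f x - D * (v - x)\<bar> \<le> \<epsilon> * (v - x)"
        proof (rule tendsto_le[of "at_left x"])
          show "((\<lambda>u. \<epsilon> * (v - u)) \<longlongrightarrow> \<epsilon> * (v - x)) (at_left x)" by (intro tendsto_intros)
          have "(f \<longlongrightarrow> f x) (at_left x)" using cont unfolding isCont_def by (rule filterlim_at_split[THEN iffD1, THEN conjunct1])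
          then show "((\<lambda>u. \<bar>f v - f u - D * (v - u)\<bar>) \<longlongrightarrow> \<bar>f v - f x - D * (v - x)\<bar>) (at_left x)" by (intro tendsto_intros)
          have "\<forall>\<^sub>F u in at_left x. u \<in> {max a (v - min \<delta>1 \<delta>2)<..<x}"
            using uv 2 by (intro eventually_at_left_real) auto
          then show "\<forall>\<^sub>F u in at_left x. \<bar>f v - f u - D * (v - u)\<bar> \<le> \<epsilon> * (v - u)"
          proof (rule eventually_mono)
            fix t assume "t \<in> {max a (v - min \<delta>1 \<delta>2)<..<x}"
            then have "a < t" "t < x" "v - t < min \<delta>1 \<delta>2" by (auto simp del: min_less_iff_conj)
            then have "In (min \<delta>1 \<delta>2) t v" using uv(4) 2(2) unfolding In_def by blast
            then show "\<bar>f v - f t - D * (v - t)\<bar> \<le> \<epsilon> * (v - t)" by (rule strict)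
          qed
        qed simp
        then show ?thesis using 2 by simp
      next
        case 3
        have "\<bar>f x - f u - D * (x - u)\<bar> \<le> \<epsilon> * (x - u)"
        proof (rule tendsto_le[of "at_right x"])
          show "((\<lambda>v. \<epsilon> * (v - u)) \<longlongrightarrow> \<epsilon> * (x - u)) (at_right x)" by (intro tendsto_intros)
          have "(f \<longlongrightarrow> f x) (at_right x)" using cont unfolding isCont_def by (rule filterlim_at_split[THEN iffD1, THEN conjunct2])
          then show "((\<lambda>v. \<bar>f v - f u - D * (v - u)\<bar>) \<longlongrightarrow> \<bar>f x - f u - D * (x - u)\<bar>) (at_right x)" by (intro tendsto_intros)
          have "\<forall>\<^sub>F v in at_right x. v \<in> {x<..<min b (u + min \<delta>1 \<delta>2)}"
            using uv 3 by (intro eventually_at_right_real) auto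
          then show "\<forall>\<^sub>F v in at_right x. \<bar>f v - f u - D * (v - u)\<bar> \<le> \<epsilon> * (v - u)"
          proof (rule eventually_mono)
            fix t assume "t \<in> {x<..<min b (u + min \<delta>1 \<delta>2)}"
            then have "x < t" "t < b" "t - u < min \<delta>1 \<delta>2" by (auto simp del: min_less_iff_conj)
            then have "In (min \<delta>1 \<delta>2) u t" using uv(1) 3(1) unfolding In_def by blast
            then show "\<bar>f t - f u - D * (t - u)\<bar> \<le> \<epsilon> * (t - u)" by (rule strict)
          qed
        qed simp
        then show ?thesis using 3 by simp
      qed
    qed
    then show ?thesis using \<delta>1(1) \<delta>2(1) by (intro exI[of _ "min \<delta>1 \<delta>2"]) auto
  qed
  have "(f has_real_derivative D) (at x)"
    unfolding has_field_derivative_iff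
  proof (rule tendstoI)
    fix e :: real assume "e > 0"
    then obtain \<delta> where \<delta>: "\<delta> > 0" "\<And>u v. a < u \<and> u \<le> x \<and> x \<le> v \<and> v < b \<and> u < v \<and> v - u < \<delta> \<Longrightarrow> \<bar>f v - f u - D * (v - u)\<bar> \<le> e / 2 * (v - u)"
      using key[of "e / 2"] by auto
    have "dist ((f y - f x) / (y - x)) D < e" if y: "y \<noteq> x" "dist y x < Min {\<delta>, x - a, b - x}" for y
    proof -
      have "\<bar>f y - f x - D * (y - x)\<bar> \<le> e / 2 * \<bar>y - x\<bar>"
      proof (cases "x < y")
        case True
        then show ?thesis using \<delta>(2)[of x y] y x by (auto simp: dist_real_def)
      next
        case False
        then have "\<bar>f x - f y - D * (x - y)\<bar> \<le> e / 2 * (x - y)" using \<delta>(2)[of y x] y x by (auto simp: dist_real_def)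
        moreover have "f y - f x - D * (y - x) = - (f x - f y - D * (x - y))" by (simp add: algebra_simps)
        moreover have "\<bar>y - x\<bar> = x - y" using False by simp
        ultimately show ?thesis by (simp only: abs_minus_cancel)
      qed
      also have "\<dots> < e * \<bar>y - x\<bar>" using y \<open>e > 0\<close> by simp
      finally have "\<bar>f y - f x - D * (y - x)\<bar> / \<bar>y - x\<bar> < e" using y by (simp add: divide_less_eq)
      moreover have "(f y - f x) / (y - x) - D = (f y - f x - D * (y - x)) / (y - x)" using y by (simp add: field_simps)
      ultimately show ?thesis by (simp add: dist_real_def)
    qed
    then show "\<forall>\<^sub>F y in at x. dist ((f y - f x) / (y - x)) D < e"
      unfolding eventually_at using \<delta>(1) x by (intro exI[of _ "Min {\<delta>, x - a, b - x}"]) auto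
  qed
  then show ?thesis by blast
qed

text \<open>Differentiability almost everywhere.  For \<open>p < q\<close> the set where the quotients oscillate across
\<open>{p..q}\<close> is null by the oscillation lemma, applied to \<open>f\<close> minus the linear function of slope
\<open>(p + q) / 2\<close>.  The bound on the variation is automatic on short intervals, and these are all that is
needed below.\<close>

lemma ac_on_differentiable_almost_everywhere:
  fixes f :: "real \<Rightarrow> real"
  assumes cont: "continuous_on {a..b} f" and ac: "ac_on {a..b} f"
    and bv: "\<And>d. d division_of \<Union>d \<Longrightarrow> \<Union>d \<subseteq> {a..b} \<Longrightarrow> (\<Sum>k\<in>d. norm (f (Sup k) - f (Inf k))) \<le> B"
  shows "\<exists>N. negligible N \<and> (\<forall>x\<in>{a<..<b} - N. \<exists>D. (f has_real_derivative D) (at x))"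
proof -
  define Z where "Z = (\<Inter>n::nat. fine_around a b (\<lambda>u v. real n * (v - u) \<le> \<bar>f v - f u\<bar>))"
  define W where "W p q = fine_around a b (\<lambda>u v. q * (v - u) \<le> f v - f u) \<inter> fine_around a b (\<lambda>u v. f v - f u \<le> p * (v - u))" for p q
  have Zm: "Z \<in> lmeasurable"
  proof (rule bounded_set_imp_lmeasurable)
    have "Z \<subseteq> {a<..<b}" unfolding Z_def using fine_around_subset by blast
    then show "bounded Z" by (rule bounded_subset[OF bounded_box[of a b, unfolded box_real]])
    show "Z \<in> sets lebesgue" unfolding Z_def
      by (intro sets.countable_INT) (auto intro: fmeasurableD fine_around_lmeasurable)
  qed
  have nZ: "negligible Z"
  proof (rule bounded_variation_steep_negligible[OF bv Zm])
    show "Z \<subseteq> {a<..<b}" unfolding Z_def using fine_around_subset by blast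
    fix x \<delta> K :: real assume x: "x \<in> Z" and "\<delta> > 0"
    obtain n :: nat where n: "K \<le> real n" using real_arch_simple by blast
    have "x \<in> fine_around a b (\<lambda>u v. real n * (v - u) \<le> \<bar>f v - f u\<bar>)" using x unfolding Z_def by blast
    then obtain u v where uv: "a < u" "u < x" "x < v" "v < b" "v - u < \<delta>" "real n * (v - u) \<le> \<bar>f v - f u\<bar>"
      unfolding fine_around_iff using \<open>\<delta> > 0\<close> by blast
    have "K * (v - u) \<le> real n * (v - u)" using n uv by (intro mult_right_mono) auto
    also have "\<dots> \<le> \<bar>f v - f u\<bar>" by (rule uv(6))
    finally show "\<exists>u v. u < x \<and> x < v \<and> v - u < \<delta> \<and> K * (v - u) \<le> \<bar>f v - f u\<bar>"
      using uv by (intro exI[of _ u] exI[of _ v]) auto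
  qed
  have nW: "negligible (W p q)" if "p < q" for p q
  proof -
    define c where "c = (p + q) / 2"
    have "ac_on {a..b} (\<lambda>x. f x - c * x)"
    proof (rule ac_on_dominated[OF ac ac_on_ident, where C = "1 + \<bar>c\<bar>"])
      fix x y :: real
      have "norm (f y - c * y - (f x - c * x)) = \<bar>(f y - f x) - c * (y - x)\<bar>" by (simp add: algebra_simps)
      also have "\<dots> \<le> \<bar>f y - f x\<bar> + \<bar>c\<bar> * \<bar>y - x\<bar>" using abs_triangle_ineq4[of "f y - f x" "c * (y - x)"] by (simp add: abs_mult)
      also have "\<dots> \<le> (1 + \<bar>c\<bar>) * (\<bar>f y - f x\<bar> + \<bar>y - x\<bar>)" by (simp add: algebra_simps)
      finally show "norm (f y - c * y - (f x - c * x)) \<le> (1 + \<bar>c\<bar>) * (norm (f y - f x) + norm (y - x))" by simp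
    qed simp
    moreover have "W p q \<in> lmeasurable" unfolding W_def by (intro fmeasurable.Int fine_around_lmeasurable)
    moreover have "W p q \<subseteq> {a<..<b}" unfolding W_def using fine_around_subset by blast
    moreover have "(q - p) / 2 > 0" using that by simp
    ultimately show ?thesis
    proof (rule ac_on_oscillation_negligible)
      fix x \<delta> :: real assume x: "x \<in> W p q" and "\<delta> > 0"
      have x1: "x \<in> fine_around a b (\<lambda>u v. q * (v - u) \<le> f v - f u)" and x2: "x \<in> fine_around a b (\<lambda>u v. f v - f u \<le> p * (v - u))"
        using x unfolding W_def by auto
      obtain u v where uv: "u < x" "x < v" "v - u < \<delta>" "q * (v - u) \<le> f v - f u"
        using x1 \<open>\<delta> > 0\<close> unfolding fine_around_iff by blast
      have "(q - p) / 2 * (v - u) = q * (v - u) - c * v + c * u" by (simp add: c_def field_simps)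
      then show "\<exists>u v. u < x \<and> x < v \<and> v - u < \<delta> \<and> (q - p) / 2 * (v - u) \<le> f v - c * v - (f u - c * u)"
        using uv by (intro exI[of _ u] exI[of _ v]) auto
      obtain u v where uv: "u < x" "x < v" "v - u < \<delta>" "f v - f u \<le> p * (v - u)"
        using x2 \<open>\<delta> > 0\<close> unfolding fine_around_iff by blast
      have "- ((q - p) / 2) * (v - u) = p * (v - u) - c * v + c * u" by (simp add: c_def field_simps)
      then show "\<exists>u v. u < x \<and> x < v \<and> v - u < \<delta> \<and> f v - c * v - (f u - c * u) \<le> - ((q - p) / 2) * (v - u)"
        using uv by (intro exI[of _ u] exI[of _ v]) auto
    qed
  qed
  define N where "N = Z \<union> (\<Union>(p,q)\<in>{(p,q). p \<in> \<rat> \<and> q \<in> \<rat> \<and> p < q}. W p q)"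
  show ?thesis
  proof (intro exI[of _ N] conjI ballI)
    have "countable {(p,q). p \<in> \<rat> \<and> q \<in> \<rat> \<and> p < (q::real)}"
      by (rule countable_subset[OF _ countable_SIGMA[OF countable_rat, of "\<lambda>_. \<rat>"]]) (auto intro: countable_rat)
    then show "negligible N" unfolding N_def
      using nZ nW by (intro negligible_Un negligible_countable_Union) auto
  next
    fix x assume x: "x \<in> {a<..<b} - N"
    have "x \<in> interior {a..b}" using x by auto
    then have cx: "isCont f x" using cont by (metis continuous_on_interior)
    have xZ: "x \<notin> Z" using x by (auto simp: N_def)
    then obtain n :: nat where n: "x \<notin> fine_around a b (\<lambda>u v. real n * (v - u) \<le> \<bar>f v - f u\<bar>)" unfolding Z_def by blast
    show "\<exists>D. (f has_real_derivative D) (at x)"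
    proof (rule has_real_derivative_if_quotients_bounded[OF cx, of a b "real n"])
      show "a < x" "x < b" using x by auto
      show "\<exists>\<delta>>0. \<forall>u v. a < u \<and> u < x \<and> x < v \<and> v < b \<and> v - u < \<delta> \<longrightarrow> \<bar>f v - f u\<bar> \<le> real n * (v - u)"
        using n unfolding fine_around_iff by (meson linear)
      fix p q :: real assume pq: "p \<in> \<rat>" "q \<in> \<rat>" "p < q"
      then have "x \<notin> W p q" using x by (auto simp: N_def)
      then show "(\<exists>\<delta>>0. \<forall>u v. a < u \<and> u < x \<and> x < v \<and> v < b \<and> v - u < \<delta> \<longrightarrow> f v - f u \<le> q * (v - u)) \<or>
        (\<exists>\<delta>>0. \<forall>u v. a < u \<and> u < x \<and> x < v \<and> v < b \<and> v - u < \<delta> \<longrightarrow> p * (v - u) \<le> f v - f u)"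
        unfolding W_def fine_around_iff Int_iff by (meson linear)
    qed
  qed
qed

section \<open>The fundamental theorem of calculus\<close>

text \<open>The fundamental theorem of calculus, as a Henstock--Kurzweil integral: tags in the exceptional set
are kept in an open set of small measure, where the increments are small by absolute continuity.\<close>

lemma ac_on_has_integral_derivative:
  fixes F :: "real \<Rightarrow> real"
  assumes ac: "ac_on {a..b} F" and "a \<le> b" and N: "negligible N"
    and der: "\<And>x. x \<in> {a<..<b} - N \<Longrightarrow> (F has_real_derivative h x) (at x)"
  shows "(h has_integral F b - F a) {a..b}"
proof -
  define N' where "N' = N \<union> {a, b}"
  have N': "negligible N'" unfolding N'_def using N by (intro negligible_Un) auto
  define h0 where "h0 x = (if x \<in> N' then 0 else h x)" for x
  have "(h0 has_integral F b - F a) {a..b}"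
    unfolding has_integral_real
  proof (intro allI impI)
    fix e :: real assume "e > 0"
    then have e2: "e / 2 > 0" by simp
    obtain \<delta> where \<delta>: "\<delta> > 0" "\<And>d. d division_of \<Union>d \<Longrightarrow> \<Union>d \<subseteq> {a..b} \<Longrightarrow> (\<Sum>k\<in>d. measure lborel k) < \<delta> \<Longrightarrow>
        (\<Sum>k\<in>d. norm (F (Sup k) - F (Inf k))) < e / 2"
      by (rule ac_onD[OF ac e2]) blast
    have nN: "N' \<in> null_sets lebesgue" using N' by (simp add: negligible_iff_null_sets)
    obtain T where T: "open T" "N' \<subseteq> T" "T - N' \<in> lmeasurable" "emeasure lebesgue (T - N') < ennreal \<delta>"
      using sets_lebesgue_outer_open[OF _ \<delta>(1), of N'] nN by blast
    have Tm: "T \<in> lmeasurable" "measure lebesgue T < \<delta>"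
    proof -
      have eq: "T = (T - N') \<union> N'" using T(2) by blast
      have "N' \<in> lmeasurable" using N' by (rule negligible_imp_measurable)
      then show "T \<in> lmeasurable" using T(3) by (subst eq) (intro fmeasurable.Un)
      have "emeasure lebesgue T = emeasure lebesgue (T - N')"
        using emeasure_Diff_null_set[OF nN] T(1) by auto
      then have "measure lebesgue T = measure lebesgue (T - N')" by (simp add: measure_def)
      also have "\<dots> < \<delta>" using T(3,4) \<delta>(1) by (simp add: emeasure_eq_measure2 ennreal_less_iff)
      finally show "measure lebesgue T < \<delta>" .
    qed
    define \<epsilon> where "\<epsilon> = e / (2 * (b - a) + 2)"
    have \<epsilon>: "\<epsilon> > 0" "\<epsilon> * (b - a) < e / 2" using \<open>e > 0\<close> \<open>a \<le> b\<close> by (auto simp: \<epsilon>_def field_simps)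
    have "\<exists>r>0. \<forall>y. \<bar>y - x\<bar> < r \<longrightarrow> \<bar>F y - F x - h x * (y - x)\<bar> \<le> \<epsilon> * \<bar>y - x\<bar>" if "x \<in> {a..b} - N'" for x
    proof -
      have "(F has_derivative (*) (h x)) (at x)" using der[of x] that
        by (auto simp: N'_def has_field_derivative_def)
      then obtain r where "r > 0" "\<forall>y. norm (y - x) < r \<longrightarrow> norm (F y - F x - h x * (y - x)) \<le> \<epsilon> * norm (y - x)"
        using \<epsilon>(1) unfolding has_derivative_at_alt by blast
      then show ?thesis by auto
    qed
    then obtain r where r: "\<And>x. x \<in> {a..b} - N' \<Longrightarrow> r x > 0"
      "\<And>x y. x \<in> {a..b} - N' \<Longrightarrow> \<bar>y - x\<bar> < r x \<Longrightarrow> \<bar>F y - F x - h x * (y - x)\<bar> \<le> \<epsilon> * \<bar>y - x\<bar>"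
      by metis
    define \<gamma> where "\<gamma> x = (if x \<in> N' then T else if x \<in> {a..b} then ball x (r x) else UNIV)" for x
    show "\<exists>\<gamma>. gauge \<gamma> \<and> (\<forall>\<D>. \<D> tagged_division_of {a..b} \<and> \<gamma> fine \<D> \<longrightarrow>
        norm ((\<Sum>(x, k)\<in>\<D>. measure lborel k *\<^sub>R h0 x) - (F b - F a)) < e)"
    proof (intro exI[of _ \<gamma>] conjI allI impI)
      show "gauge \<gamma>" using T r(1) by (auto simp: gauge_def \<gamma>_def)
      fix \<D> assume \<D>: "\<D> tagged_division_of {a..b} \<and> \<gamma> fine \<D>"
      then have \<D>1: "\<D> tagged_division_of {a..b}" by simp
      have fin: "finite \<D>" using \<D>1 by (rule tagged_division_of_finite)
      have el: "Inf k \<le> Sup k \<and> k = {Inf k..Sup k} \<and> measure lborel k = Sup k - Inf k \<and> x \<in> k \<and> k \<subseteq> {a..b} \<and> k \<subseteq> \<gamma> x" if xk: "(x,k) \<in> \<D>" for x k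
      proof -
        obtain u v where k: "k = cbox u v" using tagged_division_ofD(4)[OF \<D>1 xk] by blast
        have xk': "x \<in> k" "k \<subseteq> {a..b}" using tagged_division_ofD(2,3)[OF \<D>1 xk] by auto
        have "k \<subseteq> \<gamma> x" using \<D> xk unfolding fine_def by blast
        then show ?thesis using k xk' by auto
      qed
      define t where "t = (\<lambda>(x,k). measure lborel k * h0 x - (F (Sup k) - F (Inf k)))"
      define A where "A = {p \<in> \<D>. fst p \<in> N'}"
      have "(\<Sum>(x, k)\<in>\<D>. measure lborel k *\<^sub>R h0 x) - (F b - F a) = (\<Sum>p\<in>\<D>. t p)"
        unfolding additive_tagged_division_1[OF \<open>a \<le> b\<close> \<D>1, symmetric] sum_subtractf[symmetric]
        by (rule sum.cong) (auto simp: t_def)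
      also have "\<dots> = (\<Sum>p\<in>A. t p) + (\<Sum>p\<in>\<D> - A. t p)"
        using fin by (subst sum.subset_diff[of A]) (auto simp: A_def)
      finally have split: "norm ((\<Sum>(x, k)\<in>\<D>. measure lborel k *\<^sub>R h0 x) - (F b - F a)) \<le> (\<Sum>p\<in>A. norm (t p)) + (\<Sum>p\<in>\<D> - A. norm (t p))"
        by (metis add_mono norm_sum norm_triangle_le)
      have good: "(\<Sum>p\<in>\<D> - A. norm (t p)) \<le> \<epsilon> * (b - a)"
      proof -
        have "(\<Sum>p\<in>\<D> - A. norm (t p)) \<le> (\<Sum>p\<in>\<D> - A. \<epsilon> * measure lborel (snd p))"
        proof (rule sum_mono)
          fix p assume p: "p \<in> \<D> - A"
          obtain x k where xk: "p = (x,k)" by (cases p)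
          have x: "(x,k) \<in> \<D>" "x \<notin> N'" using p xk by (auto simp: A_def)
          note e = el[OF x(1)]
          define u v where "u = Inf k" "v = Sup k"
          have xab: "x \<in> {a..b} - N'" using e x by blast
          then have "\<gamma> x = ball x (r x)" by (auto simp: \<gamma>_def)
          moreover have kuv: "k = {u..v}" using e unfolding u_v_def by blast
          ultimately have "{u..v} \<subseteq> ball x (r x)" "x \<in> {u..v}" using e by blast+
          then have uv: "u \<le> x" "x \<le> v" "measure lborel k = v - u" "{u..v} \<subseteq> ball x (r x)" 
            using kuv by auto
          have "u \<in> {u..v}" "v \<in> {u..v}" using uv by auto
          then have "u \<in> ball x (r x)" "v \<in> ball x (r x)" using uv(4) by blast+
          then have "\<bar>u - x\<bar> < r x" "\<bar>v - x\<bar> < r x" by (auto simp: dist_real_def abs_minus_commute)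
          from r(2)[OF xab this(1)] r(2)[OF xab this(2)]
          have "\<bar>F u - F x - h x * (u - x)\<bar> \<le> \<epsilon> * (x - u)" "\<bar>F v - F x - h x * (v - x)\<bar> \<le> \<epsilon> * (v - x)"
            using uv by auto
          moreover have "(v - u) * h x - (F v - F u) = (F u - F x - h x * (u - x)) - (F v - F x - h x * (v - x))"
            by (simp add: algebra_simps)
          ultimately have "\<bar>(v - u) * h x - (F v - F u)\<bar> \<le> \<epsilon> * (x - u) + \<epsilon> * (v - x)" by linarith
          also have "\<dots> = \<epsilon> * (v - u)" by (simp add: algebra_simps)
          finally show "norm (t p) \<le> \<epsilon> * measure lborel (snd p)"
            using x(2) uv(3) by (simp add: t_def xk h0_def u_v_def)
        qed
        also have "\<dots> \<le> (\<Sum>p\<in>\<D>. \<epsilon> * measure lborel (snd p))"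
          using fin \<epsilon>(1) by (intro sum_mono2) (auto simp: content_pos_le)
        also have "\<dots> = \<epsilon> * (\<Sum>(x,k)\<in>\<D>. measure lborel k)" by (simp add: sum_distrib_left case_prod_unfold)
        also have "(\<Sum>(x,k)\<in>\<D>. measure lborel k) = b - a"
          using additive_content_tagged_division[of \<D> a b] \<D>1 \<open>a \<le> b\<close> by simp
        finally show ?thesis .
      qed
      have bad: "(\<Sum>p\<in>A. norm (t p)) < e / 2"
      proof -
        have Ap: "A tagged_partial_division_of {a..b}"
          using \<D>1 tagged_partial_division_subset[of \<D> "{a..b}" A] unfolding tagged_division_of_def A_def by auto
        have At: "A tagged_division_of \<Union>(snd ` A)" by (rule tagged_partial_division_of_Union_self[OF Ap])
        have Ad: "(snd ` A) division_of \<Union>(snd ` A)" by (rule partial_division_of_tagged_division[OF Ap])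
        have "(\<Sum>p\<in>A. norm (t p)) = (\<Sum>(x,k)\<in>A. norm (F (Sup k) - F (Inf k)))"
          by (rule sum.cong) (auto simp: A_def t_def h0_def norm_minus_commute)
        also have "\<dots> = (\<Sum>k\<in>snd ` A. norm (F (Sup k) - F (Inf k)))"
        proof -
          define d where "d k = (if k = {} then 0 else norm (F (Sup k) - F (Inf k)))" for k
          have ne: "k \<noteq> {}" if "(x,k) \<in> A" for x k using el[of x k] that by (auto simp: A_def)
          have "(\<Sum>(x,k)\<in>A. d k) = sum d (snd ` A)"
          proof (rule sum.over_tagged_division_lemma[OF At])
            show "d (cbox u v) = 0" if "box u v = {}" for u v using that by (auto simp: d_def)
          qed
          moreover have "(\<Sum>(x,k)\<in>A. d k) = (\<Sum>(x,k)\<in>A. norm (F (Sup k) - F (Inf k)))"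
            using ne by (intro sum.cong) (auto simp: d_def)
          moreover have "sum d (snd ` A) = (\<Sum>k\<in>snd ` A. norm (F (Sup k) - F (Inf k)))"
            using ne by (intro sum.cong) (auto simp: d_def)
          ultimately show ?thesis by simp
        qed
        also have "\<dots> < e / 2"
        proof (rule \<delta>(2)[OF Ad])
          show "\<Union>(snd ` A) \<subseteq> {a..b}" using el by (fastforce simp: A_def)
          have sub: "\<Union>(snd ` A) \<subseteq> T"
          proof -
            have "k \<subseteq> T" if "(x,k) \<in> A" for x k
              using that el[of x k] by (auto simp: A_def \<gamma>_def)
            then show ?thesis by force
          qed
          have "(\<Sum>k\<in>snd ` A. measure lborel k) = (\<Sum>k\<in>snd ` A. measure lebesgue k)"
          proof (rule sum.cong[OF refl])
            fix k assume "k \<in> snd ` A"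
            then have k: "k = {Inf k..Sup k}" using division_elem(2)[OF Ad] by blast
            show "measure lborel k = measure lebesgue k" by (subst (1 2) k) simp
          qed
          also have "\<dots> = measure lebesgue (\<Union>(snd ` A))" by (rule content_division[OF Ad])
          also have "\<dots> \<le> measure lebesgue T"
            by (rule measure_mono_fmeasurable[OF sub fmeasurableD[OF lmeasurable_division[OF Ad]] Tm(1)])
          finally show "(\<Sum>k\<in>snd ` A. measure lborel k) < \<delta>" using Tm(2) by simp
        qed
        finally show ?thesis .
      qed
      show "norm ((\<Sum>(x, k)\<in>\<D>. measure lborel k *\<^sub>R h0 x) - (F b - F a)) < e"
        using split good bad \<epsilon>(2) by linarith
    qed
  qed
  then show ?thesis
    by (rule has_integral_spike[OF N', rotated]) (auto simp: h0_def)
qed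

text \<open>The form used for actions.  The function \<open>G\<close> is arbitrary; for a non-measurable integrand,
\<open>nn_integral\<close> is the lower integral.\<close>

lemma ac_on_increment_le_nn_integral:
  fixes F :: "real \<Rightarrow> real"
  assumes ac: "ac_on {a..b} F" and "a \<le> b" and N: "negligible N"
    and der: "\<And>x. x \<in> {a<..<b} - N \<Longrightarrow> \<exists>D. (F has_real_derivative D) (at x) \<and> ennreal D \<le> G x"
  shows "ennreal (F b - F a) \<le> (\<integral>\<^sup>+x\<in>{a..b}. G x \<partial>lborel)"
proof -
  obtain h where h: "\<And>x. x \<in> {a<..<b} - N \<Longrightarrow> (F has_real_derivative h x) (at x) \<and> ennreal (h x) \<le> G x"
    using der by metis
  have int: "(h has_integral F b - F a) {a..b}"
    by (rule ac_on_has_integral_derivative[OF ac \<open>a \<le> b\<close> N]) (use h in blast)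
  define g where "g x = max 0 (h x) * indicator {a..b} x" for x
  have hm: "(\<lambda>x. h x * indicator {a..b} x) \<in> lebesgue \<rightarrow>\<^sub>M borel"
    by (rule has_integral_implies_lebesgue_measurable_real[OF int])
  have "g = (\<lambda>x. max 0 (h x * indicator {a..b} x))" by (auto simp: g_def fun_eq_iff indicator_def)
  then have gm: "g \<in> lebesgue \<rightarrow>\<^sub>M borel" using hm by simp
  have g0: "0 \<le> g x" for x by (simp add: g_def)
  have le: "(\<integral>\<^sup>+x. ennreal (g x) \<partial>lebesgue) \<le> (\<integral>\<^sup>+x\<in>{a..b}. G x \<partial>lborel)"
  proof -
    have "AE x in lebesgue. x \<notin> N \<union> {a,b}"
    proof (rule AE_not_in)
      have "negligible (N \<union> {a,b})" using N by (intro negligible_Un) auto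
      then show "N \<union> {a,b} \<in> null_sets lebesgue" by (simp add: negligible_iff_null_sets)
    qed
    then have "(\<integral>\<^sup>+x. ennreal (g x) \<partial>lebesgue) \<le> (\<integral>\<^sup>+x. G x * indicator {a..b} x \<partial>lebesgue)"
    proof (intro nn_integral_mono_AE, elim AE_mp, intro AE_I2 impI)
      fix x assume x: "x \<notin> N \<union> {a, b}"
      show "ennreal (g x) \<le> G x * indicator {a..b} x"
      proof (cases "x \<in> {a..b}")
        case True
        then have "ennreal (h x) \<le> G x" using h x by auto
        then show ?thesis using True by (simp add: g_def max_def)
      qed (simp add: g_def)
    qed
    then show ?thesis by (simp add: nn_integral_completion)
  qed
  have main: "ennreal (F b - F a) \<le> (\<integral>\<^sup>+x. ennreal (g x) \<partial>lebesgue)"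
  proof (cases "(\<integral>\<^sup>+x. ennreal (g x) \<partial>lebesgue) = \<infinity>")
    case False
    then obtain r where r: "r \<ge> 0" "(\<integral>\<^sup>+x. ennreal (g x) \<partial>lebesgue) = ennreal r"
      by (cases "(\<integral>\<^sup>+x. ennreal (g x) \<partial>lebesgue)") auto
    have I1: "(g has_integral r) UNIV"
      using has_integral_iff_nn_integral_lebesgue[of g r, OF g0] gm r by simp
    have I2: "((\<lambda>x. if x \<in> {a..b} then h x else 0) has_integral F b - F a) UNIV"
      unfolding has_integral_restrict_UNIV by (rule int)
    have "F b - F a \<le> r"
      by (rule has_integral_le[OF I2 I1]) (auto simp: g_def)
    then show ?thesis using r by (simp add: ennreal_leI)
  qed simp
  show ?thesis using main le by (rule order_trans)
qed

section \<open>Bounded variation and Lipschitz reparametrizations\<close>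

text \<open>A function \<open>V\<close> with \<open>norm (\<sigma> v - \<sigma> u) \<le> V v - V u\<close> controls the variation of \<open>\<sigma>\<close>.  Such control
functions are easier to concatenate than variations.\<close>

lemma control_division:
  fixes V :: "real \<Rightarrow> real" and \<sigma> :: "real \<Rightarrow> 'a::real_normed_vector"
  assumes V: "\<And>u v. a \<le> u \<Longrightarrow> u \<le> v \<Longrightarrow> v \<le> b \<Longrightarrow> norm (\<sigma> v - \<sigma> u) \<le> V v - V u"
    and "a \<le> b" "d division_of {a..b}"
  shows "(\<Sum>k\<in>d. norm (\<sigma> (Sup k) - \<sigma> (Inf k))) \<le> V b - V a"
proof -
  have "(\<Sum>k\<in>d. norm (\<sigma> (Sup k) - \<sigma> (Inf k))) \<le> (\<Sum>k\<in>d. V (Sup k) - V (Inf k))"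
  proof (rule sum_mono)
    fix k assume k: "k \<in> d"
    have "Inf k \<le> Sup k" "Inf k \<in> {a..b}" "Sup k \<in> {a..b}"
      using division_elem[OF assms(3) k] by blast+
    then show "norm (\<sigma> (Sup k) - \<sigma> (Inf k)) \<le> V (Sup k) - V (Inf k)" using V by auto
  qed
  also have "\<dots> = V b - V a" by (rule division_increment[OF assms(2,3)])
  finally show ?thesis .
qed

lemma division_insert_right:
  fixes d :: "real set set"
  assumes d: "d division_of {a..u}" and "a \<le> u" "u < v"
  shows "insert {u..v} d division_of {a..v}" "{u..v} \<notin> d"
proof -
  have sub: "k \<subseteq> {a..u}" if "k \<in> d" for k using division_ofD(2)[OF d that] .
  show nin: "{u..v} \<notin> d"
  proof
    assume "{u..v} \<in> d"
    then have "{u..v} \<subseteq> {a..u}" by (rule sub)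
    moreover have "v \<in> {u..v}" using \<open>u < v\<close> by simp
    ultimately have "v \<in> {a..u}" by blast
    then show False using \<open>u < v\<close> by simp
  qed
  have int: "interior k \<inter> interior {u..v} = {}" if "k \<in> d" for k
  proof -
    have "interior k \<subseteq> {a<..<u}" using interior_mono[OF sub[OF that]] by (simp add: interior_atLeastAtMost_real)
    then show ?thesis by (auto simp: interior_atLeastAtMost_real)
  qed
  show "insert {u..v} d division_of {a..v}"
  proof (rule division_ofI)
    show "finite (insert {u..v} d)" using d by auto
    show "\<Union>(insert {u..v} d) = {a..v}" using division_ofD(6)[OF d] assms by auto
    show "k \<noteq> {}" if "k \<in> insert {u..v} d" for k using that division_ofD(3)[OF d] \<open>u < v\<close> by auto
    show "\<exists>a b. k = cbox a b" if "k \<in> insert {u..v} d" for k using that division_ofD(4)[OF d] by auto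
    show "k \<subseteq> {a..v}" if "k \<in> insert {u..v} d" for k using that sub assms by fastforce
    show "interior k1 \<inter> interior k2 = {}" if k: "k1 \<in> insert {u..v} d" "k2 \<in> insert {u..v} d" "k1 \<noteq> k2" for k1 k2
    proof -
      consider "k1 \<in> d" "k2 \<in> d" | "k1 = {u..v}" "k2 \<in> d" | "k1 \<in> d" "k2 = {u..v}" using k by blast
      then show ?thesis
      proof cases
        case 1 then show ?thesis using division_ofD(5)[OF d] k(3) by blast
      next
        case 2 then show ?thesis using int[of k2] by blast
      next
        case 3 then show ?thesis using int[of k1] by blast
      qed
    qed
  qed
qed

text \<open>Conversely, the variation of \<open>\<sigma>\<close> up to time \<open>t\<close> is a control function.\<close>

lemma bounded_variation_control:
  fixes \<sigma> :: "real \<Rightarrow> 'a::real_normed_vector"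
  assumes "a \<le> b" and bv: "\<And>d. d division_of {a..b} \<Longrightarrow> (\<Sum>k\<in>d. norm (\<sigma> (Sup k) - \<sigma> (Inf k))) \<le> B"
  obtains V :: "real \<Rightarrow> real" where "V a = 0" "V b \<le> B"
    "\<And>u v. a \<le> u \<Longrightarrow> u \<le> v \<Longrightarrow> v \<le> b \<Longrightarrow> norm (\<sigma> v - \<sigma> u) \<le> V v - V u"
proof -
  define s where "s d = (\<Sum>k\<in>d. norm (\<sigma> (Sup k) - \<sigma> (Inf k)))" for d
  define V where "V t = (SUP d\<in>{d. d division_of {a..t}}. s d)" for t
  have ne: "{d. d division_of {a..t}} \<noteq> {}" if "a \<le> t" for t
    using division_of_self[of a t] that by auto
  have ins: "s (insert {u..v} d) = s d + norm (\<sigma> v - \<sigma> u)" if "d division_of {a..u}" "a \<le> u" "u < v" for d u v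
    using division_insert_right(2)[OF that] that division_of_finite[OF that(1)] by (simp add: s_def)
  have le_B: "s d \<le> B" if d: "d division_of {a..t}" and t: "a \<le> t" "t \<le> b" for d t
  proof (cases "t = b")
    case True then show ?thesis using bv d by (simp add: s_def)
  next
    case False
    then have "t < b" using t by simp
    have "s d \<le> s (insert {t..b} d)" using ins[OF d t(1) \<open>t < b\<close>] by simp
    also have "\<dots> \<le> B" using bv[OF division_insert_right(1)[OF d t(1) \<open>t < b\<close>]] by (simp add: s_def)
    finally show ?thesis .
  qed
  have bdd: "bdd_above (s ` {d. d division_of {a..t}})" if "a \<le> t" "t \<le> b" for t
    using le_B that by (intro bdd_aboveI[of _ B]) auto
  show thesis
  proof (rule that[of V])
    have "{d. d division_of {a..a}} = {{{a..a}}}" using division_of_sing[of _ a] by auto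
    then show "V a = 0" by (simp add: V_def s_def)
    show "V b \<le> B" unfolding V_def using le_B[of _ b] \<open>a \<le> b\<close> ne by (intro cSUP_least) auto
    fix u v assume uv: "a \<le> u" "u \<le> v" "v \<le> b"
    show "norm (\<sigma> v - \<sigma> u) \<le> V v - V u"
    proof (cases "u = v")
      case False
      then have "u < v" using uv by simp
      have "V u \<le> V v - norm (\<sigma> v - \<sigma> u)"
        unfolding V_def[of u]
      proof (rule cSUP_least[OF ne[OF uv(1)]])
        fix d assume "d \<in> {d. d division_of {a..u}}"
        then have d: "d division_of {a..u}" by simp
        have "s d + norm (\<sigma> v - \<sigma> u) = s (insert {u..v} d)" using ins[OF d uv(1) \<open>u < v\<close>] by simp
        also have "\<dots> \<le> V v" unfolding V_def
          using division_insert_right(1)[OF d uv(1) \<open>u < v\<close>] bdd[of v] uv by (intro cSUP_upper) auto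
        finally show "s d \<le> V v - norm (\<sigma> v - \<sigma> u)" by simp
      qed
      then show ?thesis by simp
    qed simp
  qed
qed

text \<open>A continuous path of length at most \<open>\<nu>\<close> has a reparametrization over \<open>{0..1}\<close> with Lipschitz
constant \<open>\<nu>\<close>.  Running time is read off from a generalized inverse of the control function \<open>V\<close>, so
that continuity of \<open>V\<close> is not needed: where \<open>V\<close> jumps, the path itself does not.\<close>

lemma lipschitz_reparametrization:
  fixes f :: "real \<Rightarrow> 'a::real_normed_vector"
  assumes "0 < T" and cont: "continuous_on {0..T} f"
    and bv: "\<And>d. d division_of {0..T} \<Longrightarrow> (\<Sum>k\<in>d. norm (f (Sup k) - f (Inf k))) \<le> \<nu>"
  obtains g where "g ` {0..1} \<subseteq> f ` {0..T}" "g (0::real) = f 0" "g 1 = f T"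
    "\<And>s s'. 0 \<le> s \<Longrightarrow> s \<le> s' \<Longrightarrow> s' \<le> 1 \<Longrightarrow> norm (g s' - g s) \<le> \<nu> * (s' - s)"
proof -
  have "0 \<le> T" using \<open>0 < T\<close> by simp
  then obtain V :: "real \<Rightarrow> real" where V: "V 0 = 0" "V T \<le> \<nu>"
    "\<And>u v. 0 \<le> u \<Longrightarrow> u \<le> v \<Longrightarrow> v \<le> T \<Longrightarrow> norm (f v - f u) \<le> V v - V u"
    using bounded_variation_control[OF _ bv] by blast
  have mono: "V u \<le> V v" if "0 \<le> u" "u \<le> v" "v \<le> T" for u v
    using V(3)[OF that] norm_ge_zero[of "f v - f u"] by linarith
  have "\<nu> \<ge> 0" using mono[of 0 T] V \<open>0 < T\<close> by simp
  \<comment> \<open>\<open>\<tau> s\<close> is the last time up to which at most the length \<open>\<nu> * s\<close> has been used; \<open>\<tau> 0 = 0\<close> fixes the starting point.\<close>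
  define A where "A s = {t \<in> {0..T}. V t \<le> \<nu> * s}" for s
  define \<tau> where "\<tau> s = (if s = 0 then 0 else Sup (A s))" for s
  have A0: "0 \<in> A s" if "0 \<le> s" for s using that \<open>\<nu> \<ge> 0\<close> \<open>0 < T\<close> V(1) by (simp add: A_def)
  have Abdd: "bdd_above (A s)" for s by (rule bdd_aboveI[of _ T]) (auto simp: A_def)
  have \<tau>r: "0 \<le> \<tau> s" "\<tau> s \<le> T" if "0 \<le> s" for s
  proof -
    show "0 \<le> \<tau> s" using cSup_upper[OF A0[OF that] Abdd] by (simp add: \<tau>_def)
    have "Sup (A s) \<le> T" using A0[OF that] by (intro cSup_least) (auto simp: A_def)
    then show "\<tau> s \<le> T" using \<open>0 < T\<close> by (simp add: \<tau>_def)
  qed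
  have above: "\<nu> * s \<le> V t" if "0 \<le> s" "\<tau> s < t" "t \<le> T" for s t
  proof (cases "s = 0")
    case True
    then show ?thesis using mono[of 0 t] V(1) that by (simp add: \<tau>_def)
  next
    case False
    then have "Sup (A s) < t" using that by (simp add: \<tau>_def)
    then have "t \<notin> A s" using cSup_upper[OF _ Abdd[of s], of t] by force
    moreover have "0 \<le> t" using \<tau>r(1)[OF \<open>0 \<le> s\<close>] that by simp
    ultimately show ?thesis using that by (simp add: A_def)
  qed
  have below: "V t \<le> \<nu> * s" if "0 \<le> s" "0 \<le> t" "t < \<tau> s" for s t
  proof -
    have "t < Sup (A s)" using that by (auto simp: \<tau>_def split: if_splits)
    then obtain t' where t': "t' \<in> A s" "t < t'" using A0[OF \<open>0 \<le> s\<close>] less_cSup_iff[OF _ Abdd[of s], of t] by blast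
    then have "V t \<le> V t'" using that by (intro mono) (auto simp: A_def)
    then show ?thesis using t' by (simp add: A_def)
  qed
  have \<tau>mono: "\<tau> s \<le> \<tau> s'" if "0 \<le> s" "s \<le> s'" for s s'
  proof (cases "s = 0")
    case True then show ?thesis using \<tau>r(1)[of s'] that by (simp add: \<tau>_def)
  next
    case False
    have "\<nu> * s \<le> \<nu> * s'" using \<open>\<nu> \<ge> 0\<close> that by (intro mult_left_mono) auto
    then have "A s \<subseteq> A s'" by (auto simp: A_def)
    then have "Sup (A s) \<le> Sup (A s')" using A0[OF that(1)] Abdd by (intro cSup_subset_mono) auto
    then show ?thesis using False that by (simp add: \<tau>_def)
  qed
  show thesis
  proof (rule that[of "f \<circ> \<tau>"])
    show "(f \<circ> \<tau>) ` {0..1} \<subseteq> f ` {0..T}" using \<tau>r by auto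
    show "(f \<circ> \<tau>) 0 = f 0" by (simp add: \<tau>_def)
    have "T \<in> A 1" using V(2) \<open>0 < T\<close> by (simp add: A_def)
    then have "T \<le> \<tau> 1" using cSup_upper[OF _ Abdd] by (simp add: \<tau>_def)
    then have "\<tau> 1 = T" using \<tau>r(2)[of 1] by simp
    then show "(f \<circ> \<tau>) 1 = f T" by simp
    fix s s' :: real assume s: "0 \<le> s" "s \<le> s'" "s' \<le> 1"
    show "norm ((f \<circ> \<tau>) s' - (f \<circ> \<tau>) s) \<le> \<nu> * (s' - s)"
    proof (cases "\<tau> s = \<tau> s'")
      case True then show ?thesis using \<open>\<nu> \<ge> 0\<close> s by simp
    next
      case False
      then have lt: "\<tau> s < \<tau> s'" using \<tau>mono[of s s'] s by simp
      define h where "h n = (\<tau> s' - \<tau> s) / (real n + 3)" for n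
      have h: "0 < h n" "2 * h n \<le> \<tau> s' - \<tau> s" for n
      proof -
        show "0 < h n" using lt by (simp add: h_def)
        have "2 * (\<tau> s' - \<tau> s) \<le> (real n + 3) * (\<tau> s' - \<tau> s)" using lt by (intro mult_right_mono) auto
        then show "2 * h n \<le> \<tau> s' - \<tau> s" by (simp add: h_def field_simps)
      qed
      have h0: "h \<longlonglongrightarrow> 0"
      proof -
        have "(\<lambda>n. (\<tau> s' - \<tau> s) * inverse (real (n + 3))) \<longlonglongrightarrow> (\<tau> s' - \<tau> s) * 0"
          by (intro tendsto_mult_left LIMSEQ_ignore_initial_segment[OF lim_inverse_n])
        then show ?thesis unfolding h_def by (simp add: divide_inverse)
      qed
      have rng: "\<tau> s + h n \<in> {0..T}" "\<tau> s' - h n \<in> {0..T}" for n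
        using h[of n] \<tau>r[of s] \<tau>r[of s'] s by auto
      have l1: "(\<lambda>n. f (\<tau> s + h n)) \<longlonglongrightarrow> f (\<tau> s)"
      proof (rule continuous_on_tendsto_compose[OF cont])
        show "(\<lambda>n. \<tau> s + h n) \<longlonglongrightarrow> \<tau> s" using tendsto_add[OF tendsto_const h0] by simp
      qed (use rng \<tau>r s in auto)
      have l2: "(\<lambda>n. f (\<tau> s' - h n)) \<longlonglongrightarrow> f (\<tau> s')"
      proof (rule continuous_on_tendsto_compose[OF cont])
        show "(\<lambda>n. \<tau> s' - h n) \<longlonglongrightarrow> \<tau> s'" using tendsto_diff[OF tendsto_const h0] by simp
      qed (use rng \<tau>r s in auto)
      have "norm (f (\<tau> s') - f (\<tau> s)) \<le> \<nu> * (s' - s)"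
      proof (rule LIMSEQ_le_const2[OF tendsto_norm[OF tendsto_diff[OF l2 l1]]], intro exI allI impI)
        fix n
        have "norm (f (\<tau> s' - h n) - f (\<tau> s + h n)) \<le> V (\<tau> s' - h n) - V (\<tau> s + h n)"
          using h[of n] rng[of n] by (intro V(3)) auto
        also have "\<dots> \<le> \<nu> * s' - \<nu> * s"
          using below[of s' "\<tau> s' - h n"] above[of s "\<tau> s + h n"] h[of n] rng[of n] s by auto
        finally show "norm (f (\<tau> s' - h n) - f (\<tau> s + h n)) \<le> \<nu> * (s' - s)" by (simp add: algebra_simps)
      qed
      then show ?thesis by simp
    qed
  qed
qed

section \<open>Paths at Frechet distance zero\<close>

text \<open>Frechet distance zero, spelled out: suitable changes of parameterization make the two paths
uniformly close.\<close>

definition close_params :: "'n::finite param \<Rightarrow> 'n param \<Rightarrow> bool" where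
  "close_params p q \<longleftrightarrow> (\<forall>\<epsilon>>0. \<exists>\<alpha> \<beta>. reparam (fst p) \<alpha> \<and> reparam (fst q) \<beta> \<and>
     (\<forall>t\<in>{0..1}. dist (snd p (\<alpha> t)) (snd q (\<beta> t)) < \<epsilon>))"

lemma close_params_sym: "close_params p q \<Longrightarrow> close_params q p"
  unfolding close_params_def by (simp add: dist_commute) blast

lemma reparam_range: "reparam T \<alpha> \<Longrightarrow> t \<in> {0..1} \<Longrightarrow> \<alpha> t \<in> {0..T}"
  unfolding reparam_def mono_on_def by (metis atLeastAtMost_iff order_refl zero_le_one)

lemma reparam_scale: "0 < T \<Longrightarrow> reparam T (\<lambda>t. t * T)"
  unfolding reparam_def by (auto intro!: continuous_intros mono_onI mult_right_mono)

lemma reparam_surj: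
  assumes "reparam T \<alpha>" "t \<in> {0..T}"
  obtains s where "s \<in> {0..1}" "\<alpha> s = t"
proof -
  have "\<exists>s. 0 \<le> s \<and> s \<le> 1 \<and> \<alpha> s = t"
    using assms unfolding reparam_def by (intro IVT') auto
  then show thesis using that by auto
qed

lemma dist_reparam_bdd:
  assumes "p \<in> params D" "q \<in> params D" "reparam (fst p) \<alpha>" "reparam (fst q) \<beta>"
  shows "bdd_above ((\<lambda>t. dist (snd p (\<alpha> t)) (snd q (\<beta> t))) ` {0..1})"
proof -
  have "continuous_on {0..1} (\<lambda>t. snd p (\<alpha> t))"
  proof (rule continuous_on_compose2[of "{0..fst p}" "snd p" _ \<alpha>])
    show "\<alpha> ` {0..1} \<subseteq> {0..fst p}" using reparam_range[OF assms(3)] by blast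
  qed (use assms in \<open>auto simp: params_def reparam_def\<close>)
  moreover have "continuous_on {0..1} (\<lambda>t. snd q (\<beta> t))"
  proof (rule continuous_on_compose2[of "{0..fst q}" "snd q" _ \<beta>])
    show "\<beta> ` {0..1} \<subseteq> {0..fst q}" using reparam_range[OF assms(4)] by blast
  qed (use assms in \<open>auto simp: params_def reparam_def\<close>)
  ultimately have "compact ((\<lambda>t. dist (snd p (\<alpha> t)) (snd q (\<beta> t))) ` {0..1})"
    by (intro compact_continuous_image continuous_on_dist compact_Icc)
  then show ?thesis by (intro bounded_imp_bdd_above compact_imp_bounded)
qed

lemma frechet_dist_zero_close:
  assumes "p \<in> params D" "q \<in> params D" "frechet_dist p q = 0"
  shows "close_params p q"
  unfolding close_params_def
proof (intro allI impI)
  fix \<epsilon> :: real assume "\<epsilon> > 0"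
  let ?R = "{(\<alpha>, \<beta>). reparam (fst p) \<alpha> \<and> reparam (fst q) \<beta>}"
  let ?f = "\<lambda>(\<alpha>, \<beta>). SUP t \<in> {0..1}. dist (snd p (\<alpha> t)) (snd q (\<beta> t))"
  have "0 < fst p" "0 < fst q" using assms by (auto simp: params_def)
  then have "((\<lambda>t. t * fst p), (\<lambda>t. t * fst q)) \<in> ?R" using reparam_scale by auto
  then have ne: "?f ` ?R \<noteq> {}" by blast
  have "Inf (?f ` ?R) < \<epsilon>" using assms(3) \<open>\<epsilon> > 0\<close> unfolding frechet_dist_def by simp
  from cInf_lessD[OF ne this]
  obtain \<alpha> \<beta> where ab: "reparam (fst p) \<alpha>" "reparam (fst q) \<beta>" "(SUP t \<in> {0..1}. dist (snd p (\<alpha> t)) (snd q (\<beta> t))) < \<epsilon>"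
    by auto
  have "dist (snd p (\<alpha> t)) (snd q (\<beta> t)) < \<epsilon>" if "t \<in> {0..1}" for t
    using cSUP_upper[OF that dist_reparam_bdd[OF assms(1,2) ab(1,2)]] ab(3) by linarith
  then show "\<exists>\<alpha> \<beta>. reparam (fst p) \<alpha> \<and> reparam (fst q) \<beta> \<and> (\<forall>t\<in>{0..1}. dist (snd p (\<alpha> t)) (snd q (\<beta> t)) < \<epsilon>)"
    using ab by blast
qed

lemma frechet_dist_refl:
  assumes p: "p \<in> params D"
  shows "frechet_dist p p = 0"
proof -
  let ?R = "{(\<alpha>, \<beta>). reparam (fst p) \<alpha> \<and> reparam (fst p) \<beta>}"
  let ?f = "\<lambda>(\<alpha>, \<beta>). SUP t \<in> {0..1}. dist (snd p (\<alpha> t)) (snd p (\<beta> t))"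
  have "0 < fst p" using assms by (auto simp: params_def)
  define x where "x = ((\<lambda>t. t * fst p), (\<lambda>t. t * fst p))"
  have x: "x \<in> ?R" using reparam_scale[OF \<open>0 < fst p\<close>] by (auto simp: x_def)
  have nonneg: "0 \<le> ?f y" if y: "y \<in> ?R" for y
  proof -
    obtain \<alpha> \<beta> where ab: "y = (\<alpha>, \<beta>)" "reparam (fst p) \<alpha>" "reparam (fst p) \<beta>" using y by auto
    have "dist (snd p (\<alpha> 0)) (snd p (\<beta> 0)) \<le> ?f y"
      unfolding ab(1) prod.case by (rule cSUP_upper[OF _ dist_reparam_bdd[OF p p ab(2,3)]]) simp
    then show ?thesis using zero_le_dist order_trans by blast
  qed
  have "Inf (?f ` ?R) \<le> ?f x" using x nonneg by (intro cINF_lower bdd_belowI[of _ 0]) auto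
  also have "?f x = 0" by (simp add: x_def)
  finally have "Inf (?f ` ?R) \<le> 0" .
  moreover have "0 \<le> Inf (?f ` ?R)" using x nonneg by (intro cINF_greatest) auto
  ultimately show ?thesis unfolding frechet_dist_def by simp
qed

lemma curve_rel_refl: "p \<in> params D \<Longrightarrow> (p, p) \<in> curve_rel D"
  by (simp add: curve_rel_def frechet_dist_refl)

lemma curve_rel_close: "(p, q) \<in> curve_rel D \<Longrightarrow> close_params p q"
  unfolding curve_rel_def using frechet_dist_zero_close by blast

lemma close_params_endpoints:
  assumes "close_params p q"
  shows "snd p 0 = snd q 0" "snd p (fst p) = snd q (fst q)"
proof -
  have "dist (snd p 0) (snd q 0) < \<epsilon> \<and> dist (snd p (fst p)) (snd q (fst q)) < \<epsilon>" if "\<epsilon> > 0" for \<epsilon>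
  proof -
    obtain \<alpha> \<beta> where ab: "reparam (fst p) \<alpha>" "reparam (fst q) \<beta>"
      "\<forall>t\<in>{0..1}. dist (snd p (\<alpha> t)) (snd q (\<beta> t)) < \<epsilon>" using assms \<open>\<epsilon> > 0\<close> unfolding close_params_def by blast
    then show ?thesis using ab(3)[rule_format, of 0] ab(3)[rule_format, of 1] by (simp add: reparam_def)
  qed
  then show "snd p 0 = snd q 0" "snd p (fst p) = snd q (fst q)"
    by (metis less_irrefl zero_less_dist_iff)+
qed

lemma close_params_image:
  assumes p: "p \<in> params D" and "close_params p q"
  shows "snd q ` {0..fst q} \<subseteq> snd p ` {0..fst p}"
proof
  fix y assume "y \<in> snd q ` {0..fst q}"
  then obtain t where t: "t \<in> {0..fst q}" "y = snd q t" by blast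
  have "compact (snd p ` {0..fst p})" using p by (intro compact_continuous_image) (auto simp: params_def)
  then have cl: "closed (snd p ` {0..fst p})" by (rule compact_imp_closed)
  have "\<exists>x\<in>snd p ` {0..fst p}. dist x y < \<epsilon>" if "\<epsilon> > 0" for \<epsilon>
  proof -
    obtain \<alpha> \<beta> where ab: "reparam (fst p) \<alpha>" "reparam (fst q) \<beta>"
      "\<forall>t\<in>{0..1}. dist (snd p (\<alpha> t)) (snd q (\<beta> t)) < \<epsilon>" using assms(2) \<open>\<epsilon> > 0\<close> unfolding close_params_def by blast
    obtain s where s: "s \<in> {0..1}" "\<beta> s = t" using reparam_surj[OF ab(2) t(1)] .
    then have "dist (snd p (\<alpha> s)) y < \<epsilon>" using ab(3) t(2) by auto
    then show ?thesis using reparam_range[OF ab(1) s(1)] by blast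
  qed
  then have "y \<in> closure (snd p ` {0..fst p})" by (simp add: closure_approachable)
  then show "y \<in> snd p ` {0..fst p}" using cl by simp
qed

text \<open>The length of a path is bounded by the total control of any path at Frechet distance zero.\<close>

lemma close_params_variation:
  fixes V :: "real \<Rightarrow> real"
  assumes "close_params p q" and "0 < fst p" "0 < fst q"
    and V: "\<And>u v. 0 \<le> u \<Longrightarrow> u \<le> v \<Longrightarrow> v \<le> fst p \<Longrightarrow> norm (snd p v - snd p u) \<le> V v - V u"
  shows "param_length q \<le> ennreal (V (fst p) - V 0)"
  unfolding param_length_def
proof (rule SUP_least, rule ennreal_leI)
  fix d assume "d \<in> {d. d division_of {0..fst q}}"
  then have d: "d division_of {0..fst q}" by simp
  have fin: "finite d" using d by (rule division_of_finite)
  show "(\<Sum>k\<in>d. norm (snd q (Sup k) - snd q (Inf k))) \<le> V (fst p) - V 0"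
  proof (rule field_le_epsilon)
    fix e :: real assume "e > 0"
    define \<epsilon> where "\<epsilon> = e / (2 * real (card d) + 1)"
    have \<epsilon>: "\<epsilon> > 0" using \<open>e > 0\<close> by (simp add: \<epsilon>_def)
    obtain \<alpha> \<beta> where ab: "reparam (fst p) \<alpha>" "reparam (fst q) \<beta>"
      "\<forall>t\<in>{0..1}. dist (snd p (\<alpha> t)) (snd q (\<beta> t)) < \<epsilon>" using assms(1) \<epsilon> unfolding close_params_def by blast
    have "\<forall>t\<in>{0..fst q}. \<exists>s. s \<in> {0..1} \<and> \<beta> s = t" using reparam_surj[OF ab(2)] by metis
    then obtain s where s: "\<And>t. t \<in> {0..fst q} \<Longrightarrow> s t \<in> {0..1} \<and> \<beta> (s t) = t" by metis
    have smono: "s t \<le> s t'" if "t \<in> {0..fst q}" "t' \<in> {0..fst q}" "t \<le> t'" for t t'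
    proof (rule ccontr)
      assume n: "\<not> s t \<le> s t'"
      then have "s t' \<le> s t" by simp
      then have "\<beta> (s t') \<le> \<beta> (s t)" using mono_onD[of "{0..1}" \<beta> "s t'" "s t"] ab(2)[unfolded reparam_def] s[OF that(1)] s[OF that(2)] by metis
      then have "t = t'" using s that by auto
      then show False using n by simp
    qed
    define W where "W t = V (\<alpha> (s t))" for t
    have "(\<Sum>k\<in>d. norm (snd q (Sup k) - snd q (Inf k))) \<le> (\<Sum>k\<in>d. (W (Sup k) - W (Inf k)) + 2 * \<epsilon>)"
    proof (rule sum_mono)
      fix k assume k: "k \<in> d"
      have el: "Inf k \<le> Sup k" "Inf k \<in> {0..fst q}" "Sup k \<in> {0..fst q}"
        using division_elem[OF d k] by blast+
      let ?u = "\<alpha> (s (Inf k))" and ?v = "\<alpha> (s (Sup k))"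
      have "?u \<le> ?v" using mono_onD[of "{0..1}" \<alpha> "s (Inf k)" "s (Sup k)"] ab(1)[unfolded reparam_def] smono[OF el(2,3,1)] s[OF el(2)] s[OF el(3)] by metis
      moreover have "?u \<in> {0..fst p}" "?v \<in> {0..fst p}" using reparam_range[OF ab(1)] s el by auto
      ultimately have 1: "norm (snd p ?v - snd p ?u) \<le> W (Sup k) - W (Inf k)" unfolding W_def by (intro V) auto
      have 2: "dist (snd p ?u) (snd q (Inf k)) < \<epsilon>" using ab(3) s[OF el(2)] by metis
      have 3: "dist (snd p ?v) (snd q (Sup k)) < \<epsilon>" using ab(3) s[OF el(3)] by metis
      have eq: "snd q (Sup k) - snd q (Inf k) = (snd q (Sup k) - snd p ?v) + (snd p ?v - snd p ?u) + (snd p ?u - snd q (Inf k))" by simp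
      have "norm (snd q (Sup k) - snd q (Inf k)) \<le> norm (snd q (Sup k) - snd p ?v) + norm (snd p ?v - snd p ?u) + norm (snd p ?u - snd q (Inf k))"
        unfolding eq by (intro norm_triangle_le add_mono order_refl)
      then have "norm (snd q (Sup k) - snd q (Inf k)) \<le> dist (snd p ?v) (snd q (Sup k)) + norm (snd p ?v - snd p ?u) + dist (snd p ?u) (snd q (Inf k))"
        by (simp add: dist_norm norm_minus_commute)
      then show "norm (snd q (Sup k) - snd q (Inf k)) \<le> (W (Sup k) - W (Inf k)) + 2 * \<epsilon>" using 1 2 3 by linarith
    qed
    also have "\<dots> = (\<Sum>k\<in>d. W (Sup k) - W (Inf k)) + real (card d) * (2 * \<epsilon>)" by (simp add: sum.distrib)
    also have "(\<Sum>k\<in>d. W (Sup k) - W (Inf k)) = W (fst q) - W 0"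
      using assms(3) d by (intro division_increment) auto
    also have "\<dots> \<le> V (fst p) - V 0"
    proof -
      have m: "V u \<le> V v" if "0 \<le> u" "u \<le> v" "v \<le> fst p" for u v
        using V[OF that] norm_ge_zero[of "snd p v - snd p u"] by linarith
      have "\<alpha> (s (fst q)) \<in> {0..fst p}" "\<alpha> (s 0) \<in> {0..fst p}" using reparam_range[OF ab(1)] s assms(3) by auto
      then have "W (fst q) \<le> V (fst p)" "V 0 \<le> W 0" unfolding W_def by (auto intro!: m)
      then show ?thesis by simp
    qed
    also have "real (card d) * (2 * \<epsilon>) \<le> e" using \<open>e > 0\<close> by (simp add: \<epsilon>_def field_simps)
    finally show "(\<Sum>k\<in>d. norm (snd q (Sup k) - snd q (Inf k))) \<le> V (fst p) - V 0 + e" by simp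
  qed
qed

section \<open>Lower integrals and the action on intervals\<close>

text \<open>The integral of an arbitrary function is attained by a measurable minorant.  This makes it
unnecessary to prove that the integrand of the action is measurable.\<close>

lemma nn_integral_measurable_minorant:
  fixes f :: "'a \<Rightarrow> ennreal"
  obtains g where "g \<in> borel_measurable M" "\<And>x. g x \<le> f x" "(\<integral>\<^sup>+x. g x \<partial>M) = (\<integral>\<^sup>+x. f x \<partial>M)"
proof -
  let ?A = "{g. simple_function M g \<and> g \<le> f}"
  have "(\<lambda>x. 0) \<in> ?A" by (auto simp: le_fun_def)
  then have "?A \<noteq> {}" by blast
  then obtain s :: "nat \<Rightarrow> ennreal" where s: "range s \<subseteq> integral\<^sup>S M ` ?A" "Sup (integral\<^sup>S M ` ?A) = Sup (range s)"
    using ennreal_SUP_countable_SUP[of ?A "integral\<^sup>S M"] by auto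
  have "\<forall>n. \<exists>g. g \<in> ?A \<and> s n = integral\<^sup>S M g" using s(1) by blast
  then obtain G where G: "\<And>n. simple_function M (G n)" "\<And>n. G n \<le> f" "\<And>n. s n = integral\<^sup>S M (G n)" by (auto; metis)
  define g where "g x = (SUP n. G n x)" for x
  show thesis
  proof (rule that[of g])
    show gm: "g \<in> borel_measurable M"
      unfolding g_def using G(1) by (intro borel_measurable_SUP) (auto intro: borel_measurable_simple_function)
    show gf: "g x \<le> f x" for x unfolding g_def using G(2) by (auto intro!: SUP_least simp: le_fun_def)
    show "(\<integral>\<^sup>+x. g x \<partial>M) = (\<integral>\<^sup>+x. f x \<partial>M)"
    proof (rule antisym)
      show "(\<integral>\<^sup>+x. g x \<partial>M) \<le> (\<integral>\<^sup>+x. f x \<partial>M)" using gf by (intro nn_integral_mono)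
      have "(\<integral>\<^sup>+x. f x \<partial>M) = (SUP n. s n)" unfolding nn_integral_def using s(2) by simp
      also have "\<dots> \<le> (\<integral>\<^sup>+x. g x \<partial>M)"
      proof (rule SUP_least)
        fix n
        have "s n = (\<integral>\<^sup>+x. G n x \<partial>M)" using G nn_integral_eq_simple_integral by metis
        also have "\<dots> \<le> (\<integral>\<^sup>+x. g x \<partial>M)" unfolding g_def by (intro nn_integral_mono SUP_upper) simp
        finally show "s n \<le> (\<integral>\<^sup>+x. g x \<partial>M)" .
      qed
      finally show "(\<integral>\<^sup>+x. f x \<partial>M) \<le> (\<integral>\<^sup>+x. g x \<partial>M)" .
    qed
  qed
qed

lemma AE_lborel_neq: "AE x in lborel. x \<noteq> (a::real)"
  using AE_lborel_singleton by blast

lemma nn_integral_Icc_split: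
  fixes f :: "real \<Rightarrow> ennreal"
  assumes "a \<le> b" "b \<le> c"
  shows "(\<integral>\<^sup>+x\<in>{a..c}. f x \<partial>lborel) = (\<integral>\<^sup>+x\<in>{a..b}. f x \<partial>lborel) + (\<integral>\<^sup>+x\<in>{b..c}. f x \<partial>lborel)"
proof (rule antisym)
  obtain m where m: "m \<in> borel_measurable lborel" "\<And>x. m x \<le> f x * indicator {a..c} x"
    "(\<integral>\<^sup>+x. m x \<partial>lborel) = (\<integral>\<^sup>+x\<in>{a..c}. f x \<partial>lborel)"
    by (rule nn_integral_measurable_minorant[of lborel "\<lambda>x. f x * indicator {a..c} x"]) (assumption | rule that)+
  have "(\<integral>\<^sup>+x. m x \<partial>lborel) \<le> (\<integral>\<^sup>+x. m x * indicator {a..b} x + m x * indicator {b..c} x \<partial>lborel)"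
  proof (rule nn_integral_mono)
    fix x
    have "m x = 0" if "x \<notin> {a..c}" using m(2)[of x] that by simp
    then show "m x \<le> m x * indicator {a..b} x + m x * indicator {b..c} x"
      by (cases "x \<in> {a..c}"; cases "x \<le> b"; cases "x \<ge> b") (auto simp: indicator_def)
  qed
  also have "\<dots> = (\<integral>\<^sup>+x. m x * indicator {a..b} x \<partial>lborel) + (\<integral>\<^sup>+x. m x * indicator {b..c} x \<partial>lborel)"
    using m(1) by (intro nn_integral_add) auto
  also have "\<dots> \<le> (\<integral>\<^sup>+x\<in>{a..b}. f x \<partial>lborel) + (\<integral>\<^sup>+x\<in>{b..c}. f x \<partial>lborel)"
  proof (intro add_mono nn_integral_mono)
    show "m x * indicator {a..b} x \<le> f x * indicator {a..b} x" "m x * indicator {b..c} x \<le> f x * indicator {b..c} x" for x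
      using m(2)[of x] assms by (auto simp: indicator_def split: if_splits)
  qed
  finally show "(\<integral>\<^sup>+x\<in>{a..c}. f x \<partial>lborel) \<le> (\<integral>\<^sup>+x\<in>{a..b}. f x \<partial>lborel) + (\<integral>\<^sup>+x\<in>{b..c}. f x \<partial>lborel)"
    using m(3) by simp
next
  obtain m1 where m1: "m1 \<in> borel_measurable lborel" "\<And>x. m1 x \<le> f x * indicator {a..b} x"
    "(\<integral>\<^sup>+x. m1 x \<partial>lborel) = (\<integral>\<^sup>+x\<in>{a..b}. f x \<partial>lborel)"
    by (rule nn_integral_measurable_minorant[of lborel "\<lambda>x. f x * indicator {a..b} x"]) (assumption | rule that)+
  obtain m2 where m2: "m2 \<in> borel_measurable lborel" "\<And>x. m2 x \<le> f x * indicator {b..c} x"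
    "(\<integral>\<^sup>+x. m2 x \<partial>lborel) = (\<integral>\<^sup>+x\<in>{b..c}. f x \<partial>lborel)"
    by (rule nn_integral_measurable_minorant[of lborel "\<lambda>x. f x * indicator {b..c} x"]) (assumption | rule that)+
  have "(\<integral>\<^sup>+x. m1 x \<partial>lborel) + (\<integral>\<^sup>+x. m2 x \<partial>lborel) = (\<integral>\<^sup>+x. m1 x + m2 x \<partial>lborel)"
    using m1(1) m2(1) by (intro nn_integral_add[symmetric]) auto
  also have "\<dots> \<le> (\<integral>\<^sup>+x\<in>{a..c}. f x \<partial>lborel)"
  proof (rule nn_integral_mono_AE, rule AE_mp[OF AE_lborel_neq[of b]], intro AE_I2 impI)
    fix x assume "x \<noteq> b"
    then consider "x < b" | "x > b" by linarith
    then show "m1 x + m2 x \<le> f x * indicator {a..c} x"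
    proof cases
      case 1 then show ?thesis using m1(2)[of x] m2(2)[of x] assms by (auto simp: indicator_def split: if_splits)
    next
      case 2 then show ?thesis using m1(2)[of x] m2(2)[of x] assms by (auto simp: indicator_def split: if_splits)
    qed
  qed
  finally show "(\<integral>\<^sup>+x\<in>{a..b}. f x \<partial>lborel) + (\<integral>\<^sup>+x\<in>{b..c}. f x \<partial>lborel) \<le> (\<integral>\<^sup>+x\<in>{a..c}. f x \<partial>lborel)"
    using m1(3) m2(3) by simp
qed

text \<open>The action of the part of a path between the times \<open>a\<close> and \<open>b\<close>.\<close>

definition act :: "(real ^ 'n::finite \<Rightarrow> real ^ 'n \<Rightarrow> real) \<Rightarrow> (real \<Rightarrow> real ^ 'n) \<Rightarrow> real \<Rightarrow> real \<Rightarrow> ennreal" where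
  "act H \<phi> a b = (\<integral>\<^sup>+\<alpha>\<in>{a..b}. ennreal (local_action H (\<phi> \<alpha>) (vector_derivative \<phi> (at \<alpha>))) \<partial>lborel)"

lemma param_action_eq_act: "param_action H \<phi> = act H \<phi> 0 1"
  by (simp add: param_action_def act_def)

lemma act_split: "a \<le> b \<Longrightarrow> b \<le> c \<Longrightarrow> act H \<phi> a c = act H \<phi> a b + act H \<phi> b c"
  unfolding act_def by (rule nn_integral_Icc_split)

lemma act_cong:
  assumes "\<And>t. a < t \<Longrightarrow> t < b \<Longrightarrow> \<phi> t = \<sigma> t"
  shows "act H \<phi> a b = act H \<sigma> a b"
  unfolding act_def
proof (rule nn_integral_cong_AE, rule AE_mp[OF AE_lborel_neq[of a]], rule AE_mp[OF AE_lborel_neq[of b]], intro AE_I2 impI)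
  fix x assume x: "x \<noteq> b" "x \<noteq> a"
  show "ennreal (local_action H (\<phi> x) (vector_derivative \<phi> (at x))) * indicator {a..b} x =
        ennreal (local_action H (\<sigma> x) (vector_derivative \<sigma> (at x))) * indicator {a..b} x"
  proof (cases "x \<in> {a<..<b}")
    case True
    have "(\<phi> has_vector_derivative D) (at x) \<longleftrightarrow> (\<sigma> has_vector_derivative D) (at x)" for D
      using has_vector_derivative_transform_within_open[of \<phi> D x "{a<..<b}" \<sigma>]
        has_vector_derivative_transform_within_open[of \<sigma> D x "{a<..<b}" \<phi>] True assms by auto
    then show ?thesis using True assms by (simp add: vector_derivative_def)
  qed (use x in auto)
qed

lemma act_le:
  assumes "a \<le> b" "negligible N" "c \<ge> 0"
    and "\<And>t. a < t \<Longrightarrow> t < b \<Longrightarrow> t \<notin> N \<Longrightarrow> local_action H (\<phi> t) (vector_derivative \<phi> (at t)) \<le> c"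
  shows "act H \<phi> a b \<le> ennreal (c * (b - a))"
proof -
  have "AE x in lebesgue. x \<notin> N \<union> {a,b}"
  proof (rule AE_not_in)
    have "negligible (N \<union> {a,b})" using assms(2) by (intro negligible_Un) auto
    then show "N \<union> {a,b} \<in> null_sets lebesgue" by (simp add: negligible_iff_null_sets)
  qed
  then have "(\<integral>\<^sup>+\<alpha>. ennreal (local_action H (\<phi> \<alpha>) (vector_derivative \<phi> (at \<alpha>))) * indicator {a..b} \<alpha> \<partial>lebesgue)
    \<le> (\<integral>\<^sup>+\<alpha>. ennreal c * indicator {a..b} \<alpha> \<partial>lebesgue)"
    by (intro nn_integral_mono_AE, elim AE_mp, intro AE_I2 impI)
      (auto simp: indicator_def intro!: ennreal_leI assms(4))
  also have "\<dots> = ennreal (c * (b - a))"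
    using assms(1,3) by (simp add: nn_integral_cmult_indicator ennreal_mult)
  finally show ?thesis unfolding act_def by (simp add: nn_integral_completion)
qed

lemma act_ge:
  assumes "a \<le> b" "c \<ge> 0"
    and "\<And>t. a < t \<Longrightarrow> t < b \<Longrightarrow> c \<le> local_action H (\<phi> t) (vector_derivative \<phi> (at t))"
  shows "ennreal (c * (b - a)) \<le> act H \<phi> a b"
proof -
  have "ennreal (c * (b - a)) = (\<integral>\<^sup>+\<alpha>. ennreal c * indicator {a..b} \<alpha> \<partial>lborel)"
    using assms(1,2) by (simp add: nn_integral_cmult_indicator ennreal_mult)
  also have "\<dots> \<le> act H \<phi> a b"
    unfolding act_def
  proof (rule nn_integral_mono_AE, rule AE_mp[OF AE_lborel_neq[of a]], rule AE_mp[OF AE_lborel_neq[of b]], intro AE_I2 impI)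
    fix x assume "x \<noteq> b" "x \<noteq> a"
    then show "ennreal c * indicator {a..b} x \<le> ennreal (local_action H (\<phi> x) (vector_derivative \<phi> (at x))) * indicator {a..b} x"
      using assms(3)[of x] by (auto simp: indicator_def intro!: ennreal_leI)
  qed
  finally show ?thesis .
qed

section \<open>First hitting points\<close>

text \<open>The first hitting point does not depend on the parameterization.  Before the first time at which
\<open>q\<close> reaches \<open>x\<close>, the path \<open>q\<close> runs through points that \<open>p\<close> visits before time \<open>t\<close>.\<close>

lemma first_hit_close_params:
  assumes pq: "close_params p q" and p: "p \<in> params D" and q: "q \<in> params D"
    and t: "t \<in> {0..fst p}" "snd p t = x" "\<forall>s\<in>{0..<t}. snd p s \<notin> A" and "x \<in> A"
  shows "\<exists>r\<in>{0..fst q}. snd q r = x \<and> (\<forall>s\<in>{0..<r}. snd q s \<notin> A)"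
proof -
  have contq: "continuous_on {0..fst q} (snd q)" and contp: "continuous_on {0..fst p} (snd p)"
    using p q by (auto simp: params_def)
  have "x \<in> snd q ` {0..fst q}"
    using close_params_image[OF q close_params_sym[OF pq]] t by blast
  define Z where "Z = {0..fst q} \<inter> snd q -` {x}"
  have Zne: "Z \<noteq> {}" using \<open>x \<in> snd q ` {0..fst q}\<close> by (auto simp: Z_def)
  have "closed Z" unfolding Z_def by (rule continuous_closed_preimage[OF contq]) auto
  have Zb: "bdd_below Z" by (rule bdd_belowI[of _ 0]) (auto simp: Z_def)
  define r where "r = Inf Z"
  have r: "r \<in> Z" unfolding r_def by (rule closed_contains_Inf[OF Zne Zb \<open>closed Z\<close>])
  have before: "snd q s \<noteq> x" if "0 \<le> s" "s < r" for s
  proof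
    assume "snd q s = x"
    moreover have "r \<le> fst q" using r by (auto simp: Z_def)
    ultimately have "s \<in> Z" using that by (auto simp: Z_def)
    then have "r \<le> s" unfolding r_def by (rule cInf_lower[OF _ Zb])
    then show False using that by simp
  qed
  have "snd q s \<notin> A" if s: "s \<in> {0..<r}" for s
  proof -
    have sr: "0 \<le> s" "s < r" "s \<le> fst q" using s r by (auto simp: Z_def)
    have "compact (snd q ` {0..s})"
      by (rule compact_continuous_image[OF continuous_on_subset[OF contq]]) (use sr in auto)
    then have "closed (snd q ` {0..s})" by (rule compact_imp_closed)
    moreover have "x \<notin> snd q ` {0..s}"
    proof
      assume "x \<in> snd q ` {0..s}"
      then obtain s' where "s' \<in> {0..s}" "snd q s' = x" by blast
      then show False using before[of s'] sr by auto
    qed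
    ultimately obtain \<delta> where \<delta>: "\<delta> > 0" "\<forall>y\<in>snd q ` {0..s}. \<delta> \<le> dist x y"
      using separate_point_closed[of "snd q ` {0..s}" x] by blast
    have cp: "compact (snd p ` {0..t})"
      by (rule compact_continuous_image[OF continuous_on_subset[OF contp]]) (use t in auto)
    have "\<exists>y\<in>snd p ` {0..t}. dist y (snd q s) < \<epsilon>" if "\<epsilon> > 0" for \<epsilon>
    proof -
      have "min \<epsilon> \<delta> > 0" using \<open>\<epsilon> > 0\<close> \<delta>(1) by simp
      then obtain \<alpha> \<beta> where ab: "reparam (fst p) \<alpha>" "reparam (fst q) \<beta>"
        "\<forall>t\<in>{0..1}. dist (snd p (\<alpha> t)) (snd q (\<beta> t)) < min \<epsilon> \<delta>" using pq unfolding close_params_def by blast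
      obtain s1 where s1: "s1 \<in> {0..1}" "\<alpha> s1 = t" using reparam_surj[OF ab(1) t(1)] .
      have "s \<in> {0..fst q}" using sr by simp
      then obtain s2 where s2: "s2 \<in> {0..1}" "\<beta> s2 = s" using reparam_surj[OF ab(2)] by blast
      have "dist x (snd q (\<beta> s1)) < \<delta>" using ab(3) s1 t(2) by auto
      then have "\<beta> s1 \<notin> {0..s}" using \<delta>(2) by force
      then have "s < \<beta> s1" using reparam_range[OF ab(2) s1(1)] by auto
      then have "s2 \<le> s1" using mono_onD[of "{0..1}" \<beta> s1 s2] ab(2)[unfolded reparam_def] s1(1) s2 by (metis linear not_le)
      then have "\<alpha> s2 \<le> t" using mono_onD[of "{0..1}" \<alpha> s2 s1] ab(1)[unfolded reparam_def] s1 s2(1) by metis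
      moreover have "0 \<le> \<alpha> s2" using reparam_range[OF ab(1) s2(1)] by simp
      moreover have "dist (snd p (\<alpha> s2)) (snd q s) < \<epsilon>" using ab(3) s2 by auto
      ultimately show ?thesis by (intro bexI[of _ "snd p (\<alpha> s2)"]) auto
    qed
    then have "snd q s \<in> closure (snd p ` {0..t})" by (simp add: closure_approachable)
    then have "snd q s \<in> snd p ` {0..t}" using compact_imp_closed[OF cp] by simp
    then obtain t' where t': "t' \<in> {0..t}" "snd q s = snd p t'" by blast
    have "t' \<noteq> t" using t' t(2) before[OF sr(1,2)] by auto
    then show ?thesis using t(3) t' by auto
  qed
  then show ?thesis using r by (intro bexI[of _ r]) (auto simp: Z_def)
qed

lemma curvesE:
  assumes "\<gamma> \<in> curves D"
  obtains p where "p \<in> params D" "p \<in> \<gamma>" "\<And>q. q \<in> \<gamma> \<Longrightarrow> q \<in> params D \<and> close_params p q"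
proof -
  obtain p where p: "p \<in> params D" "\<gamma> = curve_rel D `` {p}" using assms unfolding curves_def by (rule quotientE)
  show thesis
  proof (rule that[OF p(1)])
    show "p \<in> \<gamma>" using p curve_rel_refl by blast
    show "q \<in> params D \<and> close_params p q" if "q \<in> \<gamma>" for q
      using that p curve_rel_close[of p q D] by (auto simp: curve_rel_def)
  qed
qed

lemma first_hitting_time:
  assumes "\<gamma> \<in> curves D" "q \<in> \<gamma>" "first_hitting_point \<gamma> A x"
  shows "\<exists>r\<in>{0..fst q}. snd q r = x \<and> (\<forall>s\<in>{0..<r}. snd q s \<notin> A)"
proof -
  obtain p where p: "p \<in> params D" "p \<in> \<gamma>" "\<And>q. q \<in> \<gamma> \<Longrightarrow> q \<in> params D \<and> close_params p q"
    by (rule curvesE[OF assms(1)]) (assumption | rule that)+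
  obtain q' where q': "q' \<in> \<gamma>" "\<exists>t\<in>{0..fst q'}. snd q' t = x \<and> x \<in> A \<and> (\<forall>s\<in>{0..<t}. snd q' s \<notin> A)"
    using assms(3) unfolding first_hitting_point_def by fastforce
  then obtain t where t: "t\<in>{0..fst q'}" "snd q' t = x" "x \<in> A" "\<forall>s\<in>{0..<t}. snd q' s \<notin> A" by blast
  have c: "q' \<in> params D" "close_params q' p" using p(3)[OF q'(1)] close_params_sym by blast+
  obtain t' where t': "t' \<in> {0..fst p}" "snd p t' = x" "\<forall>s\<in>{0..<t'}. snd p s \<notin> A"
    using first_hit_close_params[OF c(2,1) p(1) t(1,2,4,3)] by blast
  have "q \<in> params D" "close_params p q" using p(3)[OF assms(2)] by blast+
  then show ?thesis using first_hit_close_params[OF _ p(1) _ t' t(3)] by blast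
qed

section \<open>Admissible paths\<close>

text \<open>Paths of finite length in \<open>G\<close>, over the time interval \<open>{a..b}\<close>, with the regularity required in
\<^const>\<open>Ct\<close>.  Finite length is expressed by a control function, and finitely many exceptional times
are allowed; with both choices concatenation is immediate.\<close>

definition admissible_path :: "(real ^ 'n::finite) set \<Rightarrow> real \<Rightarrow> real \<Rightarrow> (real \<Rightarrow> real ^ 'n) \<Rightarrow> bool" where
  "admissible_path G a b \<sigma> \<longleftrightarrow> continuous_on {a..b} \<sigma> \<and> \<sigma> ` {a..b} \<subseteq> G \<and>
     (\<exists>F. finite F \<and> (\<forall>t\<in>{a..b} - F. \<exists>r>0. abs_cont_on ({a..b} \<inter> cball t r) \<sigma>)) \<and>
     (\<exists>V::real \<Rightarrow> real. \<forall>u v. a \<le> u \<and> u \<le> v \<and> v \<le> b \<longrightarrow> norm (\<sigma> v - \<sigma> u) \<le> V v - V u)"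

lemma abs_cont_on_cong:
  assumes "abs_cont_on I \<phi>" "\<And>t. t \<in> I \<Longrightarrow> \<sigma> t = \<phi> t"
  shows "abs_cont_on I \<sigma>"
  unfolding abs_cont_on_iff_ac_on
  by (rule ac_on_dominated[where C = 1 and f = \<phi> and g = \<phi>])
    (use assms in \<open>auto simp: abs_cont_on_iff_ac_on\<close>)

lemma abs_cont_on_subset: "abs_cont_on I \<phi> \<Longrightarrow> J \<subseteq> I \<Longrightarrow> abs_cont_on J \<phi>"
  unfolding abs_cont_on_iff_ac_on by (rule ac_on_subset)

lemma lipschitz_continuous_on:
  fixes \<sigma> :: "real \<Rightarrow> 'a::real_normed_vector"
  assumes "C \<ge> 0" and lip: "\<And>u v. a \<le> u \<Longrightarrow> u \<le> v \<Longrightarrow> v \<le> b \<Longrightarrow> norm (\<sigma> v - \<sigma> u) \<le> C * (v - u)"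
  shows "continuous_on {a..b} \<sigma>"
proof (rule lipschitz_on_continuous_on[of C])
  show "C-lipschitz_on {a..b} \<sigma>"
  proof (rule lipschitz_onI)
    fix x y assume "x \<in> {a..b}" "y \<in> {a..b}"
    then show "dist (\<sigma> x) (\<sigma> y) \<le> C * dist x y"
      using lip[of x y] lip[of y x] by (cases "x \<le> y") (auto simp: dist_norm norm_minus_commute)
  qed fact
qed

lemma admissible_path_lipschitz:
  assumes "C \<ge> 0" and lip: "\<And>u v. a \<le> u \<Longrightarrow> u \<le> v \<Longrightarrow> v \<le> b \<Longrightarrow> norm (\<sigma> v - \<sigma> u) \<le> C * (v - u)"
    and "\<sigma> ` {a..b} \<subseteq> G"
  shows "admissible_path G a b \<sigma>"
  unfolding admissible_path_def
proof (intro conjI)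
  show "continuous_on {a..b} \<sigma>" using lipschitz_continuous_on[OF assms(1,2)] .
  show "\<exists>F. finite F \<and> (\<forall>t\<in>{a..b} - F. \<exists>r>0. abs_cont_on ({a..b} \<inter> cball t r) \<sigma>)"
  proof (intro exI[of _ "{}"] conjI ballI)
    fix t
    have "abs_cont_on ({a..b} \<inter> cball t 1) \<sigma>"
      unfolding abs_cont_on_iff_ac_on by (rule ac_on_lipschitz[OF assms(1)]) (use lip in auto)
    then show "\<exists>r>0. abs_cont_on ({a..b} \<inter> cball t r) \<sigma>" by (intro exI[of _ 1]) simp
  qed simp
  show "\<exists>V::real \<Rightarrow> real. \<forall>u v. a \<le> u \<and> u \<le> v \<and> v \<le> b \<longrightarrow> norm (\<sigma> v - \<sigma> u) \<le> V v - V u"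
    using lip by (intro exI[of _ "\<lambda>t. C * t"]) (auto simp: algebra_simps)
qed fact

lemma admissible_path_join:
  assumes 1: "admissible_path G a m \<sigma>1" and 2: "admissible_path G m b \<sigma>2" and eq: "\<sigma>1 m = \<sigma>2 m" and ab: "a \<le> m" "m \<le> b"
  shows "admissible_path G a b (\<lambda>t. if t \<le> m then \<sigma>1 t else \<sigma>2 t)" (is "admissible_path G a b ?\<sigma>")
  unfolding admissible_path_def
proof (intro conjI)
  have un: "{a..b} = {a..m} \<union> {m..b}" using ab by auto
  show "continuous_on {a..b} ?\<sigma>"
    unfolding un
  proof (rule continuous_on_cases)
    show "continuous_on {a..m} \<sigma>1" "continuous_on {m..b} \<sigma>2" using 1 2 by (auto simp: admissible_path_def)
    show "\<forall>t. t \<in> {a..m} \<and> \<not> t \<le> m \<or> t \<in> {m..b} \<and> t \<le> m \<longrightarrow> \<sigma>1 t = \<sigma>2 t"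
    proof (intro allI impI)
      fix t assume "t \<in> {a..m} \<and> \<not> t \<le> m \<or> t \<in> {m..b} \<and> t \<le> m"
      then have "t = m" by auto
      then show "\<sigma>1 t = \<sigma>2 t" using eq by simp
    qed
  qed auto
  show "?\<sigma> ` {a..b} \<subseteq> G"
    using 1 2 unfolding admissible_path_def by (auto simp: image_subset_iff)
  obtain F1 where F1: "finite F1" "\<And>t. t\<in>{a..m} - F1 \<Longrightarrow> \<exists>r>0. abs_cont_on ({a..m} \<inter> cball t r) \<sigma>1"
    using 1 unfolding admissible_path_def by blast
  obtain F2 where F2: "finite F2" "\<And>t. t\<in>{m..b} - F2 \<Longrightarrow> \<exists>r>0. abs_cont_on ({m..b} \<inter> cball t r) \<sigma>2"
    using 2 unfolding admissible_path_def by blast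
  show "\<exists>F. finite F \<and> (\<forall>t\<in>{a..b} - F. \<exists>r>0. abs_cont_on ({a..b} \<inter> cball t r) ?\<sigma>)"
  proof (intro exI[of _ "F1 \<union> F2 \<union> {m}"] conjI ballI)
    show "finite (F1 \<union> F2 \<union> {m})" using F1 F2 by simp
    fix t assume t: "t \<in> {a..b} - (F1 \<union> F2 \<union> {m})"
    consider "t < m" | "t > m" using t by force
    then show "\<exists>r>0. abs_cont_on ({a..b} \<inter> cball t r) ?\<sigma>"
    proof cases
      case 1
      obtain r where r: "r > 0" "abs_cont_on ({a..m} \<inter> cball t r) \<sigma>1" using F1(2)[of t] t 1 by auto
      define r' where "r' = min r (m - t)"
      have "abs_cont_on ({a..b} \<inter> cball t r') ?\<sigma>"
        by (rule abs_cont_on_cong[OF abs_cont_on_subset[OF r(2)]]) (auto simp: r'_def dist_real_def)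
      then show ?thesis using r 1 by (intro exI[of _ r']) (auto simp: r'_def)
    next
      case 2
      obtain r where r: "r > 0" "abs_cont_on ({m..b} \<inter> cball t r) \<sigma>2" using F2(2)[of t] t 2 by auto
      define r' where "r' = min r ((t - m) / 2)"
      have "abs_cont_on ({a..b} \<inter> cball t r') ?\<sigma>"
        by (rule abs_cont_on_cong[OF abs_cont_on_subset[OF r(2)]]) (use 2 in \<open>auto simp: r'_def dist_real_def min_def abs_if split: if_splits\<close>)
      then show ?thesis using r 2 by (intro exI[of _ r']) (auto simp: r'_def)
    qed
  qed
  obtain V1 :: "real \<Rightarrow> real" where V1: "\<And>u v. a \<le> u \<Longrightarrow> u \<le> v \<Longrightarrow> v \<le> m \<Longrightarrow> norm (\<sigma>1 v - \<sigma>1 u) \<le> V1 v - V1 u"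
    using 1 unfolding admissible_path_def by blast
  obtain V2 :: "real \<Rightarrow> real" where V2: "\<And>u v. m \<le> u \<Longrightarrow> u \<le> v \<Longrightarrow> v \<le> b \<Longrightarrow> norm (\<sigma>2 v - \<sigma>2 u) \<le> V2 v - V2 u"
    using 2 unfolding admissible_path_def by blast
  show "\<exists>V::real \<Rightarrow> real. \<forall>u v. a \<le> u \<and> u \<le> v \<and> v \<le> b \<longrightarrow> norm (?\<sigma> v - ?\<sigma> u) \<le> V v - V u"
  proof (intro exI[of _ "\<lambda>t. if t \<le> m then V1 t else V1 m + V2 t - V2 m"] allI impI)
    fix u v assume uv: "a \<le> u \<and> u \<le> v \<and> v \<le> b"
    consider "v \<le> m" | "u > m" | "u \<le> m" "v > m" by linarith
    then show "norm (?\<sigma> v - ?\<sigma> u) \<le> (if v \<le> m then V1 v else V1 m + V2 v - V2 m) - (if u \<le> m then V1 u else V1 m + V2 u - V2 m)"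
    proof cases
      case 1 then show ?thesis using V1[of u v] uv by auto
    next
      case 2 then show ?thesis using V2[of u v] uv by auto
    next
      case 3
      have "\<sigma>2 v - \<sigma>1 u = (\<sigma>2 v - \<sigma>2 m) + (\<sigma>1 m - \<sigma>1 u)" using eq by simp
      then have "norm (\<sigma>2 v - \<sigma>1 u) \<le> norm (\<sigma>2 v - \<sigma>2 m) + norm (\<sigma>1 m - \<sigma>1 u)" by (metis norm_triangle_ineq)
      then show ?thesis using V2[of m v] V1[of u m] 3 uv by auto
    qed
  qed
qed

lemma act_join:
  assumes "a \<le> m" "m \<le> b"
  shows "act H (\<lambda>t. if t \<le> m then \<sigma>1 t else \<sigma>2 t) a b = act H \<sigma>1 a m + act H \<sigma>2 m b"
proof -
  let ?\<sigma> = "\<lambda>t. if t \<le> m then \<sigma>1 t else \<sigma>2 t"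
  have "act H ?\<sigma> a m = act H \<sigma>1 a m" by (rule act_cong) auto
  moreover have "act H ?\<sigma> m b = act H \<sigma>2 m b" by (rule act_cong) auto
  ultimately show ?thesis using act_split[OF assms, of H ?\<sigma>] by simp
qed

lemma admissible_path_Ct:
  assumes "admissible_path G 0 1 \<sigma>" "G \<subseteq> D"
  shows "\<sigma> \<in> Ct D"
  using assms unfolding admissible_path_def Ct_def by blast

text \<open>The class of an admissible path is a rectifiable curve in \<open>Dt\<close>: all its members have the image and
end points of \<open>\<sigma>\<close>, and finite length.\<close>

lemma admissible_path_curve:
  assumes \<sigma>: "admissible_path Dt 0 1 \<sigma>" and "Dt \<subseteq> D" and "\<sigma> 0 \<in> A\<^sub>1" "\<sigma> 1 \<in> A\<^sub>2"
  obtains \<gamma> where "\<gamma> \<in> rect_curves_between D Dt A\<^sub>1 A\<^sub>2" "\<gamma> \<in> gen_curves D" "(1, \<sigma>) \<in> \<gamma>"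
proof -
  define \<gamma> where "\<gamma> = curve_rel D `` {(1, \<sigma>)}"
  have p: "(1, \<sigma>) \<in> params D" using \<sigma> \<open>Dt \<subseteq> D\<close> unfolding admissible_path_def params_def by auto
  have mem: "(1, \<sigma>) \<in> \<gamma>" unfolding \<gamma>_def using curve_rel_refl[OF p] by blast
  have cl: "q \<in> params D \<and> close_params (1, \<sigma>) q" if "q \<in> \<gamma>" for q
    using that curve_rel_close[of "(1,\<sigma>)" q D] unfolding \<gamma>_def curve_rel_def by auto
  have cur: "\<gamma> \<in> curves D" unfolding \<gamma>_def curves_def by (rule quotientI[OF p])
  have gen: "\<gamma> \<in> gen_curves D" unfolding gen_curves_def using cur mem admissible_path_Ct[OF \<sigma> \<open>Dt \<subseteq> D\<close>] by blast
  obtain V :: "real \<Rightarrow> real" where V: "\<And>u v. 0 \<le> u \<Longrightarrow> u \<le> v \<Longrightarrow> v \<le> 1 \<Longrightarrow> norm (\<sigma> v - \<sigma> u) \<le> V v - V u"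
    using \<sigma> unfolding admissible_path_def by blast
  have "curve_length \<gamma> < \<infinity>"
  proof -
    define q where "q = (SOME q. q \<in> \<gamma>)"
    have q: "q \<in> \<gamma>" unfolding q_def using mem by (rule someI)
    have "0 < fst q" using cl[OF q] by (auto simp: params_def)
    then have "param_length q \<le> ennreal (V 1 - V 0)"
      using close_params_variation[of "(1,\<sigma>)" q V] cl[OF q] V by simp
    also have "\<dots> < \<infinity>" by simp
    finally show ?thesis unfolding curve_length_def q_def .
  qed
  moreover have "connects \<gamma> Dt A\<^sub>1 A\<^sub>2"
    unfolding connects_def
  proof (intro ballI, clarify)
    fix T \<phi> assume "(T, \<phi>) \<in> \<gamma>"
    note c = conjunct2[OF cl[OF this]]
    have "\<phi> ` {0..T} \<subseteq> \<sigma> ` {0..1}" using close_params_image[OF p c] by simp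
    also have "\<dots> \<subseteq> Dt" using \<sigma> unfolding admissible_path_def by blast
    finally show "\<phi> ` {0..T} \<subseteq> Dt \<and> \<phi> 0 \<in> A\<^sub>1 \<and> \<phi> T \<in> A\<^sub>2"
      using close_params_endpoints[OF c] assms(3,4) by simp
  qed
  ultimately have "\<gamma> \<in> rect_curves_between D Dt A\<^sub>1 A\<^sub>2"
    unfolding rect_curves_between_def rect_curves_def using cur by blast
  then show thesis using that gen mem by blast
qed

text \<open>All that is used of minimality: no admissible path from \<open>A\<^sub>1\<close> to \<open>A\<^sub>2\<close> has smaller action than
\<open>\<gamma>\<close>.\<close>

lemma weak_minimizer_le_act:
  assumes "weak_minimizer D Dt S A\<^sub>1 A\<^sub>2 \<gamma>" "induces D H S"
    and \<sigma>: "admissible_path Dt 0 1 \<sigma>" and "Dt \<subseteq> D" and "\<sigma> 0 \<in> A\<^sub>1" "\<sigma> 1 \<in> A\<^sub>2"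
  shows "S \<gamma> \<le> act H \<sigma> 0 1"
proof -
  obtain \<gamma>' where g: "\<gamma>' \<in> rect_curves_between D Dt A\<^sub>1 A\<^sub>2" "\<gamma>' \<in> gen_curves D" "(1, \<sigma>) \<in> \<gamma>'"
    using admissible_path_curve[OF assms(3-6)] .
  have "S \<gamma> \<le> S \<gamma>'" using assms(1) g(1) unfolding weak_minimizer_def by (auto intro: INF_lower)
  also have "S \<gamma>' = act H \<sigma> 0 1"
    using assms(2) g(2,3) admissible_path_Ct[OF \<sigma> \<open>Dt \<subseteq> D\<close>] unfolding induces_def param_action_eq_act by blast
  finally show ?thesis .
qed

lemma rect_curve_lipschitz_path:
  assumes "\<gamma> \<in> rect_curves_between D Dt {p} {q}" "curve_length \<gamma> \<le> ennreal \<nu>" "\<nu> \<ge> 0"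
  obtains g where "g ` {0..1} \<subseteq> Dt" "g (0::real) = p" "g 1 = q"
    "\<And>s s'. 0 \<le> s \<Longrightarrow> s \<le> s' \<Longrightarrow> s' \<le> 1 \<Longrightarrow> norm (g s' - g s) \<le> \<nu> * (s' - s)"
proof -
  have g: "\<gamma> \<in> curves D" "connects \<gamma> Dt {p} {q}" using assms(1) by (auto simp: rect_curves_between_def rect_curves_def)
  obtain p0 where p0: "p0 \<in> \<gamma>" "\<And>q. q \<in> \<gamma> \<Longrightarrow> q \<in> params D \<and> close_params p0 q"
    by (rule curvesE[OF g(1)]) blast
  define P where "P = (SOME q. q \<in> \<gamma>)"
  have P: "P \<in> \<gamma>" unfolding P_def using p0(1) by (rule someI)
  obtain T f where Tf: "P = (T, f)" by (cases P)
  have f: "0 < T" "continuous_on {0..T} f" using p0(2)[OF P] Tf by (auto simp: params_def)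
  have f2: "f ` {0..T} \<subseteq> Dt" "f 0 = p" "f T = q" using g(2) P unfolding connects_def Tf by fastforce+
  have bv: "(\<Sum>k\<in>d. norm (f (Sup k) - f (Inf k))) \<le> \<nu>" if "d division_of {0..T}" for d
  proof -
    have "ennreal (\<Sum>k\<in>d. norm (f (Sup k) - f (Inf k))) \<le> param_length P"
      unfolding param_length_def Tf using that by (auto intro: SUP_upper2)
    also have "\<dots> \<le> ennreal \<nu>" using assms(2) unfolding curve_length_def P_def .
    finally show ?thesis using \<open>\<nu> \<ge> 0\<close> by (simp add: ennreal_le_iff)
  qed
  obtain g where "g ` {0..1} \<subseteq> f ` {0..T}" "g (0::real) = f 0" "g 1 = f T"
    "\<And>s s'. 0 \<le> s \<Longrightarrow> s \<le> s' \<Longrightarrow> s' \<le> 1 \<Longrightarrow> norm (g s' - g s) \<le> \<nu> * (s' - s)"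
    using lipschitz_reparametrization[OF f bv] by blast
  then show thesis using that f2 by blast
qed

section \<open>The local action of a Hamiltonian\<close>

lemma quadratic_form_le:
  fixes A :: "real ^ 'n::finite ^ 'n"
  shows "\<xi> \<bullet> (A *v \<xi>) \<le> (real CARD('n))\<^sup>2 * norm A * (norm \<xi>)\<^sup>2"
proof -
  have "\<xi> \<bullet> (A *v \<xi>) = (\<Sum>i\<in>UNIV. \<Sum>j\<in>UNIV. \<xi> $ i * (A $ i $ j * \<xi> $ j))"
    by (simp add: inner_vec_def matrix_vector_mult_def sum_distrib_left)
  also have "\<dots> \<le> (\<Sum>i\<in>(UNIV::'n set). \<Sum>j\<in>(UNIV::'n set). norm A * (norm \<xi>)\<^sup>2)"
  proof (intro sum_mono)
    fix i j
    have "\<bar>A $ i $ j\<bar> \<le> norm A" using order_trans[OF component_le_norm_cart[of "A $ i" j] Finite_Cartesian_Product.norm_nth_le[of A i]] .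
    then have "\<bar>\<xi> $ i\<bar> * (\<bar>A $ i $ j\<bar> * \<bar>\<xi> $ j\<bar>) \<le> norm \<xi> * (norm A * norm \<xi>)"
      by (intro mult_mono component_le_norm_cart mult_nonneg_nonneg) auto
    then show "\<xi> $ i * (A $ i $ j * \<xi> $ j) \<le> norm A * (norm \<xi>)\<^sup>2"
      using abs_ge_self[of "\<xi> $ i * (A $ i $ j * \<xi> $ j)"] by (simp add: abs_mult power2_eq_square mult_ac)
  qed
  also have "\<dots> = (real CARD('n))\<^sup>2 * norm A * (norm \<xi>)\<^sup>2" by (simp add: power2_eq_square)
  finally show ?thesis .
qed

lemma GDERIV_unique:
  assumes "GDERIV f x :> D" "GDERIV f x :> E"
  shows "D = (E :: 'a::real_inner)"
proof -
  have "(\<lambda>h. inner h D) = (\<lambda>h. inner h E)"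
    using has_derivative_unique assms unfolding gderiv_def by blast
  then have "inner (D - E) D = inner (D - E) E" by (rule fun_cong)
  then have "inner (D - E) (D - E) = 0" by (simp add: inner_diff_right)
  then show ?thesis by simp
qed

text \<open>Taylor expansion of order two in the second argument, along a line.\<close>

lemma has_theta_derivs_Taylor:
  assumes "has_theta_derivs D H Ht Htt" "x \<in> D"
  obtains t where "0 < t" "t < 1"
    "H x (\<theta> + \<eta>) = H x \<theta> + \<eta> \<bullet> Ht x \<theta> + (\<eta> \<bullet> (Htt x (\<theta> + t *\<^sub>R \<eta>) *v \<eta>)) / 2"
proof -
  define f where "f = (\<lambda>m::nat. \<lambda>t::real. if m = 0 then H x (\<theta> + t *\<^sub>R \<eta>) else if m = 1 then \<eta> \<bullet> Ht x (\<theta> + t *\<^sub>R \<eta>)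
    else \<eta> \<bullet> (Htt x (\<theta> + t *\<^sub>R \<eta>) *v \<eta>))"
  have line: "((\<lambda>t. \<theta> + t *\<^sub>R \<eta>) has_derivative (\<lambda>h. h *\<^sub>R \<eta>)) (at t)" for t
    by (auto intro!: derivative_eq_intros)
  have d0: "DERIV (f 0) t :> f (Suc 0) t" for t
  proof -
    have "(H x has_derivative (\<lambda>h. h \<bullet> Ht x (\<theta> + t *\<^sub>R \<eta>))) (at (\<theta> + t *\<^sub>R \<eta>))"
      using assms unfolding has_theta_derivs_def gderiv_def by blast
    from has_derivative_compose[OF line this]
    have "((\<lambda>t. H x (\<theta> + t *\<^sub>R \<eta>)) has_derivative (\<lambda>h. (h *\<^sub>R \<eta>) \<bullet> Ht x (\<theta> + t *\<^sub>R \<eta>))) (at t)" .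
    moreover have "(\<lambda>h. (h *\<^sub>R \<eta>) \<bullet> Ht x (\<theta> + t *\<^sub>R \<eta>)) = (*) (\<eta> \<bullet> Ht x (\<theta> + t *\<^sub>R \<eta>))"
      by (rule ext) simp
    ultimately show ?thesis by (simp add: f_def has_field_derivative_def)
  qed
  have d1: "DERIV (f (Suc 0)) t :> f (Suc (Suc 0)) t" for t
  proof -
    have "(Ht x has_derivative (\<lambda>h. Htt x (\<theta> + t *\<^sub>R \<eta>) *v h)) (at (\<theta> + t *\<^sub>R \<eta>))"
      using assms unfolding has_theta_derivs_def by blast
    from has_derivative_inner_right[OF has_derivative_compose[OF line this], of \<eta>]
    have "((\<lambda>t. \<eta> \<bullet> Ht x (\<theta> + t *\<^sub>R \<eta>)) has_derivative (\<lambda>h. \<eta> \<bullet> (Htt x (\<theta> + t *\<^sub>R \<eta>) *v (h *\<^sub>R \<eta>)))) (at t)" .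
    moreover have "(\<lambda>h. \<eta> \<bullet> (Htt x (\<theta> + t *\<^sub>R \<eta>) *v (h *\<^sub>R \<eta>))) = (*) (\<eta> \<bullet> (Htt x (\<theta> + t *\<^sub>R \<eta>) *v \<eta>))"
      by (rule ext) (simp add: matrix_vector_mult_scaleR)
    ultimately show ?thesis by (simp add: f_def has_field_derivative_def)
  qed
  have "\<exists>t. 0 < t \<and> t < 1 \<and> f 0 1 = (\<Sum>m<2. f m 0 / fact m * 1 ^ m) + f 2 t / fact 2 * 1 ^ 2"
    by (rule Maclaurin) (use d0 d1 in \<open>auto simp: less_2_cases_iff\<close>)
  then obtain t where "0 < t" "t < 1" "f 0 1 = (\<Sum>m<2. f m 0 / fact m * 1 ^ m) + f 2 t / fact 2 * 1 ^ 2" by blast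
  then show thesis by (intro that[of t]) (simp_all add: f_def numeral_2_eq_2)
qed

lemma hamiltonian_derivs:
  assumes "hamiltonian D H"
  shows "\<exists>Ht Htt. has_theta_derivs D H Ht Htt \<and>
    (\<forall>K. compact K \<and> K \<subseteq> D \<longrightarrow> (\<exists>m>0. \<forall>x\<in>K. \<forall>\<theta> \<xi>. \<xi> \<bullet> (Htt x \<theta> *v \<xi>) \<ge> m * (norm \<xi>)\<^sup>2))"
  using assms unfolding hamiltonian_def by (elim conjE)

lemma hamiltonian_zero_le: "hamiltonian D H \<Longrightarrow> x \<in> D \<Longrightarrow> H x 0 \<le> 0"
  unfolding hamiltonian_def by (elim conjE) (rule bspec)

lemma hamiltonian_convex_lower:
  assumes "hamiltonian D H" "compact K" "K \<subseteq> D"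
  shows "\<exists>m>0. \<exists>G. (\<forall>x\<in>K. \<forall>\<theta> \<eta>. H x (\<theta> + \<eta>) \<ge> H x \<theta> + \<eta> \<bullet> G x \<theta> + m * (norm \<eta>)\<^sup>2) \<and>
    (\<forall>x\<in>K. \<forall>\<theta>. GDERIV (H x) \<theta> :> G x \<theta>)"
proof -
  obtain Ht Htt where h: "has_theta_derivs D H Ht Htt" 
    and conv: "\<forall>K. compact K \<and> K \<subseteq> D \<longrightarrow> (\<exists>m>0. \<forall>x\<in>K. \<forall>\<theta> \<xi>. \<xi> \<bullet> (Htt x \<theta> *v \<xi>) \<ge> m * (norm \<xi>)\<^sup>2)"
    using hamiltonian_derivs[OF assms(1)] by (elim exE conjE) (rule that)
  obtain m where m: "m > 0" "\<forall>x\<in>K. \<forall>\<theta> \<xi>. \<xi> \<bullet> (Htt x \<theta> *v \<xi>) \<ge> m * (norm \<xi>)\<^sup>2"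
    using conv assms(2,3) by blast
  show ?thesis
  proof (intro exI[of _ "m / 2"] exI[of _ Ht] conjI ballI allI)
    show "m / 2 > 0" using m by simp
    fix x \<theta> assume x: "x \<in> K"
    then have xD: "x \<in> D" using assms by blast
    show "GDERIV (H x) \<theta> :> Ht x \<theta>" using h(1) xD unfolding has_theta_derivs_def by blast
    fix \<eta>
    obtain t where "H x (\<theta> + \<eta>) = H x \<theta> + \<eta> \<bullet> Ht x \<theta> + (\<eta> \<bullet> (Htt x (\<theta> + t *\<^sub>R \<eta>) *v \<eta>)) / 2"
      using has_theta_derivs_Taylor[OF h(1) xD] by blast
    then show "H x \<theta> + \<eta> \<bullet> Ht x \<theta> + m / 2 * (norm \<eta>)\<^sup>2 \<le> H x (\<theta> + \<eta>)"
      using m(2)[rule_format, OF x, of \<eta> "\<theta> + t *\<^sub>R \<eta>"] by simp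
  qed
qed

lemma hamiltonian_local_upper:
  assumes "hamiltonian D H" "compact K" "K \<subseteq> D" and b: "\<And>x. x \<in> D \<Longrightarrow> GDERIV (H x) 0 :> b x"
  shows "\<exists>M>0. \<forall>x\<in>K. \<forall>\<theta>. norm \<theta> \<le> 1 \<longrightarrow> H x \<theta> \<le> H x 0 + \<theta> \<bullet> b x + M * (norm \<theta>)\<^sup>2"
proof -
  obtain Ht Htt where h: "has_theta_derivs D H Ht Htt"
    using hamiltonian_derivs[OF assms(1)] by (elim exE conjE) (rule that)
  have "continuous_on (K \<times> cball 0 1) (\<lambda>(x,\<theta>). Htt x \<theta>)"
    by (rule continuous_on_subset[of "D \<times> UNIV"]) (use h assms(3) in \<open>auto simp: has_theta_derivs_def\<close>)
  then have "compact ((\<lambda>(x,\<theta>). Htt x \<theta>) ` (K \<times> cball 0 1))"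
    using assms(2) by (intro compact_continuous_image compact_Times compact_cball)
  then have "bounded ((\<lambda>(x,\<theta>). Htt x \<theta>) ` (K \<times> cball 0 1))" by (rule compact_imp_bounded)
  then obtain B where "B > 0" and B': "\<forall>A\<in>(\<lambda>(x,\<theta>). Htt x \<theta>) ` (K \<times> cball 0 1). norm A \<le> B"
    unfolding bounded_pos by blast
  have B: "B > 0" "\<And>x \<theta>. x \<in> K \<Longrightarrow> norm \<theta> \<le> 1 \<Longrightarrow> norm (Htt x \<theta>) \<le> B"
  proof -
    fix x \<theta> assume "x \<in> K" "norm (\<theta> :: real ^ 'a) \<le> 1"
    then have "(x, \<theta>) \<in> K \<times> cball 0 1" by simp
    then have "Htt x \<theta> \<in> (\<lambda>(x,\<theta>). Htt x \<theta>) ` (K \<times> cball 0 1)" by (rule rev_image_eqI) simp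
    then show "norm (Htt x \<theta>) \<le> B" using B' by blast
  qed fact
  define c where "c = (real CARD('a))\<^sup>2"
  have c: "c > 0" by (simp add: c_def)
  show ?thesis
  proof (intro exI[of _ "c * B"] conjI ballI allI impI)
    show "c * B > 0" using B c by simp
    fix x \<theta> assume x: "x \<in> K" and \<theta>: "norm (\<theta> :: real ^ 'a) \<le> 1"
    then have xD: "x \<in> D" using assms by blast
    have bH: "b x = Ht x 0" using h b[OF xD] xD GDERIV_unique unfolding has_theta_derivs_def by blast
    obtain t where t: "0 < t" "t < 1" "H x (0 + \<theta>) = H x 0 + \<theta> \<bullet> Ht x 0 + (\<theta> \<bullet> (Htt x (0 + t *\<^sub>R \<theta>) *v \<theta>)) / 2"
      using has_theta_derivs_Taylor[OF h(1) xD] .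
    have "norm (t *\<^sub>R \<theta>) \<le> 1" using t \<theta> mult_le_one[of t "norm \<theta>"] by simp
    then have "norm (Htt x (t *\<^sub>R \<theta>)) \<le> B" using B(2)[OF x] by blast
    then have "c * norm (Htt x (t *\<^sub>R \<theta>)) * (norm \<theta>)\<^sup>2 \<le> c * B * (norm \<theta>)\<^sup>2"
      using c by (intro mult_right_mono mult_left_mono) auto
    then have "\<theta> \<bullet> (Htt x (t *\<^sub>R \<theta>) *v \<theta>) \<le> c * B * (norm \<theta>)\<^sup>2"
      using quadratic_form_le[of \<theta> "Htt x (t *\<^sub>R \<theta>)"] unfolding c_def by linarith
    moreover have "0 \<le> c * B * (norm \<theta>)\<^sup>2" using B c by simp
    ultimately show "H x \<theta> \<le> H x 0 + \<theta> \<bullet> b x + c * B * (norm \<theta>)\<^sup>2" using t(3) bH by simp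
  qed
qed

lemma drift_continuous:
  assumes "hamiltonian D H" and b: "\<And>x. x \<in> D \<Longrightarrow> GDERIV (H x) 0 :> b x"
  shows "continuous_on D b"
proof -
  obtain Ht Htt where h: "has_theta_derivs D H Ht Htt"
    using hamiltonian_derivs[OF assms(1)] by (elim exE conjE) (rule that)
  have bH: "b x = Ht x 0" if "x \<in> D" for x
    using h b[OF that] that GDERIV_unique unfolding has_theta_derivs_def by blast
  have "continuous_on (D \<times> UNIV) (\<lambda>(x, \<theta>). Ht x \<theta>)" using h unfolding has_theta_derivs_def by blast
  then have "continuous_on D (\<lambda>x. (\<lambda>(x, \<theta>). Ht x \<theta>) (x, 0))"
    by (rule continuous_on_compose2) (auto intro!: continuous_intros)
  then show ?thesis using bH by (simp cong: continuous_on_cong)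
qed

text \<open>Since \<open>H x\<close> grows quadratically, the set \<open>{\<theta>. H x \<theta> \<le> 0}\<close> is bounded and the supremum is a genuine
one.\<close>

lemma local_action_ge:
  assumes "hamiltonian D H" "x \<in> D" "H x \<theta> \<le> 0"
  shows "y \<bullet> \<theta> \<le> local_action H x y"
proof -
  have K: "compact {x}" "{x} \<subseteq> D" using assms by auto
  obtain m G where mG: "m > 0" "\<forall>\<theta> \<eta>. H x (\<theta> + \<eta>) \<ge> H x \<theta> + \<eta> \<bullet> G x \<theta> + m * (norm \<eta>)\<^sup>2"
    using hamiltonian_convex_lower[OF assms(1) K] by blast
  define R where "R = 1 + (norm (G x 0) + \<bar>H x 0\<bar>) / m"
  have bd: "norm \<eta> \<le> R" if "H x \<eta> \<le> 0" for \<eta>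
  proof (rule ccontr)
    assume n: "\<not> norm \<eta> \<le> R"
    have R1: "R \<ge> 1" using mG(1) by (simp add: R_def)
    then have g1: "norm \<eta> > 1" using n by simp
    have "m * norm \<eta> > m * R" using n mG(1) by simp
    moreover have "m * R = m + norm (G x 0) + \<bar>H x 0\<bar>" using mG(1) by (simp add: R_def field_simps)
    ultimately have "m * norm \<eta> > norm (G x 0) + \<bar>H x 0\<bar>" using mG(1) by linarith
    then have "m * norm \<eta> * norm \<eta> > (norm (G x 0) + \<bar>H x 0\<bar>) * norm \<eta>" using g1 by (intro mult_strict_right_mono) auto
    moreover have "\<bar>H x 0\<bar> * norm \<eta> \<ge> \<bar>H x 0\<bar>" using g1 by (simp add: mult_le_cancel_left1)
    moreover have "\<eta> \<bullet> G x 0 \<ge> - (norm (G x 0) * norm \<eta>)"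
      using Cauchy_Schwarz_ineq2[of \<eta> "G x 0"] by (simp add: mult.commute abs_le_iff)
    moreover have "0 \<ge> H x 0 + \<eta> \<bullet> G x 0 + m * (norm \<eta>)\<^sup>2" using mG(2)[rule_format, of 0 \<eta>] that by simp
    ultimately show False by (simp add: power2_eq_square algebra_simps)
  qed
  have "y \<bullet> \<eta> \<le> norm y * R" if "H x \<eta> \<le> 0" for \<eta>
    using norm_cauchy_schwarz[of y \<eta>] mult_left_mono[OF bd[OF that] norm_ge_zero[of y]] by linarith
  then have "bdd_above ((\<lambda>\<theta>. y \<bullet> \<theta>) ` {\<theta>. H x \<theta> \<le> 0})" by (intro bdd_aboveI[of _ "norm y * R"]) auto
  then show ?thesis unfolding local_action_def using assms(3) by (intro cSUP_upper) auto
qed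

lemma local_action_nonneg: "hamiltonian D H \<Longrightarrow> x \<in> D \<Longrightarrow> 0 \<le> local_action H x y"
  using local_action_ge[of D H x 0 y] hamiltonian_zero_le[of D H x] by simp

lemma local_action_leI:
  assumes "hamiltonian D H" "x \<in> D" "\<And>\<theta>. H x \<theta> \<le> 0 \<Longrightarrow> y \<bullet> \<theta> \<le> c"
  shows "local_action H x y \<le> c"
  unfolding local_action_def
proof (rule cSUP_least)
  show "{\<theta>. H x \<theta> \<le> 0} \<noteq> {}" using hamiltonian_zero_le[OF assms(1,2)] by blast
qed (use assms(3) in simp)

text \<open>The cost of the velocity \<open>y\<close> for a particle drifting with velocity \<open>v\<close>: it vanishes exactly if \<open>y\<close>
and \<open>v\<close> have the same direction, or if one of them is zero.\<close>

definition excess :: "'a::real_inner \<Rightarrow> 'a \<Rightarrow> real" where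
  "excess v y = norm y * norm v - y \<bullet> v"

lemma excess_nonneg: "0 \<le> excess v y"
  using norm_cauchy_schwarz[of y v] by (simp add: excess_def)

text \<open>If \<open>H x 0 = 0\<close>, the set \<open>{\<theta>. H x \<theta> \<le> 0}\<close> lies between two balls that touch the hyperplane
orthogonal to \<open>b x\<close> at the origin.  The support function of such a ball is a multiple of the excess.
So on compact sets the local action is comparable to the excess over the drift.  At points with
\<open>b x = 0\<close> both balls reduce to the origin.\<close>

lemma local_action_comparison:
  assumes H: "hamiltonian D H" and H0: "\<And>x. x \<in> D \<Longrightarrow> H x 0 = 0"
    and b: "\<And>x. x \<in> D \<Longrightarrow> GDERIV (H x) 0 :> b x" and K: "compact K" "K \<subseteq> D"
  shows "\<exists>m>0. \<exists>M>0. \<forall>x\<in>K. \<forall>y. m * local_action H x y \<le> excess (b x) y \<and> excess (b x) y \<le> M * local_action H x y"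
proof -
  obtain m G where mG: "m > 0" "\<forall>x\<in>K. \<forall>\<theta> \<eta>. H x (\<theta> + \<eta>) \<ge> H x \<theta> + \<eta> \<bullet> G x \<theta> + m * (norm \<eta>)\<^sup>2"
    "\<forall>x\<in>K. \<forall>\<theta>. GDERIV (H x) \<theta> :> G x \<theta>"
    using hamiltonian_convex_lower[OF H K] by blast
  have Gb: "G x 0 = b x" if "x \<in> K" for x using mG(3)[rule_format, OF that] b[of x] that K GDERIV_unique by blast
  obtain M0 where M0: "M0 > 0" "\<forall>x\<in>K. \<forall>\<theta>. norm \<theta> \<le> 1 \<longrightarrow> H x \<theta> \<le> H x 0 + \<theta> \<bullet> b x + M0 * (norm \<theta>)\<^sup>2"
    using hamiltonian_local_upper[OF H K b] by blast
  have "bounded (b ` K)"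
    using K drift_continuous[OF H b] by (intro compact_imp_bounded compact_continuous_image) (auto intro: continuous_on_subset)
  then obtain B where B: "B > 0" "\<And>x. x \<in> K \<Longrightarrow> norm (b x) \<le> B" unfolding bounded_pos by auto
  define M where "M = M0 + B"
  have M: "M > 0" "M \<ge> M0" "M \<ge> B" using M0 B by (auto simp: M_def)
  have "\<forall>x\<in>K. \<forall>y. 2 * m * local_action H x y \<le> excess (b x) y \<and> excess (b x) y \<le> 2 * M * local_action H x y"
  proof (intro conjI ballI allI)
    fix x y assume x: "x \<in> K"
    then have xD: "x \<in> D" using K by blast
    have "local_action H x y \<le> excess (b x) y / (2 * m)"
    proof (rule local_action_leI[OF H xD])
      fix \<theta> assume \<theta>: "H x \<theta> \<le> 0"
      have le: "\<theta> \<bullet> b x + m * (norm \<theta>)\<^sup>2 \<le> 0" using mG(2)[rule_format, OF x, of 0 \<theta>] H0[OF xD] Gb[OF x] \<theta> by simp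
      \<comment> \<open>The outer ball has centre \<open>- c\<close> and radius \<open>norm c\<close>.\<close>
      define c where "c = (1 / (2 * m)) *\<^sub>R b x"
      have "(norm (\<theta> + c))\<^sup>2 = (norm \<theta>)\<^sup>2 + 2 * (\<theta> \<bullet> c) + (norm c)\<^sup>2"
        by (simp add: power2_norm_eq_inner inner_add_left inner_add_right inner_commute)
      also have "\<theta> \<bullet> c = (\<theta> \<bullet> b x) / (2 * m)" by (simp add: c_def)
      also have "(norm \<theta>)\<^sup>2 + 2 * ((\<theta> \<bullet> b x) / (2 * m)) = (\<theta> \<bullet> b x + m * (norm \<theta>)\<^sup>2) / m"
        using mG(1) by (simp add: field_simps)
      finally have "(norm (\<theta> + c))\<^sup>2 \<le> (norm c)\<^sup>2" using le mG(1) by (simp add: divide_nonpos_pos)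
      then have n: "norm (\<theta> + c) \<le> norm c" by simp
      have "y \<bullet> \<theta> = y \<bullet> (\<theta> + c) - y \<bullet> c" by (simp add: inner_add_right)
      also have "\<dots> \<le> norm y * norm c - y \<bullet> c"
        using norm_cauchy_schwarz[of y "\<theta> + c"] mult_left_mono[OF n norm_ge_zero[of y]] by linarith
      also have "\<dots> = excess (b x) y / (2 * m)"
        using mG(1) by (simp add: c_def excess_def field_simps)
      finally show "y \<bullet> \<theta> \<le> excess (b x) y / (2 * m)" .
    qed
    then show "2 * m * local_action H x y \<le> excess (b x) y" using mG(1) by (simp add: field_simps)
    show "excess (b x) y \<le> 2 * M * local_action H x y"
    proof (cases "y = 0")
      case True
      then show ?thesis using local_action_nonneg[OF H xD, of y] M by (simp add: excess_def)
    next
      case False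
      define c where "c = (1 / (2 * M)) *\<^sub>R b x"
      \<comment> \<open>The point of the inner ball that is extremal in the direction \<open>y\<close>.\<close>
      define \<theta> where "\<theta> = (norm c / norm y) *\<^sub>R y - c"
      have n1: "norm (\<theta> + c) = norm c" using False by (simp add: \<theta>_def)
      have "norm c \<le> 1 / 2" using B(2)[OF x] M by (simp add: c_def field_simps)
      then have n: "norm \<theta> \<le> 1" using norm_triangle_ineq4[of "\<theta> + c" c] n1 by simp
      have "(norm (\<theta> + c))\<^sup>2 = (norm \<theta>)\<^sup>2 + 2 * (\<theta> \<bullet> c) + (norm c)\<^sup>2"
        by (simp add: power2_norm_eq_inner inner_add_left inner_add_right inner_commute)
      then have "(norm \<theta>)\<^sup>2 + 2 * (\<theta> \<bullet> c) = 0" using n1 by simp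
      moreover have "\<theta> \<bullet> c = (\<theta> \<bullet> b x) / (2 * M)" by (simp add: c_def)
      ultimately have z: "\<theta> \<bullet> b x + M * (norm \<theta>)\<^sup>2 = 0" using M(1) by (simp add: field_simps)
      have "H x \<theta> \<le> H x 0 + \<theta> \<bullet> b x + M0 * (norm \<theta>)\<^sup>2" by (rule M0(2)[rule_format, OF x n])
      also have "\<dots> \<le> \<theta> \<bullet> b x + M * (norm \<theta>)\<^sup>2" using H0[OF xD] M(2) by (simp add: mult_right_mono)
      finally have "H x \<theta> \<le> 0" using z by simp
      from local_action_ge[OF H xD this] have "y \<bullet> \<theta> \<le> local_action H x y" .
      moreover have "y \<bullet> \<theta> = norm c * norm y - y \<bullet> c"
        using False by (simp add: \<theta>_def inner_diff_right dot_square_norm power2_eq_square)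
      moreover have "norm c * norm y - y \<bullet> c = excess (b x) y / (2 * M)"
        using M(1) by (simp add: c_def excess_def field_simps)
      ultimately show ?thesis using M(1) by (simp add: field_simps)
    qed
  qed
  moreover have "2 * m > 0" "2 * M > 0" using mG M by auto
  ultimately show ?thesis by blast
qed

section \<open>Hamiltonians inducing the same action\<close>

lemma local_action_scale_lower:
  assumes "hamiltonian D H" "x \<in> D" "H x \<theta> \<le> 0" "c \<le> y \<bullet> \<theta>" "s \<ge> 0"
  shows "s * c \<le> local_action H x (s *\<^sub>R y)"
proof -
  have "s * c \<le> s * (y \<bullet> \<theta>)" using assms(4,5) by (rule mult_left_mono)
  also have "\<dots> = (s *\<^sub>R y) \<bullet> \<theta>" by simp
  also have "\<dots> \<le> local_action H x (s *\<^sub>R y)" by (rule local_action_ge[OF assms(1-3)])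
  finally show ?thesis .
qed

lemma excess_scale: "s \<ge> 0 \<Longrightarrow> excess v (s *\<^sub>R y) = s * excess v y"
  by (simp add: excess_def algebra_simps)

lemma excess_continuous_on: "continuous_on D b \<Longrightarrow> continuous_on D (\<lambda>x. excess (b x) y)"
  unfolding excess_def by (intro continuous_intros)

text \<open>Two Hamiltonians that induce the same action agree on the directions of zero cost.  The actions of a
short straight segment from \<open>x\<close> in such a direction are compared: the one computed with \<open>H1\<close> is of
smaller order than the length of the segment.\<close>

lemma support_nonpos_in_free_direction:
  assumes "open D" and H1: "hamiltonian D H1" "\<And>x. x \<in> D \<Longrightarrow> H1 x 0 = 0" "\<And>x. x \<in> D \<Longrightarrow> GDERIV (H1 x) 0 :> b x"
    and H2: "hamiltonian D H2" and S: "induces D H1 S" "induces D H2 S"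
    and x: "x \<in> D" "excess (b x) y = 0" and \<theta>: "H2 x \<theta> \<le> 0"
  shows "y \<bullet> \<theta> \<le> 0"
proof (rule ccontr)
  assume "\<not> y \<bullet> \<theta> \<le> 0"
  then have pos: "y \<bullet> \<theta> > 0" by simp
  then have ne: "\<theta> \<noteq> 0" "y \<noteq> 0" by auto
  have "compact {x}" "{x} \<subseteq> D" using x by auto
  from hamiltonian_convex_lower[OF H2 this]
  obtain m G where mG: "m > 0" "\<forall>\<theta> \<eta>. H2 x (\<theta> + \<eta>) \<ge> H2 x \<theta> + \<eta> \<bullet> G x \<theta> + m * (norm \<eta>)\<^sup>2"
    by blast
  \<comment> \<open>By strict convexity, \<open>H2\<close> is negative halfway to \<open>\<theta>\<close>, and hence also at nearby base points.\<close>
  define \<theta>' where "\<theta>' = (1 / 2) *\<^sub>R \<theta>"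
  have "\<theta>' + \<theta>' = \<theta>" by (simp add: \<theta>'_def flip: scaleR_2)
  then have 1: "H2 x \<theta> \<ge> H2 x \<theta>' + \<theta>' \<bullet> G x \<theta>' + m * (norm \<theta>')\<^sup>2" using mG(2)[rule_format, of \<theta>' \<theta>'] by simp
  have 2: "H2 x 0 \<ge> H2 x \<theta>' - \<theta>' \<bullet> G x \<theta>' + m * (norm \<theta>')\<^sup>2" using mG(2)[rule_format, of \<theta>' "- \<theta>'"] by simp
  have "m * (norm \<theta>')\<^sup>2 > 0" using mG(1) ne by (simp add: \<theta>'_def)
  then have neg: "H2 x \<theta>' < 0" using 1 2 \<theta> hamiltonian_zero_le[OF H2 x(1)] by linarith
  have cH2: "continuous_on D (\<lambda>x. H2 x \<theta>')"
  proof -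
    have "continuous_on (D \<times> UNIV) (\<lambda>(x, \<theta>). H2 x \<theta>)" using H2 unfolding hamiltonian_def by (elim conjE)
    then have "continuous_on D (\<lambda>x. (\<lambda>(x, \<theta>). H2 x \<theta>) (x, \<theta>'))"
      by (rule continuous_on_compose2) (auto intro!: continuous_intros)
    then show ?thesis by simp
  qed
  obtain r0 where r0: "r0 > 0" "cball x r0 \<subseteq> D" using \<open>open D\<close> x(1) open_contains_cball by blast
  obtain m1 where m1: "m1 > 0" "\<forall>z\<in>cball x r0. \<forall>y. m1 * local_action H1 z y \<le> excess (b z) y"
    using local_action_comparison[OF H1 compact_cball r0(2)] by blast
  define c where "c = y \<bullet> \<theta>'"
  have c: "c > 0" using pos by (simp add: c_def \<theta>'_def)
  have cb: "continuous_on D (\<lambda>x. excess (b x) y)" using excess_continuous_on drift_continuous[OF H1(1,3)] by blast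
  have "\<forall>\<^sub>F z in at x. H2 z \<theta>' < 0"
    using cH2 neg \<open>open D\<close> x(1) by (intro order_tendstoD(2)) (auto simp: continuous_on_eq_continuous_at isCont_def)
  then obtain r1 where r1: "r1 > 0" "\<And>z. z \<noteq> x \<Longrightarrow> dist z x < r1 \<Longrightarrow> H2 z \<theta>' < 0" unfolding eventually_at by auto
  have "\<forall>\<^sub>F z in at x. excess (b z) y < c * m1 / 2"
    using cb x c m1(1) \<open>open D\<close> by (intro order_tendstoD(2)) (auto simp: continuous_on_eq_continuous_at isCont_def)
  then obtain r2 where r2: "r2 > 0" "\<And>z. z \<noteq> x \<Longrightarrow> dist z x < r2 \<Longrightarrow> excess (b z) y < c * m1 / 2" unfolding eventually_at by auto
  define r where "r = min r0 (min r1 r2) / 2"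
  have r: "r > 0" "r < r0" "r < r1" "r < r2" using r0 r1 r2 by (auto simp: r_def)
  have near: "z \<in> D \<and> z \<in> cball x r0 \<and> H2 z \<theta>' \<le> 0 \<and> excess (b z) y \<le> c * m1 / 2" if "dist z x \<le> r" for z
  proof -
    have z: "z \<in> cball x r0" using that r by (simp add: dist_commute)
    show ?thesis
    proof (cases "z = x")
      case True
      then show ?thesis using neg x c m1(1) z r0(2) by auto
    next
      case False
      then show ?thesis using r1(2)[of z] r2(2)[of z] that r z r0(2) by fastforce
    qed
  qed
  \<comment> \<open>A segment of length \<open>r\<close>, on which the estimates hold.\<close>
  define s where "s = r / norm y"
  have s: "s > 0" using r ne by (simp add: s_def)
  define \<sigma> where "\<sigma> t = x + t *\<^sub>R (s *\<^sub>R y)" for t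
  have near\<sigma>: "dist (\<sigma> t) x \<le> r" if "0 \<le> t" "t \<le> 1" for t
  proof -
    have "dist (\<sigma> t) x = t * r" using that s ne r by (simp add: \<sigma>_def dist_norm s_def)
    also have "\<dots> \<le> r" using that r by (simp add: mult_left_le_one_le)
    finally show ?thesis .
  qed
  have der: "vector_derivative \<sigma> (at t) = s *\<^sub>R y" for t
    unfolding \<sigma>_def[abs_def]
    by (rule vector_derivative_at) (auto simp: has_vector_derivative_def intro!: derivative_eq_intros)
  have "admissible_path D 0 1 \<sigma>"
  proof (rule admissible_path_lipschitz[of r])
    fix u v :: real assume "0 \<le> u" "u \<le> v" "v \<le> 1"
    have "\<sigma> v - \<sigma> u = (v - u) *\<^sub>R (s *\<^sub>R y)" by (simp add: \<sigma>_def algebra_simps)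
    then have "norm (\<sigma> v - \<sigma> u) = (v - u) * r" using \<open>u \<le> v\<close> r ne by (simp add: s_def abs_mult)
    then show "norm (\<sigma> v - \<sigma> u) \<le> r * (v - u)" by (simp add: mult.commute)
  next
    show "\<sigma> ` {0..1} \<subseteq> D" using near near\<sigma> by auto
  qed (use r in simp)
  then obtain \<gamma> where g: "\<gamma> \<in> gen_curves D" "(1, \<sigma>) \<in> \<gamma>" "\<sigma> \<in> Ct D"
    using admissible_path_curve[of D \<sigma> D UNIV UNIV] admissible_path_Ct[of D \<sigma> D] by blast
  then have eq: "act H1 \<sigma> 0 1 = act H2 \<sigma> 0 1" using S unfolding induces_def param_action_eq_act by metis
  have "act H1 \<sigma> 0 1 \<le> ennreal (s * c / 2 * (1 - 0))"
  proof (rule act_le[where N = "{}"])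
    fix t :: real assume t: "0 < t" "t < 1"
    note n = near[OF near\<sigma>[of t]]
    have "m1 * local_action H1 (\<sigma> t) (s *\<^sub>R y) \<le> excess (b (\<sigma> t)) (s *\<^sub>R y)" using n t m1(2) by auto
    also have "\<dots> = s * excess (b (\<sigma> t)) y" using s by (simp add: excess_scale)
    also have "\<dots> \<le> s * (c * m1 / 2)" using n t s by (intro mult_left_mono) auto
    finally show "local_action H1 (\<sigma> t) (vector_derivative \<sigma> (at t)) \<le> s * c / 2"
      unfolding der using m1(1) by (simp add: field_simps)
  qed (use s c in auto)
  moreover have "ennreal (s * c * (1 - 0)) \<le> act H2 \<sigma> 0 1"
  proof (rule act_ge)
    fix t :: real assume t: "0 < t" "t < 1"
    note n = near[OF near\<sigma>[of t]]
    show "s * c \<le> local_action H2 (\<sigma> t) (vector_derivative \<sigma> (at t))"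
      unfolding der using n t s by (intro local_action_scale_lower[OF H2, where \<theta> = \<theta>']) (auto simp: c_def)
  qed (use s c in auto)
  ultimately have "ennreal (s * c) \<le> ennreal (s * c / 2)" using eq by simp
  moreover have "s * c > 0" using s c by simp
  ultimately show False by (simp add: ennreal_le_iff mult.commute)
qed

text \<open>Every Hamiltonian inducing an action of the class vanishes at \<open>\<theta> = 0\<close>.  Otherwise its local action
would be positive in all directions, but some nonzero direction is free of cost.\<close>

lemma hamiltonian_zero_at_zero:
  fixes D :: "(real ^ 'n::finite) set"
  assumes "open D" "S \<in> actions0 D" and H: "hamiltonian D H" "induces D H S" and x: "x \<in> D"
  shows "H x 0 = 0"
proof (rule ccontr)
  assume "H x 0 \<noteq> 0"
  then have neg: "H x 0 < 0" using hamiltonian_zero_le[OF H(1) x] by simp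
  obtain H0 where H0: "hamiltonian0 D H0" "induces D H0 S" using assms(2) unfolding actions0_def by blast
  have h0: "hamiltonian D H0" "\<And>x. x \<in> D \<Longrightarrow> H0 x 0 = 0" using H0(1) unfolding hamiltonian0_def by blast+
  obtain Ht Htt where ht: "has_theta_derivs D H0 Ht Htt"
    using hamiltonian_derivs[OF h0(1)] by (elim exE conjE) (rule that)
  define b where "b x = Ht x 0" for x
  have b: "GDERIV (H0 x) 0 :> b x" if "x \<in> D" for x using ht that unfolding has_theta_derivs_def b_def by blast
  \<comment> \<open>The drift direction is free of cost; if the drift vanishes, every direction is.\<close>
  define y where "y = (if b x = 0 then axis undefined 1 else b x)"
  have y: "y \<noteq> 0" by (simp add: y_def axis_eq_0_iff)
  have ex: "excess (b x) y = 0" by (auto simp: excess_def y_def dot_square_norm power2_eq_square)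
  have "isCont (\<lambda>\<epsilon>::real. H x (\<epsilon> *\<^sub>R y)) 0"
  proof -
    have "continuous_on (D \<times> UNIV) (\<lambda>(x, \<theta>). H x \<theta>)" using H unfolding hamiltonian_def by (elim conjE)
    then have "continuous_on UNIV (\<lambda>\<epsilon>::real. (\<lambda>(x, \<theta>). H x \<theta>) (x, \<epsilon> *\<^sub>R y))"
      by (rule continuous_on_compose2) (use x in \<open>auto intro!: continuous_intros\<close>)
    then show ?thesis by (simp add: continuous_on_eq_continuous_at)
  qed
  then have "\<forall>\<^sub>F \<epsilon> in at (0::real). H x (\<epsilon> *\<^sub>R y) < 0"
    unfolding isCont_def using neg by (intro order_tendstoD(2)) auto
  then obtain d where d: "d > 0" "\<And>\<epsilon>::real. \<epsilon> \<noteq> 0 \<Longrightarrow> dist \<epsilon> 0 < d \<Longrightarrow> H x (\<epsilon> *\<^sub>R y) < 0" unfolding eventually_at by auto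
  have "H x ((d / 2) *\<^sub>R y) \<le> 0" using d(2)[of "d / 2"] d(1) by simp
  from support_nonpos_in_free_direction[OF \<open>open D\<close> h0 b H(1) H0(2) H(2) x ex this]
  have "y \<bullet> ((d / 2) *\<^sub>R y) \<le> 0" by simp
  then have "d * (y \<bullet> y) \<le> 0" by simp
  moreover have "y \<bullet> y > 0" using y by simp
  ultimately show False using d(1) by (simp add: mult_le_0_iff)
qed

lemma critical_point_if_drift_zero:
  assumes "open D" "S \<in> actions0 D" and H: "hamiltonian D H" "induces D H S"
    and b: "\<And>x. x \<in> D \<Longrightarrow> GDERIV (H x) 0 :> b x" and x: "x \<in> D" "b x = 0"
  shows "critical_point D S x"
  unfolding critical_point_def
proof (intro conjI allI impI)
  fix H2 y assume H2: "hamiltonian D H2 \<and> induces D H2 S"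
  have "local_action H2 x y \<le> 0"
  proof (rule local_action_leI)
    fix \<theta> assume "H2 x \<theta> \<le> 0"
    moreover have "excess (b x) y = 0" using x by (simp add: excess_def)
    ultimately show "y \<bullet> \<theta> \<le> 0"
      using support_nonpos_in_free_direction[OF assms(1) H(1) hamiltonian_zero_at_zero[OF assms(1,2) H] b _ H(2)] H2 x by blast
  qed (use H2 x in auto)
  moreover have "0 \<le> local_action H2 x y" using local_action_nonneg H2 x by blast
  ultimately show "local_action H2 x y = 0" by simp
qed fact

section \<open>Approximation by rectifiable curves\<close>

lemma ac_on_vector_differentiable_almost_everywhere:
  fixes \<phi> :: "real \<Rightarrow> real ^ 'n::finite"
  assumes cont: "continuous_on {a..b} \<phi>" and ac: "ac_on {a..b} \<phi>"
    and bv: "\<And>d. d division_of \<Union>d \<Longrightarrow> \<Union>d \<subseteq> {a..b} \<Longrightarrow> (\<Sum>k\<in>d. norm (\<phi> (Sup k) - \<phi> (Inf k))) \<le> B"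
  shows "\<exists>N. negligible N \<and> (\<forall>x\<in>{a<..<b} - N. \<exists>D. (\<phi> has_vector_derivative D) (at x))"
proof -
  have "\<exists>N. negligible N \<and> (\<forall>x\<in>{a<..<b} - N. \<exists>D. ((\<lambda>t. \<phi> t $ i) has_real_derivative D) (at x))" for i
  proof -
    have c: "continuous_on {a..b} (\<lambda>t. \<phi> t $ i)" using cont by (intro continuous_intros)
    have le: "norm (\<phi> y $ i - \<phi> x $ i) \<le> norm (\<phi> y - \<phi> x)" for x y
      using component_le_norm_cart[of "\<phi> y - \<phi> x" i] by simp
    have a: "ac_on {a..b} (\<lambda>t. \<phi> t $ i)"
    proof (rule ac_on_dominated[OF ac ac, of 1])
      show "norm (\<phi> y $ i - \<phi> x $ i) \<le> 1 * (norm (\<phi> y - \<phi> x) + norm (\<phi> y - \<phi> x))" for x y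
        by (rule order_trans[OF le]) simp
    qed simp
    have v: "(\<Sum>k\<in>d. norm (\<phi> (Sup k) $ i - \<phi> (Inf k) $ i)) \<le> B" if "d division_of \<Union>d" "\<Union>d \<subseteq> {a..b}" for d
      using bv[OF that] sum_mono[of d, OF le] by (rule order_trans[rotated])
    show ?thesis by (rule ac_on_differentiable_almost_everywhere[OF c a v])
  qed
  then obtain N where N: "\<And>i. negligible (N i)" "\<And>i x. x\<in>{a<..<b} - N i \<Longrightarrow> \<exists>D. ((\<lambda>t. \<phi> t $ i) has_real_derivative D) (at x)"
    by metis
  show ?thesis
  proof (intro exI[of _ "\<Union>i. N i"] conjI ballI)
    show "negligible (\<Union>i. N i)" using N(1) by (intro negligible_Union) auto
    fix x assume x: "x \<in> {a<..<b} - (\<Union>i. N i)"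
    then have "\<forall>i. \<exists>D. ((\<lambda>t. \<phi> t $ i) has_real_derivative D) (at x)" using N(2) by blast
    then obtain D where D: "\<And>i. ((\<lambda>t. \<phi> t $ i) has_real_derivative D i) (at x)" by metis
    have "(\<phi> has_vector_derivative (\<chi> i. D i)) (at x)"
      unfolding has_vector_derivative_def
    proof (subst has_derivative_componentwise_within, intro ballI)
      fix e :: "real ^ 'n" assume "e \<in> Basis"
      then obtain i where e: "e = axis i 1" by (auto simp: Basis_vec_def)
      show "((\<lambda>t. \<phi> t \<bullet> e) has_derivative (\<lambda>t. t *\<^sub>R (\<chi> i. D i) \<bullet> e)) (at x)"
      proof -
        have "(\<lambda>t. t * D i) = (*) (D i)" by (rule ext) (rule mult.commute)
        then show ?thesis using D[of i] unfolding has_field_derivative_def by (simp add: e inner_axis)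
      qed
    qed
    then show "\<exists>D. (\<phi> has_vector_derivative D) (at x)" by blast
  qed
qed

lemma norm_vector_derivative_le:
  fixes \<sigma> :: "real \<Rightarrow> 'a::real_normed_vector"
  assumes der: "(\<sigma> has_vector_derivative D) (at t)" and t: "a < t" "t < b"
    and lip: "\<And>u v. a \<le> u \<Longrightarrow> u \<le> v \<Longrightarrow> v \<le> b \<Longrightarrow> norm (\<sigma> v - \<sigma> u) \<le> L * (v - u)"
  shows "norm D \<le> L"
proof (rule field_le_epsilon)
  fix e :: real assume "e > 0"
  then obtain d where d: "d > 0" "\<And>y. norm (y - t) < d \<Longrightarrow> norm (\<sigma> y - \<sigma> t - (y - t) *\<^sub>R D) \<le> e * norm (y - t)"
    using der unfolding has_vector_derivative_def has_derivative_at_alt by blast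
  define h where "h = min d (b - t) / 2"
  have h: "h > 0" "h < d" "t + h \<le> b" using d(1) t by (auto simp: h_def min_def field_simps)
  have "h * norm D = norm (h *\<^sub>R D)" using h by simp
  also have "\<dots> = norm ((\<sigma> (t + h) - \<sigma> t) - (\<sigma> (t + h) - \<sigma> t - h *\<^sub>R D))" by simp
  also have "\<dots> \<le> norm (\<sigma> (t + h) - \<sigma> t) + norm (\<sigma> (t + h) - \<sigma> t - h *\<^sub>R D)" by (rule norm_triangle_ineq4)
  also have "\<dots> \<le> L * h + e * h" using lip[of t "t + h"] d(2)[of "t + h"] h t by simp
  finally have "h * norm D \<le> h * (L + e)" by (simp add: algebra_simps)
  then show "norm D \<le> L + e" using h by simp
qed

lemma lipschitz_variation_le:
  fixes \<sigma> :: "real \<Rightarrow> 'a::real_normed_vector"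
  assumes lip: "\<And>u v. a \<le> u \<Longrightarrow> u \<le> v \<Longrightarrow> v \<le> b \<Longrightarrow> norm (\<sigma> v - \<sigma> u) \<le> L * (v - u)" and "a \<le> b" "L \<ge> 0"
    and d: "d division_of \<Union>d" "\<Union>d \<subseteq> {a..b}"
  shows "(\<Sum>k\<in>d. norm (\<sigma> (Sup k) - \<sigma> (Inf k))) \<le> L * (b - a)"
proof -
  obtain q where q: "d \<subseteq> q" "q division_of {a..b}"
    using partial_division_extend_interval[of d a b] d by (metis box_real(2))
  have "(\<Sum>k\<in>d. norm (\<sigma> (Sup k) - \<sigma> (Inf k))) \<le> (\<Sum>k\<in>q. norm (\<sigma> (Sup k) - \<sigma> (Inf k)))"
    using q division_of_finite[OF q(2)] by (intro sum_mono2) auto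
  also have "\<dots> \<le> L * b - L * a"
    using lip by (intro control_division[OF _ \<open>a \<le> b\<close> q(2)]) (auto simp: algebra_simps)
  finally show ?thesis by (simp add: algebra_simps)
qed

lemma lipschitz_act_le:
  assumes "a \<le> b" "L \<ge> 0" and lip: "\<And>u v. a \<le> u \<Longrightarrow> u \<le> v \<Longrightarrow> v \<le> b \<Longrightarrow> norm (\<sigma> v - \<sigma> u) \<le> L * (v - u)"
    and "C \<ge> 0" and ell: "\<And>t y. a \<le> t \<Longrightarrow> t \<le> b \<Longrightarrow> local_action H (\<sigma> t) y \<le> C * norm y"
  shows "act H \<sigma> a b \<le> ennreal (C * L * (b - a))"
proof -
  have "ac_on {a..b} \<sigma>" by (rule ac_on_lipschitz[OF \<open>L \<ge> 0\<close>]) (use lip in auto)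
  from ac_on_vector_differentiable_almost_everywhere[OF lipschitz_continuous_on[OF \<open>L \<ge> 0\<close> lip] this
      lipschitz_variation_le[OF lip \<open>a \<le> b\<close> \<open>L \<ge> 0\<close>]]
  obtain N where N: "negligible N" "\<forall>x\<in>{a<..<b} - N. \<exists>D. (\<sigma> has_vector_derivative D) (at x)" by blast
  show ?thesis
  proof (rule act_le[OF \<open>a \<le> b\<close> N(1)])
    fix t assume t: "a < t" "t < b" "t \<notin> N"
    then have "t \<in> {a<..<b} - N" by simp
    then obtain D where D: "(\<sigma> has_vector_derivative D) (at t)" using N(2) by blast
    have "norm D \<le> L" by (rule norm_vector_derivative_le[OF D t(1,2) lip])
    then have "C * norm D \<le> C * L" using \<open>C \<ge> 0\<close> by (rule mult_left_mono)
    then show "local_action H (\<sigma> t) (vector_derivative \<sigma> (at t)) \<le> C * L"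
      using ell[of t D] t vector_derivative_at[OF D] by simp
  qed (use assms in simp)
qed

lemma local_action_linear_bound:
  assumes "hamiltonian D H" "\<And>x. x \<in> D \<Longrightarrow> H x 0 = 0" "\<And>x. x \<in> D \<Longrightarrow> GDERIV (H x) 0 :> b x"
    and K: "compact K" "K \<subseteq> D"
  shows "\<exists>C>0. \<forall>x\<in>K. \<forall>y. local_action H x y \<le> C * norm y"
proof -
  obtain m where m: "m > 0" "\<forall>x\<in>K. \<forall>y. m * local_action H x y \<le> excess (b x) y"
    using local_action_comparison[OF assms] by blast
  have "bounded (b ` K)"
    using K drift_continuous[OF assms(1,3)] by (intro compact_imp_bounded compact_continuous_image) (auto intro: continuous_on_subset)
  then obtain B where B: "B > 0" "\<forall>x\<in>K. norm (b x) \<le> B" unfolding bounded_pos by auto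
  show ?thesis
  proof (intro exI[of _ "2 * B / m"] conjI ballI allI)
    show "2 * B / m > 0" using m B by simp
    fix x and y :: "real ^ 'a" assume x: "x \<in> K"
    have "norm y * norm (b x) \<le> norm y * B" using B(2) x by (intro mult_left_mono) auto
    moreover have "- (y \<bullet> b x) \<le> norm y * norm (b x)" using Cauchy_Schwarz_ineq2[of y "b x"] by linarith
    ultimately have "excess (b x) y \<le> 2 * (norm y * B)" unfolding excess_def by linarith
    moreover have "m * local_action H x y \<le> excess (b x) y" using m(2) x by blast
    ultimately have "m * local_action H x y \<le> 2 * B * norm y" by (simp add: mult_ac)
    then show "local_action H x y \<le> 2 * B / m * norm y" using m(1) by (simp add: field_simps)
  qed
qed

text \<open>A Lipschitz path can be traversed in both directions over any time interval; the bound on the action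
depends only on its Lipschitz constant over \<open>{0..1}\<close>.\<close>

lemma lipschitz_path_on_interval:
  fixes g :: "real \<Rightarrow> real ^ 'n::finite"
  assumes "a < b" "\<nu> \<ge> 0" and g: "g ` {0..1} \<subseteq> G"
    and lip: "\<And>s s'. 0 \<le> s \<Longrightarrow> s \<le> s' \<Longrightarrow> s' \<le> 1 \<Longrightarrow> norm (g s' - g s) \<le> \<nu> * (s' - s)"
    and "C \<ge> 0" and ell: "\<And>s y. 0 \<le> s \<Longrightarrow> s \<le> 1 \<Longrightarrow> local_action H (g s) y \<le> C * norm y"
  shows "\<exists>\<sigma>. admissible_path G a b \<sigma> \<and> \<sigma> a = g 0 \<and> \<sigma> b = g 1 \<and> act H \<sigma> a b \<le> ennreal (C * \<nu>)"
    and "\<exists>\<sigma>. admissible_path G a b \<sigma> \<and> \<sigma> a = g 1 \<and> \<sigma> b = g 0 \<and> act H \<sigma> a b \<le> ennreal (C * \<nu>)"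
proof -
  have *: "\<exists>\<sigma>. admissible_path G a b \<sigma> \<and> \<sigma> a = h 0 \<and> \<sigma> b = h 1 \<and> act H \<sigma> a b \<le> ennreal (C * \<nu>)"
    if h: "h ` {0..1} \<subseteq> G" "\<And>s s'. 0 \<le> s \<Longrightarrow> s \<le> s' \<Longrightarrow> s' \<le> 1 \<Longrightarrow> norm (h s' - h s) \<le> \<nu> * (s' - s)"
      and ell: "\<And>s y. 0 \<le> s \<Longrightarrow> s \<le> 1 \<Longrightarrow> local_action H (h s) y \<le> C * norm y" for h :: "real \<Rightarrow> real ^ 'n"
  proof -
    define \<sigma> where "\<sigma> t = h ((t - a) / (b - a))" for t
    have l: "norm (\<sigma> v - \<sigma> u) \<le> \<nu> / (b - a) * (v - u)" if "a \<le> u" "u \<le> v" "v \<le> b" for u v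
    proof -
      have "norm (\<sigma> v - \<sigma> u) \<le> \<nu> * ((v - a) / (b - a) - (u - a) / (b - a))"
        unfolding \<sigma>_def using that \<open>a < b\<close> by (intro h(2)) (auto simp: divide_right_mono)
      also have "\<dots> = \<nu> / (b - a) * (v - u)" by (simp add: diff_divide_distrib algebra_simps)
      finally show ?thesis .
    qed
    have rng: "(t - a) / (b - a) \<in> {0..1}" if "t \<in> {a..b}" for t using that \<open>a < b\<close> by (auto simp: field_simps)
    have L: "\<nu> / (b - a) \<ge> 0" using assms by simp
    have "admissible_path G a b \<sigma>"
      by (rule admissible_path_lipschitz[OF L l]) (use h(1) rng in \<open>auto simp: \<sigma>_def\<close>)
    moreover have "act H \<sigma> a b \<le> ennreal (C * (\<nu> / (b - a)) * (b - a))"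
      by (rule lipschitz_act_le[OF _ L l \<open>C \<ge> 0\<close>]) (use rng \<open>a < b\<close> ell in \<open>auto simp: \<sigma>_def\<close>)
    ultimately show ?thesis using \<open>a < b\<close> by (intro exI[of _ \<sigma>]) (auto simp: \<sigma>_def)
  qed
  show "\<exists>\<sigma>. admissible_path G a b \<sigma> \<and> \<sigma> a = g 0 \<and> \<sigma> b = g 1 \<and> act H \<sigma> a b \<le> ennreal (C * \<nu>)"
    by (rule *[OF g lip ell])
  have r: "norm (g (1 - s') - g (1 - s)) \<le> \<nu> * (s' - s)" if "0 \<le> s" "s \<le> s'" "s' \<le> 1" for s s'
    using lip[of "1 - s'" "1 - s"] that by (simp add: norm_minus_commute)
  have im: "(\<lambda>s. g (1 - s)) ` {0..1} \<subseteq> G" using g by auto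
  show "\<exists>\<sigma>. admissible_path G a b \<sigma> \<and> \<sigma> a = g 1 \<and> \<sigma> b = g 0 \<and> act H \<sigma> a b \<le> ennreal (C * \<nu>)"
    using *[OF im r] ell by simp
qed

lemma cheap_short_connections:
  assumes "open D" and D: "Dt \<subseteq> D" and loc: "locally_rect_connected D Dt"
    and H: "hamiltonian D H" "\<And>x. x \<in> D \<Longrightarrow> H x 0 = 0" "\<And>x. x \<in> D \<Longrightarrow> GDERIV (H x) 0 :> b x"
    and p: "p \<in> Dt" and "\<epsilon> > 0"
  shows "\<exists>r>0. \<forall>w\<in>cball p r \<inter> Dt. \<forall>u v. u < v \<longrightarrow>
    (\<exists>\<sigma>. admissible_path Dt u v \<sigma> \<and> \<sigma> u = p \<and> \<sigma> v = w \<and> act H \<sigma> u v \<le> ennreal \<epsilon>) \<and>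
    (\<exists>\<sigma>. admissible_path Dt u v \<sigma> \<and> \<sigma> u = w \<and> \<sigma> v = p \<and> act H \<sigma> u v \<le> ennreal \<epsilon>)"
proof -
  have "p \<in> D" using p D by blast
  then obtain \<rho> where \<rho>: "\<rho> > 0" "cball p \<rho> \<subseteq> D" using \<open>open D\<close> open_contains_cball by blast
  obtain C where C: "C > 0" "\<forall>x\<in>cball p \<rho>. \<forall>y. local_action H x y \<le> C * norm y"
    using local_action_linear_bound[OF H compact_cball \<rho>(2)] by blast
  define \<nu> where "\<nu> = min \<rho> (\<epsilon> / C)"
  have \<nu>: "\<nu> > 0" "\<nu> \<le> \<rho>" "C * \<nu> \<le> \<epsilon>" using \<rho> C \<open>\<epsilon> > 0\<close> by (auto simp: \<nu>_def min_def field_simps)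
  obtain r where r: "r > 0" "\<forall>w\<in>cball p r \<inter> Dt. \<exists>\<gamma>\<in>rect_curves_between D Dt {p} {w}. curve_length \<gamma> \<le> ennreal \<nu>"
    using loc p \<nu>(1) unfolding locally_rect_connected_def by blast
  show ?thesis
  proof (intro exI[of _ r] conjI ballI allI impI)
    show "r > 0" by fact
    fix w u v :: _ assume w: "w \<in> cball p r \<inter> Dt" and uv: "(u::real) < v"
    obtain \<gamma> where g: "\<gamma> \<in> rect_curves_between D Dt {p} {w}" "curve_length \<gamma> \<le> ennreal \<nu>" using r(2) w by blast
    obtain g where gg: "g ` {0..1} \<subseteq> Dt" "g (0::real) = p" "g 1 = w"
      "\<And>s s'. 0 \<le> s \<Longrightarrow> s \<le> s' \<Longrightarrow> s' \<le> 1 \<Longrightarrow> norm (g s' - g s) \<le> \<nu> * (s' - s)"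
      using rect_curve_lipschitz_path[OF g] \<nu>(1) by (metis less_imp_le)
    have ell: "local_action H (g s) y \<le> C * norm y" if "0 \<le> s" "s \<le> 1" for s y
    proof -
      have "norm (g s - g 0) \<le> \<nu> * (s - 0)" using gg(4)[of 0 s] that by simp
      also have "\<dots> \<le> \<nu>" using that \<nu>(1) by (simp add: mult_left_le)
      finally have "g s \<in> cball p \<rho>" using \<nu>(2) gg(2) by (simp add: dist_norm norm_minus_commute)
      then show ?thesis using C(2) by blast
    qed
    have le: "ennreal (C * \<nu>) \<le> ennreal \<epsilon>" using \<nu>(3) by (rule ennreal_leI)
    show "\<exists>\<sigma>. admissible_path Dt u v \<sigma> \<and> \<sigma> u = p \<and> \<sigma> v = w \<and> act H \<sigma> u v \<le> ennreal \<epsilon>"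
      using lipschitz_path_on_interval(1)[OF uv less_imp_le[OF \<nu>(1)] gg(1,4) less_imp_le[OF C(1)] ell] gg(2,3) order_trans[OF _ le] by blast
    show "\<exists>\<sigma>. admissible_path Dt u v \<sigma> \<and> \<sigma> u = w \<and> \<sigma> v = p \<and> act H \<sigma> u v \<le> ennreal \<epsilon>"
      using lipschitz_path_on_interval(2)[OF uv less_imp_le[OF \<nu>(1)] gg(1,4) less_imp_le[OF C(1)] ell] gg(2,3) order_trans[OF _ le] by blast
  qed
qed

lemma lipschitz_connected:
  assumes "connected Dt" and loc: "locally_rect_connected D Dt" and "p \<in> Dt" "q \<in> Dt"
  shows "\<exists>L\<ge>0. \<exists>g. g ` {0..1} \<subseteq> Dt \<and> g (0::real) = p \<and> g 1 = q \<and>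
    (\<forall>s s'. 0 \<le> s \<and> s \<le> s' \<and> s' \<le> 1 \<longrightarrow> norm (g s' - g s) \<le> L * (s' - s))"
proof -
  define R where "R p q \<longleftrightarrow> (\<exists>L\<ge>0. \<exists>g. g ` {0..1} \<subseteq> Dt \<and> g (0::real) = p \<and> g 1 = q \<and>
    (\<forall>s s'. 0 \<le> s \<and> s \<le> s' \<and> s' \<le> 1 \<longrightarrow> norm (g s' - g s) \<le> L * (s' - s)))" for p q
  have "R p q"
  proof (rule connected_equivalence_relation[OF \<open>connected Dt\<close> \<open>p \<in> Dt\<close> \<open>q \<in> Dt\<close>])
    fix x y assume "R x y"
    then obtain L g where g: "L \<ge> 0" "g ` {0..1} \<subseteq> Dt" "g (0::real) = x" "g 1 = y"
      "\<forall>s s'. 0 \<le> s \<and> s \<le> s' \<and> s' \<le> 1 \<longrightarrow> norm (g s' - g s) \<le> L * (s' - s)" unfolding R_def by blast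
    have "norm (g (1 - s') - g (1 - s)) \<le> L * (s' - s)" if "0 \<le> s" "s \<le> s'" "s' \<le> 1" for s s'
      using g(5)[rule_format, of "1 - s'" "1 - s"] that by (simp add: norm_minus_commute)
    moreover have "(\<lambda>s. g (1 - s)) ` {0..1} \<subseteq> Dt" using g(2) by auto
    ultimately show "R y x" unfolding R_def using g(1,3,4) by (intro exI[of _ L] conjI exI[of _ "\<lambda>s. g (1 - s)"]) auto
  next
    fix x y z assume "R x y" "R y z"
    obtain L1 g1 where g1: "L1 \<ge> 0" "g1 ` {0..1} \<subseteq> Dt" "g1 (0::real) = x" "g1 1 = y"
      "\<forall>s s'. 0 \<le> s \<and> s \<le> s' \<and> s' \<le> 1 \<longrightarrow> norm (g1 s' - g1 s) \<le> L1 * (s' - s)" using \<open>R x y\<close> unfolding R_def by blast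
    obtain L2 g2 where g2: "L2 \<ge> 0" "g2 ` {0..1} \<subseteq> Dt" "g2 (0::real) = y" "g2 1 = z"
      "\<forall>s s'. 0 \<le> s \<and> s \<le> s' \<and> s' \<le> 1 \<longrightarrow> norm (g2 s' - g2 s) \<le> L2 * (s' - s)" using \<open>R y z\<close> unfolding R_def by blast
    define g where "g t = (if t \<le> 1 / 2 then g1 (2 * t) else g2 (2 * t - 1))" for t
    define L where "L = 2 * (L1 + L2)"
    have "norm (g s' - g s) \<le> L * (s' - s)" if s: "0 \<le> s" "s \<le> s'" "s' \<le> 1" for s s'
    proof -
      have e: "2 * L1 * (s' - s) \<le> L * (s' - s)" "2 * L2 * (s' - s) \<le> L * (s' - s)"
        using g1(1) g2(1) s by (auto simp: L_def intro!: mult_right_mono)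
      consider "s' \<le> 1 / 2" | "s > 1 / 2" | "s \<le> 1 / 2" "s' > 1 / 2" by linarith
      then show ?thesis
      proof cases
        case 1 
        then have "norm (g s' - g s) \<le> L1 * (2 * s' - 2 * s)" using g1(5)[rule_format, of "2 * s" "2 * s'"] s by (simp add: g_def)
        then show ?thesis using e(1) by (simp add: algebra_simps)
      next
        case 2
        then have "norm (g s' - g s) \<le> L2 * ((2 * s' - 1) - (2 * s - 1))" using g2(5)[rule_format, of "2 * s - 1" "2 * s' - 1"] s by (simp add: g_def)
        then show ?thesis using e(2) by (simp add: algebra_simps)
      next
        case 3
        have 1: "norm (g1 1 - g1 (2 * s)) \<le> L1 * (1 - 2 * s)" using g1(5)[rule_format, of "2 * s" 1] s 3 by simp
        have 2: "norm (g2 (2 * s' - 1) - g2 0) \<le> L2 * (2 * s' - 1)" using g2(5)[rule_format, of 0 "2 * s' - 1"] s 3 by simp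
        have "g s' - g s = (g2 (2 * s' - 1) - g2 0) + (g1 1 - g1 (2 * s))" using 3 g1(4) g2(3) by (simp add: g_def)
        then have "norm (g s' - g s) \<le> L2 * (2 * s' - 1) + L1 * (1 - 2 * s)" using 1 2 norm_triangle_ineq[of "g2 (2 * s' - 1) - g2 0" "g1 1 - g1 (2 * s)"] by simp
        moreover have "L2 * (2 * s' - 1) \<le> L2 * (2 * s' - 2 * s)" using g2(1) 3 by (intro mult_left_mono) auto
        moreover have "L1 * (1 - 2 * s) \<le> L1 * (2 * s' - 2 * s)" using g1(1) 3 by (intro mult_left_mono) auto
        ultimately show ?thesis by (simp add: L_def algebra_simps)
      qed
    qed
    moreover have "g ` {0..1} \<subseteq> Dt" using g1(2) g2(2) by (auto simp: g_def image_subset_iff)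
    moreover have "L \<ge> 0" "g 0 = x" "g 1 = z" using g1 g2 by (auto simp: L_def g_def)
    ultimately show "R x z" unfolding R_def by blast
  next
    fix a assume a: "a \<in> Dt"
    then obtain r where r: "r > 0" "\<forall>w\<in>cball a r \<inter> Dt. \<exists>\<gamma>\<in>rect_curves_between D Dt {a} {w}. curve_length \<gamma> \<le> ennreal 1"
      using loc unfolding locally_rect_connected_def by (meson zero_less_one)
    show "\<exists>T. openin (top_of_set Dt) T \<and> a \<in> T \<and> (\<forall>x\<in>T. R a x)"
    proof (intro exI[of _ "Dt \<inter> ball a r"] conjI ballI)
      show "openin (top_of_set Dt) (Dt \<inter> ball a r)" by (rule openin_open_Int) simp
      show "a \<in> Dt \<inter> ball a r" using a r by simp
      fix x assume "x \<in> Dt \<inter> ball a r"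
      then obtain \<gamma> where g: "\<gamma> \<in> rect_curves_between D Dt {a} {x}" "curve_length \<gamma> \<le> ennreal 1" using r(2) by force
      obtain g where "g ` {0..1} \<subseteq> Dt" "g (0::real) = a" "g 1 = x"
        "\<And>s s'. 0 \<le> s \<Longrightarrow> s \<le> s' \<Longrightarrow> s' \<le> 1 \<Longrightarrow> norm (g s' - g s) \<le> 1 * (s' - s)"
        using rect_curve_lipschitz_path[OF g] by (metis zero_le_one)
      then show "R a x" unfolding R_def by (intro exI[of _ 1] conjI exI[of _ g]) auto
    qed
  qed
  then show ?thesis unfolding R_def .
qed

text \<open>A path in \<^const>\<open>Ct\<close> may have infinite length near finitely many times.  Replacing it there by
short connections, which exist by local connectedness, makes it rectifiable at arbitrarily small
additional cost.\<close>

lemma rectifiable_approximation: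
  fixes \<phi> :: "real \<Rightarrow> real ^ 'n::finite"
  assumes "open D" and D: "Dt \<subseteq> D" and loc: "locally_rect_connected D Dt"
    and H: "hamiltonian D H" "\<And>x. x \<in> D \<Longrightarrow> H x 0 = 0" "\<And>x. x \<in> D \<Longrightarrow> GDERIV (H x) 0 :> b x"
    and \<phi>: "\<phi> \<in> Ct D" "\<phi> ` {0..1} \<subseteq> Dt" and uv: "0 \<le> u" "u \<le> v" "v \<le> 1" and "\<epsilon> > 0"
  shows "\<exists>\<sigma>. admissible_path Dt u v \<sigma> \<and> \<sigma> u = \<phi> u \<and> \<sigma> v = \<phi> v \<and> act H \<sigma> u v \<le> act H \<phi> u v + ennreal \<epsilon>"
proof -
  \<comment> \<open>Quantifying over all \<open>\<epsilon>\<close> makes the property additive in the time interval, so that it needs to be verified only locally.\<close>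
  define Q where "Q u v \<longleftrightarrow> (\<forall>\<epsilon>>0. \<exists>\<sigma>. admissible_path Dt u v \<sigma> \<and> \<sigma> u = \<phi> u \<and> \<sigma> v = \<phi> v \<and>
    act H \<sigma> u v \<le> act H \<phi> u v + ennreal \<epsilon>)" for u v
  have cont: "continuous_on {0..1} \<phi>" using \<phi>(1) unfolding Ct_def by blast
  obtain F where F: "finite F" "\<forall>\<alpha>\<in>{0..1} - F. \<exists>r>0. abs_cont_on ({0..1} \<inter> cball \<alpha> r) \<phi>"
    using \<phi>(1) unfolding Ct_def by blast
  have trans: "Q u w" if uv: "Q u v" and vw: "Q v w" and le: "u \<le> v" "v \<le> w" for u v w
    unfolding Q_def
  proof (intro allI impI)
    fix \<epsilon> :: real assume "\<epsilon> > 0"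
    then have e2: "\<epsilon> / 2 > 0" by simp
    obtain \<sigma>1 where s1: "admissible_path Dt u v \<sigma>1" "\<sigma>1 u = \<phi> u" "\<sigma>1 v = \<phi> v" "act H \<sigma>1 u v \<le> act H \<phi> u v + ennreal (\<epsilon> / 2)"
      using uv e2 unfolding Q_def by blast
    obtain \<sigma>2 where s2: "admissible_path Dt v w \<sigma>2" "\<sigma>2 v = \<phi> v" "\<sigma>2 w = \<phi> w" "act H \<sigma>2 v w \<le> act H \<phi> v w + ennreal (\<epsilon> / 2)"
      using vw e2 unfolding Q_def by blast
    let ?\<sigma> = "\<lambda>t. if t \<le> v then \<sigma>1 t else \<sigma>2 t"
    have "admissible_path Dt u w ?\<sigma>" by (rule admissible_path_join[OF s1(1) s2(1) _ le]) (simp add: s1 s2)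
    moreover have "?\<sigma> u = \<phi> u" "?\<sigma> w = \<phi> w" using s1(2,3) s2(3) le by auto
    moreover have "act H ?\<sigma> u w \<le> act H \<phi> u w + ennreal \<epsilon>"
    proof -
      have "act H ?\<sigma> u w = act H \<sigma>1 u v + act H \<sigma>2 v w" by (rule act_join[OF le])
      also have "\<dots> \<le> (act H \<phi> u v + ennreal (\<epsilon> / 2)) + (act H \<phi> v w + ennreal (\<epsilon> / 2))" using s1(4) s2(4) by (rule add_mono)
      also have "\<dots> = (act H \<phi> u v + act H \<phi> v w) + (ennreal (\<epsilon> / 2) + ennreal (\<epsilon> / 2))" by (simp add: ac_simps)
      also have "\<dots> = act H \<phi> u w + ennreal \<epsilon>"
        using act_split[OF le, of H \<phi>] \<open>\<epsilon> > 0\<close> by (simp flip: ennreal_plus)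
      finally show ?thesis .
    qed
    ultimately show "\<exists>\<sigma>. admissible_path Dt u w \<sigma> \<and> \<sigma> u = \<phi> u \<and> \<sigma> w = \<phi> w \<and> act H \<sigma> u w \<le> act H \<phi> u w + ennreal \<epsilon>" by blast
  qed
  have local_good: "\<exists>d>0. \<forall>u v. u \<le> x \<and> x \<le> v \<and> v - u < d \<longrightarrow> 0 \<le> u \<and> v \<le> 1 \<longrightarrow> Q u v" if x: "x \<in> {0..1} - F" for x
  proof -
    obtain r where r: "r > 0" "abs_cont_on ({0..1} \<inter> cball x r) \<phi>" using F(2) x by blast
    obtain \<delta> where \<delta>: "\<delta> > 0" "\<And>d. d division_of \<Union>d \<Longrightarrow> \<Union>d \<subseteq> {0..1} \<inter> cball x r \<Longrightarrow> (\<Sum>k\<in>d. measure lborel k) < \<delta> \<Longrightarrow>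
        (\<Sum>k\<in>d. norm (\<phi> (Sup k) - \<phi> (Inf k))) < 1"
      by (rule ac_onD[OF r(2)[unfolded abs_cont_on_iff_ac_on] zero_less_one]) blast
    have "Q u v" if uv: "u \<le> x" "x \<le> v" "v - u < min r \<delta>" "0 \<le> u" "v \<le> 1" for u v
    proof -
      have sub: "{u..v} \<subseteq> {0..1} \<inter> cball x r" using uv by (auto simp: dist_real_def)
      have "u \<le> v" using uv by simp
      have bv: "(\<Sum>k\<in>d. norm (\<phi> (Sup k) - \<phi> (Inf k))) \<le> 1" if d: "d division_of {u..v}" for d
      proof -
        have U: "\<Union>d = {u..v}" using d by (rule division_ofD(6))
        have "(\<Sum>k\<in>d. measure lborel k) < \<delta>" using division_length[OF \<open>u \<le> v\<close> d] uv(3) by simp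
        then show ?thesis using \<delta>(2)[of d] d sub U by (metis less_imp_le)
      qed
      have V: "\<exists>V::real \<Rightarrow> real. \<forall>s t. u \<le> s \<and> s \<le> t \<and> t \<le> v \<longrightarrow> norm (\<phi> t - \<phi> s) \<le> V t - V s"
        by (rule bounded_variation_control[OF \<open>u \<le> v\<close> bv]) (assumption | rule exI | force)+
      have "admissible_path Dt u v \<phi>"
        unfolding admissible_path_def
      proof (intro conjI)
        show "continuous_on {u..v} \<phi>" by (rule continuous_on_subset[OF cont]) (use uv in auto)
        show "\<phi> ` {u..v} \<subseteq> Dt" using \<phi>(2) uv by (force simp: image_subset_iff)
        have "abs_cont_on ({u..v} \<inter> cball t 1) \<phi>" for t
          by (rule abs_cont_on_subset[OF r(2)]) (use sub in blast)
        then show "\<exists>F. finite F \<and> (\<forall>t\<in>{u..v} - F. \<exists>r>0. abs_cont_on ({u..v} \<inter> cball t r) \<phi>)"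
          by (intro exI[of _ "{}"]) (auto intro!: exI[of _ 1])
        show "\<exists>V::real \<Rightarrow> real. \<forall>s t. u \<le> s \<and> s \<le> t \<and> t \<le> v \<longrightarrow> norm (\<phi> t - \<phi> s) \<le> V t - V s" by (rule V)
      qed
      then show "Q u v" unfolding Q_def by (intro allI impI exI[of _ \<phi>]) simp
    qed
    then show ?thesis using r(1) \<delta>(1) by (intro exI[of _ "min r \<delta>"]) auto
  qed
  have good: "Q u v" if uv: "0 \<le> u" "u \<le> v" "v \<le> 1" "{u..v} \<inter> F = {}" for u v
  proof -
    have "u \<le> u \<and> v \<le> v \<longrightarrow> Q u v"
    proof (rule Bolzano[OF uv(2), where P = "\<lambda>s t. u \<le> s \<and> t \<le> v \<longrightarrow> Q s t"])
      show "u \<le> a \<and> c \<le> v \<longrightarrow> Q a c" if "u \<le> a \<and> b \<le> v \<longrightarrow> Q a b" "u \<le> b \<and> c \<le> v \<longrightarrow> Q b c" "a \<le> b" "b \<le> c" for a b c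
        using that trans[of a b c] by auto
      fix x assume x: "u \<le> x" "x \<le> v"
      then have "x \<in> {u..v}" by simp
      then have "x \<notin> F" using uv(4) by blast
      then have "x \<in> {0..1} - F" using x uv by simp
      from local_good[OF this] obtain d where d: "d > 0" "\<forall>u v. u \<le> x \<and> x \<le> v \<and> v - u < d \<longrightarrow> 0 \<le> u \<and> v \<le> 1 \<longrightarrow> Q u v" by blast
      have "Q a b" if "a \<le> x" "x \<le> b" "b - a < d" "u \<le> a" "b \<le> v" for a b
        using d(2)[rule_format, of a b] that uv by simp
      then show "\<exists>d>0. \<forall>a b. a \<le> x \<and> x \<le> b \<and> b - a < d \<longrightarrow> u \<le> a \<and> b \<le> v \<longrightarrow> Q a b"
        using d(1) by blast
    qed
    then show ?thesis by simp
  qed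
  have pt: "Q x x" if x: "0 \<le> x" "x \<le> 1" for x
  proof -
    have "admissible_path Dt x x \<phi>"
    proof (rule admissible_path_lipschitz[of 0])
      fix u v assume "x \<le> u" "u \<le> v" "v \<le> x"
      then have "u = v" by simp
      then show "norm (\<phi> v - \<phi> u) \<le> 0 * (v - u)" by simp
    qed (use \<phi>(2) x in auto)
    then show ?thesis unfolding Q_def by (intro allI impI exI[of _ \<phi>]) simp
  qed
  define link where "link p w \<epsilon> \<longleftrightarrow> (\<forall>u v. u < v \<longrightarrow>
    (\<exists>\<sigma>. admissible_path Dt u v \<sigma> \<and> \<sigma> u = p \<and> \<sigma> v = w \<and> act H \<sigma> u v \<le> ennreal \<epsilon>))" for p w \<epsilon>
  have near: "\<exists>r>0. \<forall>t\<in>{0..1}. \<bar>t - x\<bar> < r \<longrightarrow> link (\<phi> x) (\<phi> t) \<epsilon> \<and> link (\<phi> t) (\<phi> x) \<epsilon>"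
    if x: "x \<in> {0..1}" and "\<epsilon> > 0" for x \<epsilon>
  proof -
    have "\<phi> x \<in> Dt" using \<phi>(2) x by blast
    have "\<exists>r>0. \<forall>w\<in>cball (\<phi> x) r \<inter> Dt. link (\<phi> x) w \<epsilon> \<and> link w (\<phi> x) \<epsilon>"
      using cheap_short_connections[OF \<open>open D\<close> D loc H \<open>\<phi> x \<in> Dt\<close> \<open>\<epsilon> > 0\<close>] unfolding link_def by (simp add: imp_conjR all_conj_distrib)
    then obtain r where r: "r > 0" "\<forall>w\<in>cball (\<phi> x) r \<inter> Dt. link (\<phi> x) w \<epsilon> \<and> link w (\<phi> x) \<epsilon>" by blast
    obtain d where d: "d > 0" "\<forall>t\<in>{0..1}. dist t x < d \<longrightarrow> dist (\<phi> t) (\<phi> x) < r"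
      using cont x r(1) unfolding continuous_on_iff by blast
    have "\<phi> t \<in> cball (\<phi> x) r \<inter> Dt" if "t \<in> {0..1}" "\<bar>t - x\<bar> < d" for t
      using d(2)[rule_format, OF that(1)] that \<phi>(2) by (auto simp: dist_real_def dist_commute less_imp_le)
    then show ?thesis using d(1) r(2) by blast
  qed
  \<comment> \<open>Up to an exceptional time: follow \<open>\<phi>\<close> almost to the end, then take a cheap short connection.\<close>
  have to_bad: "Q u x" if ux: "0 \<le> u" "u < x" "x \<le> 1" "{u..<x} \<inter> F = {}" for u x
    unfolding Q_def
  proof (intro allI impI)
    fix \<epsilon> :: real assume "\<epsilon> > 0"
    then have e2: "\<epsilon> / 2 > 0" by simp
    have "x \<in> {0..1}" using ux by simp
    from near[OF this e2] obtain r where r: "r > 0" "\<forall>t\<in>{0..1}. \<bar>t - x\<bar> < r \<longrightarrow> link (\<phi> t) (\<phi> x) (\<epsilon> / 2)" by blast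
    define m where "m = max u (x - r / 2)"
    have m: "u \<le> m" "m < x" "m \<in> {0..1}" "\<bar>m - x\<bar> < r" using ux r(1) by (auto simp: m_def)
    have "{u..m} \<subseteq> {u..<x}" using m by auto
    then have "{u..m} \<inter> F = {}" using ux(4) by blast
    then have "Q u m" using good[of u m] m ux by simp
    then obtain \<sigma>1 where s1: "admissible_path Dt u m \<sigma>1" "\<sigma>1 u = \<phi> u" "\<sigma>1 m = \<phi> m" "act H \<sigma>1 u m \<le> act H \<phi> u m + ennreal (\<epsilon> / 2)"
      using e2 unfolding Q_def by blast
    obtain \<sigma>2 where s2: "admissible_path Dt m x \<sigma>2" "\<sigma>2 m = \<phi> m" "\<sigma>2 x = \<phi> x" "act H \<sigma>2 m x \<le> ennreal (\<epsilon> / 2)"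
      using r(2)[rule_format, OF m(3,4)] m(2) unfolding link_def by blast
    let ?\<sigma> = "\<lambda>t. if t \<le> m then \<sigma>1 t else \<sigma>2 t"
    have "admissible_path Dt u x ?\<sigma>" by (rule admissible_path_join[OF s1(1) s2(1)]) (use m s1 s2 in auto)
    moreover have "?\<sigma> u = \<phi> u" "?\<sigma> x = \<phi> x" using s1(2,3) s2(3) m by auto
    moreover have "act H ?\<sigma> u x \<le> act H \<phi> u x + ennreal \<epsilon>"
    proof -
      have "act H ?\<sigma> u x = act H \<sigma>1 u m + act H \<sigma>2 m x" using m by (intro act_join) auto
      also have "\<dots> \<le> (act H \<phi> u m + ennreal (\<epsilon> / 2)) + ennreal (\<epsilon> / 2)" using s1(4) s2(4) by (rule add_mono)
      also have "\<dots> = act H \<phi> u m + ennreal \<epsilon>" using \<open>\<epsilon> > 0\<close> by (simp add: add.assoc flip: ennreal_plus)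
      also have "act H \<phi> u m \<le> act H \<phi> u x" using act_split[of u m x H \<phi>] m by simp
      finally show ?thesis by simp
    qed
    ultimately show "\<exists>\<sigma>. admissible_path Dt u x \<sigma> \<and> \<sigma> u = \<phi> u \<and> \<sigma> x = \<phi> x \<and> act H \<sigma> u x \<le> act H \<phi> u x + ennreal \<epsilon>" by blast
  qed
  have from_bad: "Q x v" if xv: "0 \<le> x" "x < v" "v \<le> 1" "{x<..v} \<inter> F = {}" for x v
    unfolding Q_def
  proof (intro allI impI)
    fix \<epsilon> :: real assume "\<epsilon> > 0"
    then have e2: "\<epsilon> / 2 > 0" by simp
    have "x \<in> {0..1}" using xv by simp
    from near[OF this e2] obtain r where r: "r > 0" "\<forall>t\<in>{0..1}. \<bar>t - x\<bar> < r \<longrightarrow> link (\<phi> x) (\<phi> t) (\<epsilon> / 2)" by blast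
    define m where "m = min v (x + r / 2)"
    have m: "m \<le> v" "x < m" "m \<in> {0..1}" "\<bar>m - x\<bar> < r" using xv r(1) by (auto simp: m_def)
    have "{m..v} \<subseteq> {x<..v}" using m by auto
    then have "{m..v} \<inter> F = {}" using xv(4) by blast
    then have "Q m v" using good[of m v] m xv by simp
    then obtain \<sigma>2 where s2: "admissible_path Dt m v \<sigma>2" "\<sigma>2 m = \<phi> m" "\<sigma>2 v = \<phi> v" "act H \<sigma>2 m v \<le> act H \<phi> m v + ennreal (\<epsilon> / 2)"
      using e2 unfolding Q_def by blast
    obtain \<sigma>1 where s1: "admissible_path Dt x m \<sigma>1" "\<sigma>1 x = \<phi> x" "\<sigma>1 m = \<phi> m" "act H \<sigma>1 x m \<le> ennreal (\<epsilon> / 2)"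
      using r(2)[rule_format, OF m(3,4)] m(2) unfolding link_def by blast
    let ?\<sigma> = "\<lambda>t. if t \<le> m then \<sigma>1 t else \<sigma>2 t"
    have "admissible_path Dt x v ?\<sigma>" by (rule admissible_path_join[OF s1(1) s2(1)]) (use m s1 s2 in auto)
    moreover have "?\<sigma> x = \<phi> x" "?\<sigma> v = \<phi> v" using s1(2,3) s2(2,3) m by auto
    moreover have "act H ?\<sigma> x v \<le> act H \<phi> x v + ennreal \<epsilon>"
    proof -
      have "act H ?\<sigma> x v = act H \<sigma>1 x m + act H \<sigma>2 m v" using m by (intro act_join) auto
      also have "\<dots> \<le> ennreal (\<epsilon> / 2) + (act H \<phi> m v + ennreal (\<epsilon> / 2))" using s1(4) s2(4) by (rule add_mono)
      also have "\<dots> = act H \<phi> m v + (ennreal (\<epsilon> / 2) + ennreal (\<epsilon> / 2))" by (simp add: ac_simps)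
      also have "\<dots> = act H \<phi> m v + ennreal \<epsilon>" using \<open>\<epsilon> > 0\<close> by (simp flip: ennreal_plus)
      also have "act H \<phi> m v \<le> act H \<phi> x v" using act_split[of x m v H \<phi>] m by simp
      finally show ?thesis by simp
    qed
    ultimately show "\<exists>\<sigma>. admissible_path Dt x v \<sigma> \<and> \<sigma> x = \<phi> x \<and> \<sigma> v = \<phi> v \<and> act H \<sigma> x v \<le> act H \<phi> x v + ennreal \<epsilon>" by blast
  qed
  have "0 \<le> u \<and> v \<le> 1 \<longrightarrow> Q u v"
  proof (rule Bolzano[OF uv(2), where P = "\<lambda>s t. 0 \<le> s \<and> t \<le> 1 \<longrightarrow> Q s t"])
    show "0 \<le> a \<and> c \<le> 1 \<longrightarrow> Q a c" if "0 \<le> a \<and> b \<le> 1 \<longrightarrow> Q a b" "0 \<le> b \<and> c \<le> 1 \<longrightarrow> Q b c" "a \<le> b" "b \<le> c" for a b c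
      using that trans[of a b c] by auto
    fix x assume x: "u \<le> x" "x \<le> v"
    obtain d where d: "d > 0" "\<forall>y\<in>F. y \<noteq> x \<longrightarrow> d \<le> dist x y" using finite_set_avoid[OF F(1)] by blast
    have "Q a b" if ab: "a \<le> x" "x \<le> b" "b - a < d" "0 \<le> a" "b \<le> 1" for a b
    proof -
      have sep: "y = x" if "y \<in> F" "a \<le> y" "y \<le> b" for y
      proof (rule ccontr)
        assume "y \<noteq> x"
        then have "d \<le> \<bar>x - y\<bar>" using d(2) that(1) by (simp add: dist_real_def)
        then show False using that ab by linarith
      qed
      have "Q a x"
      proof (cases "a = x")
        case True then show ?thesis using pt[of x] ab by simp
      next
        case False
        have "y \<notin> {a..<x}" if "y \<in> F" for y using sep[OF that] ab(2) by (cases "y < x") auto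
        then have "{a..<x} \<inter> F = {}" by blast
        then show ?thesis using ab False by (intro to_bad) auto
      qed
      moreover have "Q x b"
      proof (cases "b = x")
        case True then show ?thesis using pt[of x] ab by simp
      next
        case False
        have "y \<notin> {x<..b}" if "y \<in> F" for y using sep[OF that] ab(1) by (cases "x < y") auto
        then have "{x<..b} \<inter> F = {}" by blast
        then show ?thesis using ab False by (intro from_bad) auto
      qed
      ultimately show ?thesis using trans[of a x b] ab by blast
    qed
    then show "\<exists>d>0. \<forall>a b. a \<le> x \<and> x \<le> b \<and> b - a < d \<longrightarrow> 0 \<le> a \<and> b \<le> 1 \<longrightarrow> Q a b" using d(1) by blast
  qed
  then show ?thesis using uv \<open>\<epsilon> > 0\<close> unfolding Q_def by blast
qed

text \<open>The infimum is finite, since any two points of the connected set \<open>Dt\<close> are joined by a Lipschitz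
path.\<close>

lemma weak_minimum_finite:
  assumes "open D" and D: "Dt \<subseteq> D" and "connected Dt" and loc: "locally_rect_connected D Dt"
    and H: "hamiltonian D H" "\<And>x. x \<in> D \<Longrightarrow> H x 0 = 0" "\<And>x. x \<in> D \<Longrightarrow> GDERIV (H x) 0 :> b x"
    and S: "induces D H S" and min: "weak_minimizer D Dt S A\<^sub>1 A\<^sub>2 \<gamma>"
    and pq: "p \<in> A\<^sub>1" "p \<in> Dt" "q \<in> A\<^sub>2" "q \<in> Dt"
  shows "S \<gamma> < \<infinity>"
proof -
  obtain L g where g: "L \<ge> 0" "g ` {0..1} \<subseteq> Dt" "g (0::real) = p" "g 1 = q"
    "\<forall>s s'. 0 \<le> s \<and> s \<le> s' \<and> s' \<le> 1 \<longrightarrow> norm (g s' - g s) \<le> L * (s' - s)"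
    using lipschitz_connected[OF \<open>connected Dt\<close> loc pq(2,4)] by blast
  then have lip: "norm (g s' - g s) \<le> L * (s' - s)" if "0 \<le> s" "s \<le> s'" "s' \<le> 1" for s s' using that by blast
  have "continuous_on {0..1} g" by (rule lipschitz_continuous_on[OF g(1) lip])
  then have "compact (g ` {0..1})" by (rule compact_continuous_image) simp
  moreover have "g ` {0..1} \<subseteq> D" using g(2) D by blast
  ultimately obtain C where C: "C > 0" "\<forall>x\<in>g ` {0..1}. \<forall>y. local_action H x y \<le> C * norm y"
    using local_action_linear_bound[OF H] by blast
  have ell: "local_action H (g s) y \<le> C * norm y" if "0 \<le> s" "s \<le> 1" for s y
    using C(2) that by simp
  have "\<exists>\<sigma>. admissible_path Dt 0 1 \<sigma> \<and> \<sigma> 0 = g 0 \<and> \<sigma> 1 = g 1 \<and> act H \<sigma> 0 1 \<le> ennreal (C * L)"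
    by (rule lipschitz_path_on_interval(1)[OF zero_less_one g(1,2) lip less_imp_le[OF C(1)] ell])
  then obtain \<sigma> where \<sigma>: "admissible_path Dt 0 1 \<sigma>" "\<sigma> 0 = g 0" "\<sigma> 1 = g 1" "act H \<sigma> 0 1 \<le> ennreal (C * L)" by blast
  have "S \<gamma> \<le> act H \<sigma> 0 1"
  proof (rule weak_minimizer_le_act[OF min S \<sigma>(1) D])
    show "\<sigma> 0 \<in> A\<^sub>1" "\<sigma> 1 \<in> A\<^sub>2" using \<sigma>(2,3) g(3,4) pq(1,3) by simp_all
  qed
  also have "\<dots> \<le> ennreal (C * L)" by fact
  also have "\<dots> < \<infinity>" by simp
  finally show ?thesis .
qed

section \<open>Growth of functions along a path\<close>

lemma partial_division_length_le:
  fixes d :: "real set set"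
  assumes "u \<le> v" "d division_of \<Union>d" "\<Union>d \<subseteq> {u..v}"
  shows "(\<Sum>k\<in>d. measure lborel k) \<le> v - u"
proof -
  obtain q where q: "d \<subseteq> q" "q division_of {u..v}"
    using partial_division_extend_interval[of d u v] assms by (metis box_real(2))
  have "(\<Sum>k\<in>d. measure lborel k) \<le> (\<Sum>k\<in>q. measure lborel k)"
    using q division_of_finite[OF q(2)] by (intro sum_mono2) auto
  also have "\<dots> = v - u" by (rule division_length[OF assms(1) q(2)])
  finally show ?thesis .
qed

lemma ennreal_plus_le: "ennreal (x + y) \<le> ennreal x + ennreal y"
proof -
  have "ennreal (x + y) \<le> ennreal (max 0 x + max 0 y)" by (rule ennreal_leI) simp
  also have "\<dots> = ennreal (max 0 x) + ennreal (max 0 y)" by (rule ennreal_plus) auto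
  also have "\<dots> = ennreal x + ennreal y" by (simp add: ennreal_neg max_def)
  finally show ?thesis .
qed

text \<open>Calibration: a Lipschitz function that grows along the path at most at the rate of the local action
increases by at most the action.\<close>

lemma increment_le_act:
  fixes \<phi> :: "real \<Rightarrow> real ^ 'n::finite" and W :: "real ^ 'n \<Rightarrow> real"
  assumes cont: "continuous_on {0..1} \<phi>" and F: "\<forall>\<alpha>\<in>{0..1} - F. \<exists>r>0. abs_cont_on ({0..1} \<inter> cball \<alpha> r) \<phi>"
    and st: "0 \<le> s" "s \<le> t" "t \<le> 1" "{s..t} \<inter> F = {}"
    and K: "\<phi> ` {s..t} \<subseteq> K" and "C \<ge> 0" and lip: "\<And>x y. x \<in> K \<Longrightarrow> y \<in> K \<Longrightarrow> \<bar>W x - W y\<bar> \<le> C * norm (x - y)"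
    and der: "\<And>\<alpha> y. s < \<alpha> \<Longrightarrow> \<alpha> < t \<Longrightarrow> (\<phi> has_vector_derivative y) (at \<alpha>) \<Longrightarrow>
      \<exists>D. ((\<lambda>\<alpha>. W (\<phi> \<alpha>)) has_real_derivative D) (at \<alpha>) \<and> D \<le> local_action H (\<phi> \<alpha>) y"
  shows "ennreal (W (\<phi> t) - W (\<phi> s)) \<le> act H \<phi> s t"
proof -
  define P where "P u v \<longleftrightarrow> (s \<le> u \<and> v \<le> t \<longrightarrow> ennreal (W (\<phi> v) - W (\<phi> u)) \<le> act H \<phi> u v)" for u v
  have "P s t"
  proof (rule Bolzano[OF st(2)])
    fix u v w assume P: "P u v" "P v w" and le: "u \<le> v" "v \<le> w"
    show "P u w"
      unfolding P_def
    proof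
      assume uw: "s \<le> u \<and> w \<le> t"
      have "ennreal (W (\<phi> w) - W (\<phi> u)) \<le> ennreal (W (\<phi> v) - W (\<phi> u)) + ennreal (W (\<phi> w) - W (\<phi> v))"
        using ennreal_plus_le[of "W (\<phi> v) - W (\<phi> u)" "W (\<phi> w) - W (\<phi> v)"] by simp
      also have "\<dots> \<le> act H \<phi> u v + act H \<phi> v w"
        using P uw le unfolding P_def by (intro add_mono) auto
      also have "\<dots> = act H \<phi> u w" using act_split[OF le, of H \<phi>] by (rule sym)
      finally show "ennreal (W (\<phi> w) - W (\<phi> u)) \<le> act H \<phi> u w" .
    qed
  next
    fix x assume x: "s \<le> x" "x \<le> t"
    then have "x \<in> {s..t}" by simp
    then have "x \<notin> F" using st(4) by blast
    then have "x \<in> {0..1} - F" using x st by simp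
    then obtain r where r: "r > 0" "abs_cont_on ({0..1} \<inter> cball x r) \<phi>" using F by blast
    obtain \<delta> where \<delta>: "\<delta> > 0" "\<And>d. d division_of \<Union>d \<Longrightarrow> \<Union>d \<subseteq> {0..1} \<inter> cball x r \<Longrightarrow> (\<Sum>k\<in>d. measure lborel k) < \<delta> \<Longrightarrow>
        (\<Sum>k\<in>d. norm (\<phi> (Sup k) - \<phi> (Inf k))) < 1"
      by (rule ac_onD[OF r(2)[unfolded abs_cont_on_iff_ac_on] zero_less_one]) blast
    have "P u v" if uv: "u \<le> x" "x \<le> v" "v - u < min r \<delta>" for u v
      unfolding P_def
    proof
      assume uv': "s \<le> u \<and> v \<le> t"
      have sub: "{u..v} \<subseteq> {0..1} \<inter> cball x r" using uv uv' st by (auto simp: dist_real_def)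
      have "u \<le> v" using uv by simp
      have bv: "(\<Sum>k\<in>d. norm (\<phi> (Sup k) - \<phi> (Inf k))) \<le> 1" if d: "d division_of \<Union>d" "\<Union>d \<subseteq> {u..v}" for d
      proof -
        have "(\<Sum>k\<in>d. measure lborel k) < \<delta>" using partial_division_length_le[OF \<open>u \<le> v\<close> d] uv(3) by simp
        then show ?thesis using \<delta>(2)[OF d(1)] d(2) sub by (meson less_imp_le order_trans)
      qed
      have ac: "ac_on {u..v} \<phi>" using ac_on_subset[OF r(2)[unfolded abs_cont_on_iff_ac_on] sub] .
      have "continuous_on {u..v} \<phi>" by (rule continuous_on_subset[OF cont]) (use sub in blast)
      then have "\<exists>N. negligible N \<and> (\<forall>x\<in>{u<..<v} - N. \<exists>D. (\<phi> has_vector_derivative D) (at x))"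
        by (rule ac_on_vector_differentiable_almost_everywhere[OF _ ac bv])
      then obtain N where N: "negligible N" "\<forall>x\<in>{u<..<v} - N. \<exists>D. (\<phi> has_vector_derivative D) (at x)" by blast
      have inK: "\<phi> \<alpha> \<in> K" if "\<alpha> \<in> {u..v}" for \<alpha>
      proof -
        have "\<alpha> \<in> {s..t}" using that uv' by simp
        then show ?thesis using K by blast
      qed
      have acW: "ac_on {u..v} (\<lambda>\<alpha>. W (\<phi> \<alpha>))"
      proof (rule ac_on_dominated[OF ac ac \<open>C \<ge> 0\<close>])
        fix x y assume "x \<in> {u..v}" "y \<in> {u..v}"
        then have "norm (W (\<phi> y) - W (\<phi> x)) \<le> C * norm (\<phi> y - \<phi> x)" using lip[OF inK inK] by simp
        also have "\<dots> \<le> C * (norm (\<phi> y - \<phi> x) + norm (\<phi> y - \<phi> x))" using \<open>C \<ge> 0\<close> by (intro mult_left_mono) auto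
        finally show "norm (W (\<phi> y) - W (\<phi> x)) \<le> C * (norm (\<phi> y - \<phi> x) + norm (\<phi> y - \<phi> x))" .
      qed
      show "ennreal (W (\<phi> v) - W (\<phi> u)) \<le> act H \<phi> u v"
        unfolding act_def
      proof (rule ac_on_increment_le_nn_integral[OF acW \<open>u \<le> v\<close> N(1)])
        fix \<alpha> assume \<alpha>: "\<alpha> \<in> {u<..<v} - N"
        then obtain y where y: "(\<phi> has_vector_derivative y) (at \<alpha>)" using N(2) by blast
        have "s < \<alpha>" "\<alpha> < t" using \<alpha> uv' by auto
        from der[OF this y] show "\<exists>D. ((\<lambda>\<alpha>. W (\<phi> \<alpha>)) has_real_derivative D) (at \<alpha>) \<and>
            ennreal D \<le> ennreal (local_action H (\<phi> \<alpha>) (vector_derivative \<phi> (at \<alpha>)))"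
          unfolding vector_derivative_at[OF y] by (blast intro: ennreal_leI)
      qed
    qed
    then show "\<exists>d>0. \<forall>u v. u \<le> x \<and> x \<le> v \<and> v - u < d \<longrightarrow> P u v"
      using r(1) \<delta>(1) by (intro exI[of _ "min r \<delta>"]) auto
  qed
  then show ?thesis unfolding P_def by simp
qed

section \<open>The trajectory through a point with nonzero drift\<close>

text \<open>Coordinates at a point \<open>p\<close> with drift \<open>b p = a *\<^sub>R e\<close>, where \<open>e\<close> is a unit vector: in a ball of
radius \<open>\<rho>\<close> the field \<open>b\<close> is close to \<open>b p\<close>, and the rescaled field whose component along \<open>e\<close> is
\<open>1\<close> is Lipschitz.  The curve \<open>B\<close> is the trajectory of \<open>b\<close> through \<open>p\<close>, parameterized by its
coordinate along \<open>e\<close>.\<close>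

locale transversal_trajectory =
  fixes b :: "real ^ 'n::finite \<Rightarrow> real ^ 'n" and p e :: "real ^ 'n" and a \<rho> L U :: real and B :: "real \<Rightarrow> real ^ 'n"
  assumes a: "a > 0" and \<rho>: "\<rho> > 0" and L: "L \<ge> 0" and U: "U > 0" and e: "norm e = 1" and bp: "b p = a *\<^sub>R e"
    and near: "\<And>x. x \<in> cball p \<rho> \<Longrightarrow> norm (b x - b p) \<le> a / 4"
    and slope_lipschitz: "\<And>x y. x \<in> cball p \<rho> \<Longrightarrow> y \<in> cball p \<rho> \<Longrightarrow>
      norm (b x /\<^sub>R (b x \<bullet> e) - b y /\<^sub>R (b y \<bullet> e)) \<le> L * norm (x - y)"
    and traj: "\<And>w. \<bar>w\<bar> < U \<Longrightarrow> (B has_vector_derivative (b (B w) /\<^sub>R (b (B w) \<bullet> e))) (at w)"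
      "\<And>w. \<bar>w\<bar> < U \<Longrightarrow> B w \<in> cball p \<rho>" "\<And>w. \<bar>w\<bar> < U \<Longrightarrow> (B w - p) \<bullet> e = w"
    and B0: "B 0 = p"
begin

text \<open>The drift, rescaled to have component \<open>1\<close> along \<open>e\<close>.\<close>

definition slope :: "real ^ 'n \<Rightarrow> real ^ 'n" where
  "slope x = b x /\<^sub>R (b x \<bullet> e)"

text \<open>The coordinate along \<open>e\<close>, measured from \<open>p\<close>.\<close>

definition height :: "real ^ 'n \<Rightarrow> real" where
  "height x = (x - p) \<bullet> e"

text \<open>The displacement of a point from the point of the trajectory at the same height.  At heights
between \<open>- U\<close> and \<open>U\<close> it is orthogonal to \<open>e\<close>, and it vanishes only on the trajectory.\<close>

definition offset :: "real ^ 'n \<Rightarrow> real ^ 'n" where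
  "offset x = x - B (height x)"

lemma inner_e_e: "e \<bullet> e = 1" using e by (simp add: dot_square_norm)

lemma drift_bounds:
  assumes "x \<in> cball p \<rho>"
  shows "3 / 4 * a \<le> b x \<bullet> e" "norm (b x) \<le> 5 / 4 * a" "3 / 4 * a \<le> norm (b x)" "b x \<bullet> e \<le> 5 / 4 * a"
proof -
  have "\<bar>(b x - b p) \<bullet> e\<bar> \<le> norm (b x - b p) * norm e" by (rule Cauchy_Schwarz_ineq2)
  also have "\<dots> \<le> a / 4" using near[OF assms] e by simp
  finally have "\<bar>b x \<bullet> e - a\<bar> \<le> a / 4" by (simp add: bp inner_diff_left inner_e_e)
  then have "b x \<bullet> e - a \<le> a / 4" "- (b x \<bullet> e - a) \<le> a / 4" unfolding abs_le_iff by blast+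
  then show 1: "3 / 4 * a \<le> b x \<bullet> e" and "b x \<bullet> e \<le> 5 / 4 * a" by linarith+
  have "norm (b x) \<le> norm (b x - b p) + norm (b p)" using norm_triangle_sub[of "b x" "b p"] by simp
  then show "norm (b x) \<le> 5 / 4 * a" using near[OF assms] a e by (simp add: bp)
  show "3 / 4 * a \<le> norm (b x)" using 1 norm_cauchy_schwarz[of "b x" e] e by simp
qed

lemma slope_bounds:
  assumes "x \<in> cball p \<rho>"
  shows "norm (slope x) \<le> 2" "slope x \<bullet> e = 1" "b x = (b x \<bullet> e) *\<^sub>R slope x"
proof -
  note bb = drift_bounds[OF assms]
  have pos: "b x \<bullet> e > 0" using bb(1) a by linarith
  have "norm (slope x) = norm (b x) / (b x \<bullet> e)" using pos by (simp add: slope_def divide_inverse)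
  also have "\<dots> \<le> 2" using bb(1,2) a pos by (simp add: divide_le_eq)
  finally show "norm (slope x) \<le> 2" .
  show "slope x \<bullet> e = 1" "b x = (b x \<bullet> e) *\<^sub>R slope x" using pos by (auto simp: slope_def)
qed

lemma slope_lip: "x \<in> cball p \<rho> \<Longrightarrow> y \<in> cball p \<rho> \<Longrightarrow> norm (slope x - slope y) \<le> L * norm (x - y)"
  using slope_lipschitz unfolding slope_def .

lemma traj_der: "\<bar>w\<bar> < U \<Longrightarrow> (B has_vector_derivative slope (B w)) (at w)"
  using traj(1) unfolding slope_def .

lemma traj_lipschitz:
  assumes "\<bar>w\<bar> < U" "\<bar>w'\<bar> < U"
  shows "norm (B w - B w') \<le> 2 * \<bar>w - w'\<bar>"
proof -
  have "norm (B w - B w') \<le> 2 * norm (w - w')"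
  proof (rule differentiable_bound[of "{-U<..<U}" B "\<lambda>z h. h *\<^sub>R slope (B z)" 2])
    show "convex {-U<..<U}" by simp
    fix z assume "z \<in> {-U<..<U}"
    then have z: "\<bar>z\<bar> < U" by auto
    show "(B has_derivative (\<lambda>h. h *\<^sub>R slope (B z))) (at z within {-U<..<U})"
      using traj_der[OF z] unfolding has_vector_derivative_def by (rule has_derivative_at_withinI)
    show "onorm (\<lambda>h. h *\<^sub>R slope (B z)) \<le> 2"
      by (rule onorm_le) (use slope_bounds(1)[OF traj(2)[OF z]] in \<open>simp add: mult.commute mult_left_mono\<close>)
  qed (use assms in auto)
  then show ?thesis by simp
qed

lemma height_le: "\<bar>height x\<bar> \<le> norm (x - p)"
  using Cauchy_Schwarz_ineq2[of "x - p" e] e by (simp add: height_def)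

lemma height_diff: "\<bar>height x - height y\<bar> \<le> norm (x - y)"
proof -
  have "height x - height y = (x - y) \<bullet> e" by (simp add: height_def inner_diff_left)
  then show ?thesis using Cauchy_Schwarz_ineq2[of "x - y" e] e by simp
qed

lemma offset_lipschitz:
  assumes "\<bar>height x\<bar> < U" "\<bar>height y\<bar> < U"
  shows "norm (offset x - offset y) \<le> 3 * norm (x - y)"
proof -
  have "norm (offset x - offset y) = norm ((x - y) - (B (height x) - B (height y)))" by (simp add: offset_def algebra_simps)
  also have "\<dots> \<le> norm (x - y) + norm (B (height x) - B (height y))" by (rule norm_triangle_ineq4)
  also have "\<dots> \<le> 3 * norm (x - y)" using traj_lipschitz[OF assms] height_diff[of x y] by simp
  finally show ?thesis .
qed

lemma offset_base: "offset p = 0" by (simp add: offset_def height_def B0)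

lemma offset_le: "norm (x - p) < U \<Longrightarrow> norm (offset x) \<le> 3 * norm (x - p)"
  using offset_lipschitz[of x p] height_le[of x] U by (simp add: offset_base height_def[of p])

lemma offset_transversal: "\<bar>height x\<bar> < U \<Longrightarrow> offset x \<bullet> e = 0"
  using traj(3)[of "height x"] by (simp add: offset_def inner_diff_left height_def)

text \<open>The part of a velocity \<open>y\<close> that is transversal to the drift is of the order of the geometric mean of
\<open>norm y\<close> and the excess.  The free parameter \<open>\<kappa>\<close> comes from the inequality between the geometric and
the arithmetic mean.\<close>

lemma transversal_component_le:
  assumes x: "x \<in> cball p \<rho>" and "\<kappa> > 0"
  shows "norm (y - (y \<bullet> e) *\<^sub>R slope x) \<le> \<kappa> * norm y + 24 / a / \<kappa> * excess (b x) y"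
proof -
  note bb = drift_bounds[OF x] and sb = slope_bounds[OF x]
  define B where "B = norm (b x)"
  have B: "B > 0" "B \<ge> 3 / 4 * a" using bb(3) a by (auto simp: B_def)
  define u where "u = y - ((y \<bullet> b x) / B\<^sup>2) *\<^sub>R b x"
  have eq: "y - (y \<bullet> e) *\<^sub>R slope x = u - (u \<bullet> e) *\<^sub>R slope x"
  proof -
    have "b x - (b x \<bullet> e) *\<^sub>R slope x = 0" using sb(3) by simp
    then have "c *\<^sub>R b x - (c *\<^sub>R b x \<bullet> e) *\<^sub>R slope x = 0" for c by (metis inner_scaleR_left scaleR_diff_right scaleR_scaleR scaleR_zero_right)
    from this[of "(y \<bullet> b x) / B\<^sup>2"] show ?thesis unfolding u_def by (simp add: inner_diff_left algebra_simps sb(2))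
  qed
  have "norm (y - (y \<bullet> e) *\<^sub>R slope x) \<le> norm u + norm ((u \<bullet> e) *\<^sub>R slope x)" unfolding eq by (rule norm_triangle_ineq4)
  also have "\<dots> \<le> norm u + norm u * 2"
  proof -
    have "\<bar>u \<bullet> e\<bar> \<le> norm u" using Cauchy_Schwarz_ineq2[of u e] e by simp
    then have "\<bar>u \<bullet> e\<bar> * norm (slope x) \<le> norm u * 2" using sb(1) by (intro mult_mono) simp_all
    then show ?thesis by simp
  qed
  finally have le3: "norm (y - (y \<bullet> e) *\<^sub>R slope x) \<le> 3 * norm u" by simp
  define E where "E = excess (b x) y"
  have E0: "E \<ge> 0" using excess_nonneg by (simp add: E_def)
  have B2: "b x \<bullet> b x = B\<^sup>2" by (simp add: B_def dot_square_norm)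
  have "(norm u)\<^sup>2 = (norm y)\<^sup>2 - (y \<bullet> b x)\<^sup>2 / B\<^sup>2"
  proof -
    have "(norm u)\<^sup>2 = y \<bullet> y - 2 * ((y \<bullet> b x) / B\<^sup>2 * (y \<bullet> b x)) + ((y \<bullet> b x) / B\<^sup>2)\<^sup>2 * (b x \<bullet> b x)"
      unfolding u_def power2_norm_eq_inner by (simp add: inner_diff_left inner_diff_right inner_commute power2_eq_square algebra_simps)
    also have "\<dots> = (norm y)\<^sup>2 - (y \<bullet> b x)\<^sup>2 / B\<^sup>2"
      unfolding B2 using B(1) by (simp add: power2_norm_eq_inner[symmetric] power2_eq_square field_simps)
    finally show ?thesis .
  qed
  also have "\<dots> = E * (norm y * B + y \<bullet> b x) / B\<^sup>2"
    using B(1) by (simp add: E_def excess_def B_def[symmetric] field_simps power2_eq_square)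
  also have "\<dots> \<le> E * (2 * (norm y * B)) / B\<^sup>2"
    using norm_cauchy_schwarz[of y "b x"] E0 by (intro divide_right_mono mult_left_mono) (auto simp: B_def)
  also have "\<dots> = 2 * norm y * E / B" using B(1) by (simp add: power2_eq_square)
  also have "\<dots> \<le> 2 * norm y * E / (3 / 4 * a)" using B a E0 by (intro divide_left_mono) auto
  finally have u2: "(norm u)\<^sup>2 \<le> 8 / 3 / a * (norm y * E)" by simp
  have "(3 * norm u)\<^sup>2 \<le> (\<kappa> * norm y + 24 / a / \<kappa> * E)\<^sup>2"
  proof -
    have "9 * (norm u)\<^sup>2 \<le> 9 * (8 / 3 / a * (norm y * E))" using u2 by (rule mult_left_mono) simp
    then have "(3 * norm u)\<^sup>2 \<le> 24 / a * (norm y * E)" by (simp add: power_mult_distrib mult.commute)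
    also have "\<dots> = \<kappa> * norm y * (24 / a / \<kappa> * E)" using \<open>\<kappa> > 0\<close> by simp
    also have "\<dots> \<le> (\<kappa> * norm y + 24 / a / \<kappa> * E)\<^sup>2"
    proof -
      have nn: "0 \<le> \<kappa> * norm y" "0 \<le> 24 / a / \<kappa> * E" using \<open>\<kappa> > 0\<close> a E0 by auto
      have "s * t \<le> (s + t)\<^sup>2" if "0 \<le> s" "0 \<le> t" for s t :: real
        using that by (simp add: power2_sum)
      from this[OF nn] show ?thesis .
    qed
    finally show ?thesis .
  qed
  then have "3 * norm u \<le> \<kappa> * norm y + 24 / a / \<kappa> * E"
    by (rule power2_le_imp_le) (use \<open>\<kappa> > 0\<close> a E0 in auto)
  then show ?thesis using le3 unfolding E_def by linarith
qed

text \<open>A velocity that does not make progress along \<open>e\<close> has an excess at least of the order of its length.\<close>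

lemma speed_le:
  assumes x: "x \<in> cball p \<rho>"
  shows "norm y \<le> 2 / a * excess (b x) y + 2 * (y \<bullet> e)"
proof -
  have "y \<bullet> (b x - b p) \<le> norm y * (a / 4)"
    using norm_cauchy_schwarz[of y "b x - b p"] mult_left_mono[OF near[OF x] norm_ge_zero[of y]] by linarith
  moreover have "norm y * (3 / 4 * a) \<le> norm y * norm (b x)" using drift_bounds(3)[OF x] by (rule mult_left_mono) simp
  ultimately have "norm y * (a / 2) \<le> excess (b x) y + a * (y \<bullet> e)"
    unfolding excess_def by (simp add: inner_diff_right bp algebra_simps)
  then show ?thesis using a by (simp add: field_simps)
qed

text \<open>If a path ends at \<open>p\<close> and its largest offset \<open>Z\<close> from the trajectory occurs at its starting point,
at distance \<open>R\<close> from \<open>p\<close>, then its action is at least of the order of \<open>Z\<^sup>2 / R\<close>: the offset has to be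
removed within a short distance.\<close>

lemma act_lower_bound:
  assumes M: "M > 0" "\<And>x y. x \<in> cball p \<rho> \<Longrightarrow> excess (b x) y \<le> M * local_action H x y"
    and cont: "continuous_on {0..1} \<phi>" and F: "\<forall>\<alpha>\<in>{0..1} - F. \<exists>r>0. abs_cont_on ({0..1} \<inter> cball \<alpha> r) \<phi>"
    and st: "0 \<le> s" "s < t" "t \<le> 1" "{s..<t} \<inter> F = {}" and end_p: "\<phi> t = p"
    and r: "r < U" "r \<le> \<rho>" "\<And>\<alpha>. \<alpha> \<in> {s..t} \<Longrightarrow> norm (\<phi> \<alpha> - p) \<le> r"
    and Z: "Z = norm (offset (\<phi> s))" "Z > 0" "\<And>\<alpha>. \<alpha> \<in> {s..t} \<Longrightarrow> norm (offset (\<phi> \<alpha>)) \<le> Z"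
    and R: "R = norm (\<phi> s - p)" "L * R \<le> 1 / 8"
  shows "ennreal (Z\<^sup>2 / (2 * M * (9 / (2 * a) + 192 / a) * R)) \<le> act H \<phi> s t"
proof -
  define K where "K = {x. norm (x - p) \<le> r}"
  have K: "x \<in> cball p \<rho>" "\<bar>height x\<bar> < U" if "x \<in> K" for x
    using that r(1,2) height_le[of x] by (auto simp: K_def dist_norm norm_minus_commute)
  have inK: "\<phi> \<alpha> \<in> K" if "\<alpha> \<in> {s..t}" for \<alpha> using r(3)[OF that] by (simp add: K_def)
  have s: "s \<in> {s..t}" and t: "t \<in> {s..t}" using st by auto
  have "R > 0"
  proof (rule ccontr)
    assume "\<not> R > 0"
    then have "\<phi> s = p" using R(1) by simp
    then show False using Z(1,2) offset_base by simp
  qed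
  have "norm (\<phi> s - p) < U" using r(3)[OF s] r(1) by linarith
  then have ZR: "Z \<le> 3 * R" using offset_le[of "\<phi> s"] Z(1) R(1) by simp
  \<comment> \<open>With this weight the loss \<open>\<mu> * R\<close> is at most \<open>Z / 2\<close>, while \<open>N\<close> is of the order of \<open>R / Z\<close>.\<close>
  define \<kappa> where "\<kappa> = Z / (8 * R)"
  have \<kappa>: "\<kappa> > 0" using Z(2) \<open>R > 0\<close> by (simp add: \<kappa>_def)
  define \<mu> where "\<mu> = 2 * (\<kappa> + L * Z)"
  define N where "N = (\<kappa> + L * Z) * (2 / a) + 24 / a / \<kappa>"
  have LZ: "0 \<le> L * Z" using L Z(2) by simp
  have \<mu>: "\<mu> > 0" using \<kappa> LZ by (simp add: \<mu>_def)
  have N: "N > 0" unfolding N_def using \<kappa> LZ a by (intro add_nonneg_pos mult_nonneg_nonneg) auto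
  define n where "n = (- (1 / Z)) *\<^sub>R offset (\<phi> s)"
  have n: "norm n = 1" "n \<bullet> offset (\<phi> s) = - Z"
    using Z(1,2) by (auto simp: n_def dot_square_norm power2_eq_square)
  \<comment> \<open>The calibrating function: the decrease of the offset, corrected by a multiple of the progress along \<open>e\<close> in order to absorb the length of the path.\<close>
  define W where "W x = (n \<bullet> offset x - \<mu> * height x) / (N * M)" for x
  have NM: "N * M > 0" using N M(1) by simp
  have main: "ennreal (W (\<phi> t') - W (\<phi> s)) \<le> act H \<phi> s t" if t': "s \<le> t'" "t' < t" for t'
  proof -
    have "ennreal (W (\<phi> t') - W (\<phi> s)) \<le> act H \<phi> s t'"
    proof (rule increment_le_act[OF cont F])
      show "0 \<le> s" "s \<le> t'" "t' \<le> 1" using st t' by auto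
      have "{s..t'} \<subseteq> {s..<t}" using t' by auto
      then show "{s..t'} \<inter> F = {}" using st(4) by blast
      show "\<phi> ` {s..t'} \<subseteq> K" using inK t' by auto
      show "0 \<le> (3 + \<mu>) / (N * M)" using NM \<mu> by simp
    next
      fix x y assume xy: "x \<in> K" "y \<in> K"
      have "\<bar>n \<bullet> (offset x - offset y)\<bar> \<le> 3 * norm (x - y)"
        using Cauchy_Schwarz_ineq2[of n "offset x - offset y"] n(1) offset_lipschitz[OF K(2)[OF xy(1)] K(2)[OF xy(2)]] by simp
      moreover have "\<bar>\<mu> * (height x - height y)\<bar> \<le> \<mu> * norm (x - y)"
        using \<mu> height_diff[of x y] by (simp add: abs_mult)
      ultimately have "\<bar>n \<bullet> (offset x - offset y) - \<mu> * (height x - height y)\<bar> \<le> (3 + \<mu>) * norm (x - y)"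
        by (simp add: algebra_simps abs_le_iff)
      moreover have "W x - W y = (n \<bullet> (offset x - offset y) - \<mu> * (height x - height y)) / (N * M)"
        unfolding W_def diff_divide_distrib[symmetric]
        by (intro arg_cong2[where f = "(/)"] refl) (simp add: inner_diff_right algebra_simps)
      ultimately show "\<bar>W x - W y\<bar> \<le> (3 + \<mu>) / (N * M) * norm (x - y)"
        using NM by (simp add: abs_divide divide_right_mono)
    next
      fix \<alpha> y assume \<alpha>: "s < \<alpha>" "\<alpha> < t'" and y: "(\<phi> has_vector_derivative y) (at \<alpha>)"
      then have \<alpha>st: "\<alpha> \<in> {s..t}" using t' by simp
      define x where "x = \<phi> \<alpha>"
      have x: "x \<in> cball p \<rho>" "\<bar>height x\<bar> < U" using K[OF inK[OF \<alpha>st]] by (auto simp: x_def)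
      have dh: "((\<lambda>\<alpha>. height (\<phi> \<alpha>)) has_vector_derivative (y \<bullet> e)) (at \<alpha>)"
        unfolding height_def
        using bounded_linear.has_vector_derivative[OF bounded_linear_inner_left has_vector_derivative_diff[OF y has_vector_derivative_const[of p]]]
        by simp
      have dB: "((\<lambda>\<alpha>. B (height (\<phi> \<alpha>))) has_vector_derivative (y \<bullet> e) *\<^sub>R slope (B (height x))) (at \<alpha>)"
        using vector_diff_chain_at[OF dh traj_der[of "height (\<phi> \<alpha>)"]] x(2) by (simp add: o_def x_def)
      define D where "D = (n \<bullet> (y - (y \<bullet> e) *\<^sub>R slope (B (height x))) - \<mu> * (y \<bullet> e)) / (N * M)"
      have "((\<lambda>\<alpha>. n \<bullet> offset (\<phi> \<alpha>)) has_vector_derivative n \<bullet> (y - (y \<bullet> e) *\<^sub>R slope (B (height x)))) (at \<alpha>)"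
        unfolding offset_def by (rule bounded_linear.has_vector_derivative[OF bounded_linear_inner_right has_vector_derivative_diff[OF y dB]])
      then have "((\<lambda>\<alpha>. W (\<phi> \<alpha>)) has_real_derivative D) (at \<alpha>)"
        unfolding W_def D_def using dh unfolding has_real_derivative_iff_has_vector_derivative[symmetric]
        by (intro DERIV_cdivide DERIV_diff DERIV_cmult)
      moreover have "D \<le> local_action H (\<phi> \<alpha>) y"
      proof -
        define E where "E = excess (b x) y"
        have le1: "n \<bullet> (y - (y \<bullet> e) *\<^sub>R slope (B (height x))) \<le> norm (y - (y \<bullet> e) *\<^sub>R slope (B (height x)))"
          using norm_cauchy_schwarz[of n "y - (y \<bullet> e) *\<^sub>R slope (B (height x))"] n(1) by simp
        have split: "y - (y \<bullet> e) *\<^sub>R slope (B (height x)) = (y - (y \<bullet> e) *\<^sub>R slope x) + (y \<bullet> e) *\<^sub>R (slope x - slope (B (height x)))"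
          by (simp add: algebra_simps)
        have le2: "norm (y - (y \<bullet> e) *\<^sub>R slope (B (height x))) \<le> norm (y - (y \<bullet> e) *\<^sub>R slope x) + norm ((y \<bullet> e) *\<^sub>R (slope x - slope (B (height x))))"
          unfolding split by (rule norm_triangle_ineq)
        have le3: "norm ((y \<bullet> e) *\<^sub>R (slope x - slope (B (height x)))) \<le> norm y * (L * Z)"
        proof -
          have "norm (slope x - slope (B (height x))) \<le> L * norm (offset x)"
            using slope_lip[OF x(1) traj(2)[OF x(2)]] by (simp add: offset_def)
          also have "\<dots> \<le> L * Z" using Z(3)[OF \<alpha>st] L by (intro mult_left_mono) (auto simp: x_def)
          finally have "norm (slope x - slope (B (height x))) \<le> L * Z" .
          moreover have "\<bar>y \<bullet> e\<bar> \<le> norm y" using Cauchy_Schwarz_ineq2[of y e] e by simp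
          ultimately have "\<bar>y \<bullet> e\<bar> * norm (slope x - slope (B (height x))) \<le> norm y * (L * Z)"
            by (intro mult_mono) simp_all
          then show ?thesis by simp
        qed
        have "n \<bullet> (y - (y \<bullet> e) *\<^sub>R slope (B (height x))) \<le> \<kappa> * norm y + 24 / a / \<kappa> * E + norm y * (L * Z)"
          using le1 le2 le3 transversal_component_le[OF x(1) \<kappa>, of y] unfolding E_def by linarith
        also have "\<dots> = (\<kappa> + L * Z) * norm y + 24 / a / \<kappa> * E" by (simp add: algebra_simps)
        also have "(\<kappa> + L * Z) * norm y \<le> (\<kappa> + L * Z) * (2 / a * E + 2 * (y \<bullet> e))"
          using speed_le[OF x(1), of y] \<kappa> LZ unfolding E_def by (intro mult_left_mono) auto
        finally have "n \<bullet> (y - (y \<bullet> e) *\<^sub>R slope (B (height x))) - \<mu> * (y \<bullet> e) \<le> N * E"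
          by (simp add: N_def \<mu>_def algebra_simps)
        also have "\<dots> \<le> N * (M * local_action H x y)" using M(2)[OF x(1)] N unfolding E_def by (intro mult_left_mono) auto
        finally show ?thesis unfolding D_def x_def using NM by (simp add: divide_le_eq mult_ac)
      qed
      ultimately show "\<exists>D. ((\<lambda>\<alpha>. W (\<phi> \<alpha>)) has_real_derivative D) (at \<alpha>) \<and> D \<le> local_action H (\<phi> \<alpha>) y" by blast
    qed
    also have "\<dots> \<le> act H \<phi> s t" using act_split[of s t' t H \<phi>] t' by simp
    finally show ?thesis .
  qed
  \<comment> \<open>The end point itself may be an exceptional time, so it is reached as a limit.\<close>
  have lim: "ennreal (W p - W (\<phi> s)) \<le> act H \<phi> s t"
  proof (cases "act H \<phi> s t = \<infinity>")
    case False
    then obtain A where A: "A \<ge> 0" "act H \<phi> s t = ennreal A" by (cases "act H \<phi> s t") auto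
    have le: "W (\<phi> t') - W (\<phi> s) \<le> A" if "s \<le> t'" "t' < t" for t'
      using main[OF that] A by (simp add: ennreal_le_iff)
    have lipW: "\<bar>W x - W p\<bar> \<le> (3 + \<mu>) / (N * M) * norm (x - p)" if "x \<in> K" for x
    proof -
      have "\<bar>n \<bullet> offset x\<bar> \<le> 3 * norm (x - p)"
      proof -
        have "norm (x - p) < U" using that r(1) by (simp add: K_def)
        then show ?thesis using Cauchy_Schwarz_ineq2[of n "offset x"] n(1) offset_le[of x] by simp
      qed
      moreover have "\<bar>\<mu> * height x\<bar> \<le> \<mu> * norm (x - p)" using \<mu> height_le[of x] by (simp add: abs_mult)
      ultimately have "\<bar>n \<bullet> offset x - \<mu> * height x\<bar> \<le> (3 + \<mu>) * norm (x - p)" by (simp add: algebra_simps abs_le_iff)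
      moreover have "W p = 0" by (simp add: W_def offset_base height_def)
      then have "\<bar>W x - W p\<bar> = \<bar>n \<bullet> offset x - \<mu> * height x\<bar> / (N * M)"
        by (simp only: diff_0_right W_def[of x] abs_divide abs_of_pos[OF NM])
      ultimately show ?thesis using NM by (simp add: divide_right_mono)
    qed
    have "W p - W (\<phi> s) \<le> A"
    proof (rule field_le_epsilon)
      fix \<epsilon> :: real assume "\<epsilon> > 0"
      define c where "c = (3 + \<mu>) / (N * M)"
      have c: "c > 0" using NM \<mu> by (simp add: c_def)
      have "\<epsilon> / c > 0" using \<open>\<epsilon> > 0\<close> c by simp
      moreover have "t \<in> {0..1}" using st by simp
      ultimately obtain d where d: "d > 0" "\<forall>t'\<in>{0..1}. dist t' t < d \<longrightarrow> dist (\<phi> t') (\<phi> t) < \<epsilon> / c"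
        using cont unfolding continuous_on_iff by blast
      define t' where "t' = max s (t - d / 2)"
      have t': "s \<le> t'" "t' < t" "dist t' t < d" "t' \<in> {0..1}" using st d(1) by (auto simp: t'_def dist_real_def)
      have "norm (\<phi> t' - p) < \<epsilon> / c" using d(2) t' end_p by (simp add: dist_norm)
      then have "c * norm (\<phi> t' - p) < \<epsilon>" using c by (simp add: field_simps)
      moreover have "\<phi> t' \<in> K" using inK t' by simp
      ultimately have "\<bar>W (\<phi> t') - W p\<bar> < \<epsilon>" using lipW[of "\<phi> t'"] unfolding c_def by linarith
      then show "W p - W (\<phi> s) \<le> A + \<epsilon>" using le[OF t'(1,2)] by linarith
    qed
    then show ?thesis using A by (simp add: ennreal_leI)
  qed simp
  have "Z\<^sup>2 / (2 * M * (9 / (2 * a) + 192 / a) * R) \<le> W p - W (\<phi> s)"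
  proof -
    have "\<mu> * R = Z / 4 + 2 * Z * (L * R)" using \<open>R > 0\<close> by (simp add: \<mu>_def \<kappa>_def field_simps)
    also have "\<dots> \<le> Z / 4 + 2 * Z * (1 / 8)" using R(2) Z(2) by (intro add_left_mono mult_left_mono) auto
    finally have "\<mu> * R \<le> Z / 2" by simp
    moreover have "- (\<mu> * height (\<phi> s)) \<le> \<mu> * R"
      using height_le[of "\<phi> s"] \<mu> R(1) mult_left_mono[of "- height (\<phi> s)" R \<mu>] by simp
    ultimately have "Z / 2 \<le> Z + \<mu> * height (\<phi> s)" by simp
    then have "Z / 2 / (N * M) \<le> (Z + \<mu> * height (\<phi> s)) / (N * M)" using NM by (intro divide_right_mono) auto
    also have "\<dots> = W p - W (\<phi> s)"
      using n(2) by (simp add: W_def offset_base height_def[of p] add_divide_distrib diff_divide_distrib)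
    finally have 1: "Z / 2 / (N * M) \<le> W p - W (\<phi> s)" .
    have "L * Z \<le> Z / (8 * R)"
    proof -
      have "L * Z * R \<le> 1 / 8 * Z" using R(2) Z(2) mult_right_mono[of "L * R" "1 / 8" Z] by (simp add: mult_ac)
      then show ?thesis using \<open>R > 0\<close> by (simp add: field_simps)
    qed
    then have "\<kappa> + L * Z \<le> Z / (4 * R)" by (simp add: \<kappa>_def)
    also have "\<dots> \<le> 9 / 4 * (R / Z)"
    proof -
      have "Z * Z \<le> (3 * R) * (3 * R)" using ZR Z(2) by (intro mult_mono) auto
      then show ?thesis using \<open>R > 0\<close> Z(2) by (simp add: field_simps)
    qed
    finally have "(\<kappa> + L * Z) * (2 / a) \<le> 9 / 4 * (R / Z) * (2 / a)" using a by (intro mult_right_mono) auto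
    moreover have "24 / a / \<kappa> = 192 / a * (R / Z)" using \<open>R > 0\<close> Z(2) by (simp add: \<kappa>_def field_simps)
    ultimately have "N \<le> (9 / (2 * a) + 192 / a) * (R / Z)" unfolding N_def by (simp add: algebra_simps)
    then have "N * M \<le> (9 / (2 * a) + 192 / a) * (R / Z) * M" using M(1) by (intro mult_right_mono) auto
    then have "Z / 2 / ((9 / (2 * a) + 192 / a) * (R / Z) * M) \<le> Z / 2 / (N * M)"
      using NM Z(2) by (intro divide_left_mono) (auto intro!: mult_pos_pos simp: \<open>R > 0\<close> M(1) a add_pos_pos)
    moreover have "Z / 2 / ((9 / (2 * a) + 192 / a) * (R / Z) * M) = Z\<^sup>2 / (2 * M * (9 / (2 * a) + 192 / a) * R)"
    proof -
      have "Z / 2 / (c * (R / Z) * M) = Z\<^sup>2 / (2 * M * c * R)" for c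
        using Z(2) by (simp add: power2_eq_square mult_ac)
      then show ?thesis .
    qed
    ultimately show ?thesis using 1 by linarith
  qed
  then show ?thesis using lim by (meson ennreal_leI order_trans)
qed

text \<open>Deviating from the drift costs only the square of the deviation.\<close>

lemma excess_along_slope_le:
  assumes x: "x \<in> cball p \<rho>"
  shows "excess (b x) (slope x + q) \<le> 5 / 8 * a * (norm q)\<^sup>2"
proof -
  note bb = drift_bounds[OF x] and sb = slope_bounds[OF x]
  define v y where "v = slope x" and "y = slope x + q"
  have \<beta>: "b x \<bullet> e \<ge> 0" using bb(1) a by linarith
  have "excess (b x) y = (b x \<bullet> e) * (norm y * norm v - y \<bullet> v)"
  proof -
    define \<beta> where "\<beta> = b x \<bullet> e"
    have "b x = \<beta> *\<^sub>R v" "\<beta> \<ge> 0" using sb(3) \<beta> by (simp_all add: \<beta>_def v_def)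
    then show ?thesis unfolding excess_def \<beta>_def[symmetric] by (simp add: algebra_simps)
  qed
  also have "\<dots> \<le> (b x \<bullet> e) * ((norm q)\<^sup>2 / 2)"
  proof (rule mult_left_mono[OF _ \<beta>])
    have "(norm q)\<^sup>2 = (norm y)\<^sup>2 - 2 * (y \<bullet> v) + (norm v)\<^sup>2"
      unfolding y_def v_def power2_norm_eq_inner by (simp add: inner_add_left inner_add_right inner_commute)
    moreover have "0 \<le> (norm y - norm v)\<^sup>2" by simp
    ultimately show "norm y * norm v - y \<bullet> v \<le> (norm q)\<^sup>2 / 2" by (simp add: power2_diff)
  qed
  also have "\<dots> \<le> 5 / 4 * a * ((norm q)\<^sup>2 / 2)" using bb(4) by (rule mult_right_mono) simp
  finally show ?thesis by (simp add: y_def)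
qed

text \<open>The cheap competitor: starting from \<open>p0\<close>, follow the drift up to the fixed height \<open>U1\<close> and remove
the offset \<open>Z\<close> from the trajectory linearly on the way.  Its action is of the order of \<open>Z\<^sup>2\<close>, with a
constant that does not depend on \<open>p0\<close>.\<close>

lemma act_upper_bound:
  assumes m: "m > 0" "\<And>x y. x \<in> cball p \<rho> \<Longrightarrow> m * local_action H x y \<le> excess (b x) y"
    and U1: "0 < U1" "U1 < U" and p0: "norm (p0 - p) \<le> R" and R: "R \<le> U1 / 2" "2 * U1 + 3 * R \<le> \<rho>"
    and G: "cball p \<rho> \<subseteq> G" and s: "s < 1"
  shows "\<exists>\<sigma>. admissible_path G s 1 \<sigma> \<and> \<sigma> s = p0 \<and> \<sigma> 1 = B U1 \<and>
    act H \<sigma> s 1 \<le> ennreal (2 * U1 * (5 / 8 * a * (L + 2 / U1)\<^sup>2 / m) * (norm (offset p0))\<^sup>2)"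
proof -
  define z w0 where "z = offset p0" and "w0 = height p0"
  define Z where "Z = norm z"
  have w0: "\<bar>w0\<bar> \<le> R" using height_le[of p0] p0 by (simp add: w0_def)
  have w0U: "\<bar>w0\<bar> < U" using w0 R(1) U1 by linarith
  have ZR: "Z \<le> 3 * R"
  proof -
    have "norm (p0 - p) < U" using p0 R(1) U1 by linarith
    then show ?thesis using offset_le[of p0] p0 by (simp add: Z_def z_def)
  qed
  have ze: "z \<bullet> e = 0" using offset_transversal[of p0] w0U by (simp add: z_def w0_def)
  define h where "h = U1 - w0"
  have h: "h \<ge> U1 / 2" "h \<le> 2 * U1" "h > 0" using w0 R(1) U1 by (auto simp: h_def abs_le_iff)
  define k where "k = h / (1 - s)"
  have k: "k > 0" using h s by (simp add: k_def)
  define W where "W t = w0 + k * (t - s)" for t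
  have W: "w0 \<le> W t" "W t \<le> U1" "\<bar>W t\<bar> < U" "\<bar>W t\<bar> \<le> U1" if "s \<le> t" "t \<le> 1" for t
  proof -
    show 1: "w0 \<le> W t" using that k by (simp add: W_def)
    have "k * (t - s) \<le> k * (1 - s)" using that k by (intro mult_left_mono) auto
    also have "\<dots> = h" using s by (simp add: k_def)
    finally show 2: "W t \<le> U1" by (simp add: W_def h_def)
    show "\<bar>W t\<bar> \<le> U1" "\<bar>W t\<bar> < U" using 1 2 w0 R(1) U1 by (auto simp: abs_le_iff)
  qed
  \<comment> \<open>\<open>W t\<close> is the height of the competitor at time \<open>t\<close>.\<close>
  define \<sigma> where "\<sigma> t = B (W t) + ((U1 - W t) / h) *\<^sub>R z" for t
  have \<sigma>s: "\<sigma> s = p0" using h by (simp add: \<sigma>_def W_def h_def z_def offset_def w0_def)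
  have "W 1 = U1" using s by (simp add: W_def k_def h_def)
  then have \<sigma>1: "\<sigma> 1 = B U1" by (simp add: \<sigma>_def)
  have frac: "0 \<le> (U1 - W t) / h" "(U1 - W t) / h \<le> 1" if "s \<le> t" "t \<le> 1" for t
    using W[OF that] h by (auto simp: h_def)
  have near\<sigma>: "norm (\<sigma> t - B (W t)) \<le> Z" if "s \<le> t" "t \<le> 1" for t
  proof -
    have "norm (\<sigma> t - B (W t)) = (U1 - W t) / h * Z"
      by (simp only: \<sigma>_def add_diff_cancel_left' norm_scaleR Z_def real_norm_def abs_of_nonneg[OF frac(1)[OF that]])
    also have "\<dots> \<le> 1 * Z" using frac(2)[OF that] by (rule mult_right_mono) (simp add: Z_def)
    finally show ?thesis by simp
  qed
  have ball: "\<sigma> t \<in> cball p \<rho>" if "s \<le> t" "t \<le> 1" for t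
  proof -
    have "norm (B (W t) - B 0) \<le> 2 * \<bar>W t - 0\<bar>" using traj_lipschitz[of "W t" 0] W[OF that] U by simp
    then have "norm (B (W t) - p) \<le> 2 * U1" using W(4)[OF that] B0 by simp
    then have "norm (\<sigma> t - p) \<le> Z + 2 * U1"
      using near\<sigma>[OF that] norm_triangle_ineq[of "\<sigma> t - B (W t)" "B (W t) - p"] by simp
    then show ?thesis using ZR R(2) by (simp add: dist_norm norm_minus_commute)
  qed
  have adm: "admissible_path G s 1 \<sigma>"
  proof (rule admissible_path_lipschitz)
    show "0 \<le> (2 + Z / h) * k" using h k by (simp add: Z_def)
    show "\<sigma> ` {s..1} \<subseteq> G" using ball G by auto
    fix u v assume uv: "s \<le> u" "u \<le> v" "v \<le> 1"
    have Wd: "W v - W u = k * (v - u)" by (simp add: W_def algebra_simps)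
    have d: "\<sigma> v - \<sigma> u = (B (W v) - B (W u)) + ((W u - W v) / h) *\<^sub>R z"
      by (simp add: \<sigma>_def diff_divide_distrib algebra_simps)
    have "norm (\<sigma> v - \<sigma> u) \<le> norm (B (W v) - B (W u)) + norm (((W u - W v) / h) *\<^sub>R z)"
      unfolding d by (rule norm_triangle_ineq)
    also have "norm (B (W v) - B (W u)) \<le> 2 * \<bar>W v - W u\<bar>" using uv W by (intro traj_lipschitz) auto
    also have "norm (((W u - W v) / h) *\<^sub>R z) = \<bar>W v - W u\<bar> / h * Z" using h by (simp add: Z_def abs_minus_commute)
    also have "2 * \<bar>W v - W u\<bar> + \<bar>W v - W u\<bar> / h * Z = (2 + Z / h) * \<bar>W v - W u\<bar>" by (simp add: algebra_simps)
    also have "\<bar>W v - W u\<bar> = k * (v - u)" unfolding Wd using uv k by simp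
    finally show "norm (\<sigma> v - \<sigma> u) \<le> (2 + Z / h) * k * (v - u)" by (simp add: mult.assoc)
  qed
  define c where "c = 5 / 8 * a * (L + 2 / U1)\<^sup>2 / m * Z\<^sup>2"
  have c: "c \<ge> 0" using a m(1) by (simp add: c_def)
  have "act H \<sigma> s 1 \<le> ennreal ((k * c) * (1 - s))"
  proof (rule act_le[where N = "{}"])
    fix t assume t: "s < t" "t < 1"
    then have st: "s \<le> t" "t \<le> 1" by auto
    define x where "x = \<sigma> t"
    have x: "x \<in> cball p \<rho>" using ball[OF st] by (simp add: x_def)
    \<comment> \<open>The deviation of the velocity from the drift, at unit speed along \<open>e\<close>.\<close>
    define q where "q = slope (B (W t)) - slope x - (1 / h) *\<^sub>R z"
    have dW: "(W has_vector_derivative k) (at t)"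
      unfolding W_def[abs_def] has_real_derivative_iff_has_vector_derivative[symmetric]
      by (auto intro!: derivative_eq_intros)
    have dB: "((\<lambda>t. B (W t)) has_vector_derivative k *\<^sub>R slope (B (W t))) (at t)"
      using vector_diff_chain_at[OF dW traj_der[OF W(3)[OF st]]] by (simp add: o_def)
    have "((\<lambda>t. (U1 - W t) / h) has_vector_derivative (- k / h)) (at t)"
      using dW h(3) unfolding has_real_derivative_iff_has_vector_derivative[symmetric]
      by (auto intro!: derivative_eq_intros)
    then have dz: "((\<lambda>t. ((U1 - W t) / h) *\<^sub>R z) has_vector_derivative (- k / h) *\<^sub>R z) (at t)"
      by (rule bounded_linear.has_vector_derivative[OF bounded_linear_scaleR_left])
    have "(\<sigma> has_vector_derivative k *\<^sub>R slope (B (W t)) + (- k / h) *\<^sub>R z) (at t)"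
      unfolding \<sigma>_def[abs_def] by (rule has_vector_derivative_add[OF dB dz])
    also have "k *\<^sub>R slope (B (W t)) + (- k / h) *\<^sub>R z = k *\<^sub>R (slope x + q)"
      by (simp add: q_def algebra_simps)
    finally have der: "vector_derivative \<sigma> (at t) = k *\<^sub>R (slope x + q)" by (rule vector_derivative_at)
    have "norm q \<le> norm (slope (B (W t)) - slope x) + norm ((1 / h) *\<^sub>R z)"
      unfolding q_def by (rule norm_triangle_ineq4)
    also have "norm (slope (B (W t)) - slope x) \<le> L * Z"
    proof -
      have "norm (slope (B (W t)) - slope x) \<le> L * norm (B (W t) - x)" by (rule slope_lip[OF traj(2)[OF W(3)[OF st]] x])
      also have "\<dots> \<le> L * Z" using near\<sigma>[OF st] L by (intro mult_left_mono) (auto simp: x_def norm_minus_commute)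
      finally show ?thesis .
    qed
    also have "norm ((1 / h) *\<^sub>R z) \<le> 2 / U1 * Z"
    proof -
      have "1 / h \<le> 2 / U1" using h(1,3) U1(1) by (simp add: field_simps)
      then have "1 / h * Z \<le> 2 / U1 * Z" by (rule mult_right_mono) (simp add: Z_def)
      then show ?thesis using h(3) by (simp add: Z_def)
    qed
    finally have "norm q \<le> (L + 2 / U1) * Z" by (simp add: algebra_simps)
    then have q2: "(norm q)\<^sup>2 \<le> ((L + 2 / U1) * Z)\<^sup>2" by (rule power_mono) simp
    have "m * local_action H x (k *\<^sub>R (slope x + q)) \<le> excess (b x) (k *\<^sub>R (slope x + q))" by (rule m(2)[OF x])
    also have "\<dots> = k * excess (b x) (slope x + q)" using k by (simp add: excess_scale)
    also have "\<dots> \<le> k * (5 / 8 * a * (norm q)\<^sup>2)" using excess_along_slope_le[OF x] k by (intro mult_left_mono) auto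
    also have "\<dots> \<le> k * (5 / 8 * a * ((L + 2 / U1) * Z)\<^sup>2)" using q2 a k by (intro mult_left_mono) auto
    also have "\<dots> = m * (k * c)" using m(1) by (simp add: c_def power_mult_distrib)
    finally show "local_action H (\<sigma> t) (vector_derivative \<sigma> (at t)) \<le> k * c"
      unfolding der x_def[symmetric] using m(1) by simp
  qed (use s k c in auto)
  also have "(k * c) * (1 - s) = h * c" using s by (simp add: k_def)
  also have "ennreal (h * c) \<le> ennreal (2 * U1 * c)" using h(2) c by (intro ennreal_leI mult_right_mono)
  finally have "act H \<sigma> s 1 \<le> ennreal (2 * U1 * (5 / 8 * a * (L + 2 / U1)\<^sup>2 / m) * (norm (offset p0))\<^sup>2)"
    by (simp add: c_def Z_def z_def mult_ac)
  then show ?thesis using adm \<sigma>s \<sigma>1 by blast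
qed

end

lemma C1_field_lipschitz_cball:
  assumes "C1_field_on D b" "cball p \<rho> \<subseteq> D"
  shows "\<exists>C\<ge>0. \<forall>x\<in>cball p \<rho>. \<forall>y\<in>cball p \<rho>. norm (b x - b y) \<le> C * norm (x - y)"
proof -
  obtain b' :: "real ^ 'a \<Rightarrow> (real ^ 'a) \<Rightarrow>\<^sub>L (real ^ 'a)" where
    b': "\<forall>x\<in>D. (b has_derivative blinfun_apply (b' x)) (at x)" "continuous_on D b'"
    using assms(1) unfolding C1_field_on_def by (elim exE conjE) (rule that)
  have "bounded (b' ` cball p \<rho>)"
    by (rule compact_imp_bounded[OF compact_continuous_image[OF continuous_on_subset[OF b'(2) assms(2)] compact_cball]])
  then obtain C where C: "C > 0" "\<forall>A\<in>b' ` cball p \<rho>. norm A \<le> C"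
    unfolding bounded_pos by blast
  show ?thesis
  proof (intro exI[of _ C] conjI ballI)
    fix x y assume xy: "x \<in> cball p \<rho>" "y \<in> cball p \<rho>"
    show "norm (b x - b y) \<le> C * norm (x - y)"
    proof (rule differentiable_bound[of "cball p \<rho>" b "\<lambda>z. blinfun_apply (b' z)"])
      fix z assume z: "z \<in> cball p \<rho>"
      then have "z \<in> D" using assms(2) by blast
      with b'(1) have "(b has_derivative blinfun_apply (b' z)) (at z)" by (rule bspec)
      then show "(b has_derivative blinfun_apply (b' z)) (at z within cball p \<rho>)"
        by (rule has_derivative_at_withinI)
      show "onorm (blinfun_apply (b' z)) \<le> C" using C(2) z by (simp add: norm_blinfun.rep_eq[symmetric])
    qed (use xy in auto)
  qed (use C in simp)
qed

lemma normalized_field_lipschitz: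
  fixes b :: "'a::real_inner \<Rightarrow> 'a"
  assumes a: "a > 0" and "norm e = 1" and x: "3 / 4 * a \<le> b x \<bullet> e" and y: "3 / 4 * a \<le> b y \<bullet> e" "norm (b y) \<le> 5 / 4 * a"
    and lip: "norm (b x - b y) \<le> C * norm (x - y)" and "C \<ge> 0"
  shows "norm (b x /\<^sub>R (b x \<bullet> e) - b y /\<^sub>R (b y \<bullet> e)) \<le> 4 * C / a * norm (x - y)"
proof -
  define s t where "s = b x \<bullet> e" and "t = b y \<bullet> e"
  have s: "s > 0" "t > 0" "1 / s \<le> 4 / (3 * a)" using x y a by (auto simp: s_def t_def field_simps)
  have "\<bar>t - s\<bar> \<le> norm (b x - b y)"
    using Cauchy_Schwarz_ineq2[of "b x - b y" e] \<open>norm e = 1\<close> by (simp add: s_def t_def inner_diff_left abs_minus_commute)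
  have eq: "b x /\<^sub>R s - b y /\<^sub>R t = (1 / s) *\<^sub>R ((b x - b y) + ((t - s) / t) *\<^sub>R b y)"
  proof -
    have c: "(1 / s) * ((t - s) / t) = 1 / s - 1 / t" using s(1,2) by (simp add: diff_frac_eq)
    show ?thesis
      unfolding scaleR_add_right scaleR_scaleR c scaleR_diff_right scaleR_left_diff_distrib inverse_eq_divide by simp
  qed
  have "norm (((t - s) / t) *\<^sub>R b y) \<le> norm (b x - b y) * 2"
  proof -
    have "norm (b y) / t \<le> 2" using y a s by (simp add: t_def divide_le_eq)
    then have "\<bar>t - s\<bar> * (norm (b y) / t) \<le> norm (b x - b y) * 2"
      using \<open>\<bar>t - s\<bar> \<le> norm (b x - b y)\<close> s by (intro mult_mono) auto
    then show ?thesis using s by simp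
  qed
  then have "norm ((b x - b y) + ((t - s) / t) *\<^sub>R b y) \<le> 3 * norm (b x - b y)"
    using norm_triangle_ineq[of "b x - b y" "((t - s) / t) *\<^sub>R b y"] by linarith
  also have "\<dots> \<le> 3 * (C * norm (x - y))" using lip by simp
  finally have "(1 / s) * norm ((b x - b y) + ((t - s) / t) *\<^sub>R b y) \<le> 4 / (3 * a) * (3 * (C * norm (x - y)))"
    using s a by (intro mult_mono) auto
  also have "\<dots> = 4 * C / a * norm (x - y)" using a by simp
  finally show ?thesis unfolding s_def[symmetric] t_def[symmetric] eq using s by simp
qed

text \<open>Near a point with nonzero drift, the flow provides such coordinates.  The coordinate along \<open>e\<close> is
strictly increasing along the trajectory, and its inverse gives the parameterization \<open>B\<close>.\<close>

lemma transversal_trajectory_exists: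
  assumes C1: "C1_field_on D b" and flow: "is_flow D b \<psi>" and p: "p \<in> D" "b p \<noteq> 0"
    and \<rho>0: "\<rho>0 > 0" "cball p \<rho>0 \<subseteq> D" and \<tau>: "\<tau> > 0" "\<psi> p ` {-\<tau><..<\<tau>} \<subseteq> A"
  shows "\<exists>e a \<rho> L U B. transversal_trajectory b p e a \<rho> L U B \<and> \<rho> \<le> \<rho>0 \<and> (\<forall>w. \<bar>w\<bar> < U \<longrightarrow> B w \<in> A)"
proof -
  define a where "a = norm (b p)"
  have a: "a > 0" using p by (simp add: a_def)
  define e where "e = (1 / a) *\<^sub>R b p"
  have e: "norm e = 1" "b p = a *\<^sub>R e" using a by (auto simp: e_def a_def)
  have ee: "e \<bullet> e = 1" using e(1) by (simp add: dot_square_norm)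
  obtain C where C: "C \<ge> 0" "\<forall>x\<in>cball p \<rho>0. \<forall>y\<in>cball p \<rho>0. norm (b x - b y) \<le> C * norm (x - y)"
    using C1_field_lipschitz_cball[OF C1 \<rho>0(2)] by blast
  define \<rho> where "\<rho> = min \<rho>0 (a / (4 * (C + 1)))"
  have \<rho>: "\<rho> > 0" "\<rho> \<le> \<rho>0" using \<rho>0 a C by (auto simp: \<rho>_def)
  have "(C + 1) * \<rho> \<le> (C + 1) * (a / (4 * (C + 1)))" using C by (intro mult_left_mono) (auto simp: \<rho>_def)
  also have "\<dots> = a / 4"
  proof -
    have "k * (a / (4 * k)) = a / 4" if "k \<noteq> 0" for k :: real using that by simp
    from this[of "C + 1"] show ?thesis using C(1) by simp
  qed
  finally have C\<rho>: "C * \<rho> \<le> a / 4" using \<rho> by (simp add: algebra_simps)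
  have sub: "cball p \<rho> \<subseteq> cball p \<rho>0" using \<rho> by auto
  have near: "norm (b x - b p) \<le> a / 4" if x: "x \<in> cball p \<rho>" for x
  proof -
    have "norm (b x - b p) \<le> C * norm (x - p)" using C(2) x sub \<rho>0(1) by auto
    also have "\<dots> \<le> C * \<rho>" using x C(1) by (intro mult_left_mono) (auto simp: dist_norm norm_minus_commute)
    finally show ?thesis using C\<rho> by linarith
  qed
  have be: "3 / 4 * a \<le> b x \<bullet> e \<and> norm (b x) \<le> 5 / 4 * a" if x: "x \<in> cball p \<rho>" for x
  proof -
    have "\<bar>(b x - b p) \<bullet> e\<bar> \<le> a / 4" using Cauchy_Schwarz_ineq2[of "b x - b p" e] near[OF x] e(1) by simp
    then have "\<bar>b x \<bullet> e - a\<bar> \<le> a / 4" by (simp add: e(2) inner_diff_left ee)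
    then have "- (b x \<bullet> e - a) \<le> a / 4" unfolding abs_le_iff by blast
    then have "3 / 4 * a \<le> b x \<bullet> e" by linarith
    moreover have "norm (b x) \<le> 5 / 4 * a" using norm_triangle_sub[of "b x" "b p"] near[OF x] by (simp add: a_def)
    ultimately show ?thesis ..
  qed
  define \<beta> where "\<beta> = \<psi> p"
  have \<beta>: "\<beta> 0 = p" "\<And>t. (\<beta> has_vector_derivative b (\<beta> t)) (at t)"
    using flow p(1) unfolding is_flow_def \<beta>_def by blast+
  have "isCont \<beta> 0" using \<beta>(2) has_vector_derivative_continuous by blast
  then obtain d where d: "d > 0" "\<And>t. dist t 0 < d \<Longrightarrow> dist (\<beta> t) (\<beta> 0) < \<rho>"
    using \<rho>(1) unfolding continuous_at_eps_delta by blast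
  define t0 where "t0 = min d \<tau> / 2"
  have t0: "t0 > 0" "t0 < d" "t0 < \<tau>" using d(1) \<tau>(1) by (auto simp: t0_def min_def)
  have \<beta>K: "\<beta> t \<in> cball p \<rho>" if "\<bar>t\<bar> \<le> t0" for t
    using d(2)[of t] that t0 \<beta>(1) by (auto simp: dist_commute less_imp_le)
  have \<beta>A: "\<beta> t \<in> A" if "\<bar>t\<bar> \<le> t0" for t
  proof -
    have "t \<in> {-\<tau><..<\<tau>}" using that t0 by auto
    then show ?thesis using \<tau>(2) unfolding \<beta>_def by blast
  qed
  define u where "u t = (\<beta> t - p) \<bullet> e" for t
  have u0: "u 0 = 0" by (simp add: u_def \<beta>(1))
  have du: "(u has_real_derivative (b (\<beta> t) \<bullet> e)) (at t)" for t
    unfolding has_real_derivative_iff_has_vector_derivative u_def[abs_def]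
    using bounded_linear.has_vector_derivative[OF bounded_linear_inner_left has_vector_derivative_diff[OF \<beta>(2) has_vector_derivative_const[of p]]]
    by simp
  have growth: "3 / 4 * a * (t - s) \<le> u t - u s" if st: "- t0 \<le> s" "s \<le> t" "t \<le> t0" for s t
  proof (cases "s = t")
    case False
    then have "s < t" using st by simp
    obtain \<xi> where \<xi>: "s < \<xi>" "\<xi> < t" "u t - u s = (t - s) * (b (\<beta> \<xi>) \<bullet> e)"
      using MVT2[OF \<open>s < t\<close>, of u "\<lambda>t. b (\<beta> t) \<bullet> e"] du by blast
    have "\<bar>\<xi>\<bar> \<le> t0" using \<xi> st by auto
    then have "3 / 4 * a \<le> b (\<beta> \<xi>) \<bullet> e" using be \<beta>K by blast
    then have "(t - s) * (3 / 4 * a) \<le> (t - s) * (b (\<beta> \<xi>) \<bullet> e)" using \<open>s < t\<close> by (intro mult_left_mono) auto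
    then show ?thesis using \<xi>(3) by (simp add: mult.commute)
  qed simp
  define U where "U = 3 / 4 * a * t0"
  have U: "U > 0" using a t0 by (simp add: U_def)
  have ends: "u t0 \<ge> U" "u (- t0) \<le> - U"
    using growth[of 0 t0] growth[of "- t0" 0] t0 u0 by (auto simp: U_def)
  have cu: "continuous_on {-t0..t0} u"
    using du by (intro continuous_at_imp_continuous_on ballI DERIV_isCont) blast
  have "\<exists>t. \<bar>t\<bar> \<le> t0 \<and> u t = w" if "\<bar>w\<bar> < U" for w
    using IVT'[of u "- t0" w t0] ends that t0 cu by (auto simp: abs_le_iff abs_less_iff)
  then obtain T where T: "\<And>w. \<bar>w\<bar> < U \<Longrightarrow> \<bar>T w\<bar> \<le> t0 \<and> u (T w) = w" by metis
  have Tlip: "\<bar>T w - T w'\<bar> \<le> 4 / (3 * a) * \<bar>w - w'\<bar>" if "\<bar>w\<bar> < U" "\<bar>w'\<bar> < U" for w w'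
  proof -
    have *: "T w1 - T w2 \<le> 4 / (3 * a) * \<bar>w1 - w2\<bar>" if "\<bar>w1\<bar> < U" "\<bar>w2\<bar> < U" for w1 w2
    proof (cases "T w2 \<le> T w1")
      case True
      have "3 / 4 * a * (T w1 - T w2) \<le> w1 - w2"
        using growth[of "T w2" "T w1"] T[OF that(1)] T[OF that(2)] True by (auto simp: abs_le_iff)
      also have "\<dots> \<le> \<bar>w1 - w2\<bar>" by simp
      finally show ?thesis using a by (simp add: field_simps)
    next
      case False
      then have "T w1 - T w2 \<le> 0" by simp
      also have "0 \<le> 4 / (3 * a) * \<bar>w1 - w2\<bar>" using a by simp
      finally show ?thesis .
    qed
    show ?thesis using *[OF that] *[OF that(2,1)] unfolding abs_minus_commute[of w' w] by linarith
  qed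
  define B where "B w = \<beta> (T w)" for w
  have BK: "B w \<in> cball p \<rho>" and BA: "B w \<in> A" and Bu: "(B w - p) \<bullet> e = w" if "\<bar>w\<bar> < U" for w
    using T[OF that] \<beta>K[of "T w"] \<beta>A[of "T w"] unfolding B_def u_def by blast+
  have T0: "T 0 = 0"
  proof -
    have "\<bar>T 0\<bar> \<le> t0" "u (T 0) = 0" using T[of 0] U by auto
    then have "3 / 4 * a * \<bar>T 0\<bar> \<le> 0" using growth[of "T 0" 0] growth[of 0 "T 0"] u0 t0(1)
      by (cases "T 0 \<le> 0") auto
    then show ?thesis using a by (simp add: mult_le_0_iff)
  qed
  have dB: "(B has_vector_derivative (b (B w) /\<^sub>R (b (B w) \<bullet> e))) (at w)" if w: "\<bar>w\<bar> < U" for w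
  proof -
    have pos: "b (B w) \<bullet> e > 0"
    proof -
      have "3 / 4 * a \<le> b (B w) \<bullet> e" using be[OF BK[OF w]] by blast
      then show ?thesis using a by linarith
    qed
    have "isCont T w"
      unfolding continuous_at_eps_delta
    proof (intro allI impI)
      fix \<epsilon> :: real assume "\<epsilon> > 0"
      define d where "d = min (U - \<bar>w\<bar>) (\<epsilon> * a / 2)"
      have d: "d > 0" using w \<open>\<epsilon> > 0\<close> a by (simp add: d_def)
      have "dist (T w') (T w) < \<epsilon>" if "dist w' w < d" for w'
      proof -
        have w': "\<bar>w'\<bar> < U" "\<bar>w' - w\<bar> < \<epsilon> * a / 2" using that by (auto simp: d_def dist_real_def)
        have "\<bar>T w' - T w\<bar> \<le> 4 / (3 * a) * \<bar>w' - w\<bar>" by (rule Tlip[OF w'(1) w])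
        also have "\<dots> \<le> 4 / (3 * a) * (\<epsilon> * a / 2)" using w'(2) a by (intro mult_left_mono) auto
        also have "\<dots> < \<epsilon>" using a \<open>\<epsilon> > 0\<close> by simp
        finally show ?thesis by (simp add: dist_real_def)
      qed
      then show "\<exists>d>0. \<forall>w'. dist w' w < d \<longrightarrow> dist (T w') (T w) < \<epsilon>" using d by blast
    qed
    then have "(T has_real_derivative inverse (b (\<beta> (T w)) \<bullet> e)) (at w)"
      using pos w T unfolding B_def by (intro DERIV_inverse_function[OF du, where a = "- U" and b = U]) auto
    then have "(T has_vector_derivative inverse (b (B w) \<bullet> e)) (at w)"
      unfolding has_real_derivative_iff_has_vector_derivative B_def .
    from vector_diff_chain_at[OF this \<beta>(2)] show ?thesis by (simp add: o_def B_def[abs_def])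
  qed
  have "transversal_trajectory b p e a \<rho> (4 * C / a) U B"
  proof
    show "4 * C / a \<ge> 0" using C a by simp
    show "B 0 = p" by (simp add: B_def T0 \<beta>(1))
    fix x y assume xy: "x \<in> cball p \<rho>" "y \<in> cball p \<rho>"
    have "norm (b x - b y) \<le> C * norm (x - y)" using C(2) sub xy by blast
    then show "norm (b x /\<^sub>R (b x \<bullet> e) - b y /\<^sub>R (b y \<bullet> e)) \<le> 4 * C / a * norm (x - y)"
      using be[OF xy(1)] be[OF xy(2)] by (intro normalized_field_lipschitz[OF a e(1) _ _ _ _ C(1)]) auto
  next
    show "norm (b x - b p) \<le> a / 4" if "x \<in> cball p \<rho>" for x by (rule near[OF that])
    show "(B has_vector_derivative (b (B w) /\<^sub>R (b (B w) \<bullet> e))) (at w)" "B w \<in> cball p \<rho>" "(B w - p) \<bullet> e = w"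
      if "\<bar>w\<bar> < U" for w using dB[OF that] BK[OF that] Bu[OF that] by blast+
    show "0 < a" "0 < \<rho>" "0 < U" "norm e = 1" "b p = a *\<^sub>R e" by (rule a \<rho>(1) U e)+
  qed
  then have "transversal_trajectory b p e a \<rho> (4 * C / a) U B \<and> \<rho> \<le> \<rho>0 \<and> (\<forall>w. \<bar>w\<bar> < U \<longrightarrow> B w \<in> A)"
    using \<rho>(2) BA by simp
  then show ?thesis
    by - (rule exI[of _ e], rule exI[of _ a], rule exI[of _ \<rho>], rule exI[of _ "4 * C / a"], rule exI[of _ U], rule exI[of _ B])
qed

section \<open>The first hitting point of a minimizer\<close>

text \<open>If the drift did not vanish at the first hitting point, the end of the minimizer could be replaced by
a path to a later point of the trajectory, which lies in \<open>A\<^sub>2\<close>.  Before the hitting time the minimizer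
has nonzero offset \<open>Z\<close>, as the earlier part of the trajectory lies in \<open>A\<^sub>2\<close> too.  Close to the hitting
point, the replacement saves an action of order \<open>Z\<^sup>2 / R\<close> and costs only a multiple of \<open>Z\<^sup>2\<close>.\<close>

lemma drift_vanishes_at_first_hit:
  fixes D Dt A\<^sub>1 A\<^sub>2 :: "(real ^ 'n::finite) set"
  assumes "open D" and Dt: "Dt \<subseteq> D" "connected Dt" and loc: "locally_rect_connected D Dt"
    and H: "hamiltonian D H" "\<And>x. x \<in> D \<Longrightarrow> H x 0 = 0" "\<And>x. x \<in> D \<Longrightarrow> GDERIV (H x) 0 :> b x"
    and S: "induces D H S" and C1: "C1_field_on D b" and flow: "is_flow D b \<psi>"
    and A: "A\<^sub>2 \<subseteq> Dt" "A\<^sub>1 \<subseteq> Dt - A\<^sub>2"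
    and min: "weak_minimizer D Dt S A\<^sub>1 A\<^sub>2 \<gamma>" and hit: "first_hitting_point \<gamma> A\<^sub>2 p"
    and int: "p \<in> interior Dt" and \<tau>: "\<tau> > 0" "\<psi> p ` {-\<tau><..<\<tau>} \<subseteq> A\<^sub>2"
  shows "b p = 0"
proof (rule ccontr)
  assume bp: "b p \<noteq> 0"
  have \<gamma>: "\<gamma> \<in> gen_curves D" "connects \<gamma> Dt A\<^sub>1 A\<^sub>2"
    using min unfolding weak_minimizer_def gen_curves_between_def by blast+
  then obtain \<phi> where \<phi>: "\<phi> \<in> Ct D" "(1, \<phi>) \<in> \<gamma>" and cur: "\<gamma> \<in> curves D" unfolding gen_curves_def by blast
  have im: "\<phi> ` {0..1} \<subseteq> Dt" "\<phi> 0 \<in> A\<^sub>1" "\<phi> 1 \<in> A\<^sub>2"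
    using \<gamma>(2) \<phi>(2) unfolding connects_def by fastforce+
  have cont: "continuous_on {0..1} \<phi>" using \<phi>(1) unfolding Ct_def by blast
  obtain F where F: "finite F" "\<forall>\<alpha>\<in>{0..1} - F. \<exists>r>0. abs_cont_on ({0..1} \<inter> cball \<alpha> r) \<phi>"
    using \<phi>(1) unfolding Ct_def by blast
  obtain t1 where t1: "t1 \<in> {0..1}" "\<phi> t1 = p" "\<forall>s\<in>{0..<t1}. \<phi> s \<notin> A\<^sub>2"
    using first_hitting_time[OF cur \<phi>(2) hit] by auto
  have pA: "p \<in> A\<^sub>2" using hit unfolding first_hitting_point_def by auto
  then have "t1 \<noteq> 0" using t1(2) im(2) A(2) by blast
  then have t1pos: "0 < t1" "t1 \<le> 1" using t1(1) by auto
  obtain \<rho>0 where \<rho>0: "\<rho>0 > 0" "cball p \<rho>0 \<subseteq> Dt"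
    using int mem_interior_cball[of p Dt] by blast
  then have "p \<in> D" "cball p \<rho>0 \<subseteq> D" using Dt(1) pA A(1) by blast+
  from transversal_trajectory_exists[OF C1 flow this(1) bp \<rho>0(1) this(2) \<tau>]
  obtain e a \<rho> L U B where tt: "transversal_trajectory b p e a \<rho> L U B" and \<rho>le: "\<rho> \<le> \<rho>0"
    and BA: "\<forall>w. \<bar>w\<bar> < U \<longrightarrow> B w \<in> A\<^sub>2" by blast
  interpret transversal_trajectory b p e a \<rho> L U B by (rule tt)
  have "cball p \<rho> \<subseteq> cball p \<rho>0" using \<rho>le by auto
  then have Kd: "cball p \<rho> \<subseteq> Dt" "cball p \<rho> \<subseteq> D" using \<rho>0(2) Dt(1) by blast+
  obtain m M where mM: "m > 0" "M > 0" "\<forall>x\<in>cball p \<rho>. \<forall>y. m * local_action H x y \<le> excess (b x) y \<and> excess (b x) y \<le> M * local_action H x y"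
    using local_action_comparison[OF H compact_cball Kd(2)] by blast
  have m: "m * local_action H x y \<le> excess (b x) y" and M: "excess (b x) y \<le> M * local_action H x y" if "x \<in> cball p \<rho>" for x y
    using mM(3) that by blast+
  have S\<phi>: "S \<gamma> = act H \<phi> 0 1" using S \<gamma>(1) \<phi> unfolding induces_def param_action_eq_act by blast
  have fin: "S \<gamma> < \<infinity>"
    using weak_minimum_finite[OF \<open>open D\<close> Dt loc H S min im(2) _ im(3)] im A by blast
  define U1 where "U1 = Min {U / 2, \<rho> / 4}"
  have U1: "0 < U1" "U1 < U" "U1 \<le> \<rho> / 4" using U \<rho> by (auto simp: U1_def)
  define c where "c = 2 * U1 * (5 / 8 * a * (L + 2 / U1)\<^sup>2 / m)"
  have c: "c \<ge> 0" using U1 a mM(1) by (simp add: c_def)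
  define c' where "c' = 2 * M * (9 / (2 * a) + 192 / a)"
  have c': "c' > 0" using mM(2) a by (simp add: c'_def add_pos_pos)
  \<comment> \<open>Within distance \<open>R0\<close> of \<open>p\<close> the lower bound exceeds twice the cost of the competitor.\<close>
  define R0 where "R0 = Min {U1 / 2, \<rho> / 6, 1 / (8 * (L + 1)), 1 / (2 * c' * (c + 1))}"
  have R0: "R0 > 0" "R0 \<le> U1 / 2" "R0 \<le> \<rho> / 6" "R0 \<le> 1 / (8 * (L + 1))" "R0 \<le> 1 / (2 * c' * (c + 1))"
    using U1 \<rho> L c c' unfolding R0_def by auto
  have R0U: "R0 < U" "R0 \<le> \<rho>" using R0 U1 \<rho> by linarith+
  \<comment> \<open>A last piece of the path, close to \<open>p\<close> and free of exceptional times except possibly its end.\<close>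
  obtain d1 where d1: "d1 > 0" "\<forall>t\<in>{0..1}. dist t t1 < d1 \<longrightarrow> dist (\<phi> t) (\<phi> t1) < R0"
    using cont t1(1) R0(1) unfolding continuous_on_iff by blast
  obtain d2 where d2: "d2 > 0" "\<forall>y\<in>F. y \<noteq> t1 \<longrightarrow> d2 \<le> dist t1 y" using finite_set_avoid[OF F(1)] by blast
  define s0 where "s0 = max 0 (t1 - min d1 d2 / 2)"
  have s0: "0 \<le> s0" "s0 < t1" "t1 - s0 < d1" "t1 - s0 < d2" using t1pos d1(1) d2(1) by (auto simp: s0_def)
  have close: "norm (\<phi> \<alpha> - p) \<le> R0" if "\<alpha> \<in> {s0..t1}" for \<alpha>
  proof -
    have "\<alpha> \<in> {0..1}" "dist \<alpha> t1 < d1" using that s0 t1pos by (auto simp: dist_real_def)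
    then have "dist (\<phi> \<alpha>) p < R0" using d1(2) t1(2) by blast
    then show ?thesis by (simp add: dist_norm)
  qed
  have hU: "\<bar>height (\<phi> \<alpha>)\<bar> < U" if "\<alpha> \<in> {s0..t1}" for \<alpha>
    using close[OF that] height_le[of "\<phi> \<alpha>"] R0U(1) by linarith
  have noF: "{s0..<t1} \<inter> F = {}"
  proof -
    have "y \<notin> {s0..<t1}" if "y \<in> F" for y
    proof
      assume y: "y \<in> {s0..<t1}"
      then have "d2 \<le> dist t1 y" using d2(2) that by auto
      then show False using y s0(4) by (simp add: dist_real_def)
    qed
    then show ?thesis by blast
  qed
  have "continuous_on {s0..t1} (\<lambda>\<alpha>. norm (offset (\<phi> \<alpha>)))"
  proof (rule continuous_on_norm, rule continuous_on_compose2[of "{x. \<bar>height x\<bar> < U}" offset _ \<phi>])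
    show "continuous_on {x. \<bar>height x\<bar> < U} offset"
    proof (rule lipschitz_on_continuous_on[of 3], rule lipschitz_onI)
      show "dist (offset x) (offset y) \<le> 3 * dist x y" if "x \<in> {x. \<bar>height x\<bar> < U}" "y \<in> {x. \<bar>height x\<bar> < U}" for x y
        using offset_lipschitz[of x y] that by (simp add: dist_norm)
    qed simp
    show "continuous_on {s0..t1} \<phi>" by (rule continuous_on_subset[OF cont]) (use s0 t1pos in auto)
    show "\<phi> ` {s0..t1} \<subseteq> {x. \<bar>height x\<bar> < U}" using hU by auto
  qed
  \<comment> \<open>The time of the largest offset on that piece; there the path is cut.\<close>
  then obtain s where s: "s \<in> {s0..t1}" "\<forall>\<alpha>\<in>{s0..t1}. norm (offset (\<phi> \<alpha>)) \<le> norm (offset (\<phi> s))"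
    using continuous_attains_sup[of "{s0..t1}" "\<lambda>\<alpha>. norm (offset (\<phi> \<alpha>))"] s0(2) by auto
  define Z where "Z = norm (offset (\<phi> s))"
  have "offset (\<phi> s0) \<noteq> 0"
  proof
    assume "offset (\<phi> s0) = 0"
    then have "\<phi> s0 = B (height (\<phi> s0))" by (simp add: offset_def)
    also have "\<dots> \<in> A\<^sub>2" using BA hU[of s0] s0(2) by simp
    finally show False using t1(3) s0(1,2) by simp
  qed
  then have Z: "Z > 0" using s(2) s0(2) unfolding Z_def by (metis atLeastAtMost_iff less_imp_le order_refl order_less_le_trans zero_less_norm_iff)
  have "s \<noteq> t1" using Z t1(2) offset_base by (auto simp: Z_def)
  then have st: "0 \<le> s" "s < t1" "s0 \<le> s" using s(1) s0 by auto
  define R where "R = norm (\<phi> s - p)"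
  have R: "R \<le> R0" using close[OF s(1)] by (simp add: R_def)
  have Rpos: "R > 0"
  proof -
    have "\<phi> s \<noteq> p" using Z offset_base by (auto simp: Z_def)
    then show ?thesis by (simp add: R_def)
  qed
  have LR: "L * R \<le> 1 / 8"
  proof -
    have "L * R \<le> (L + 1) * R0" using R L Rpos by (intro mult_mono) auto
    also have "\<dots> \<le> (L + 1) * (1 / (8 * (L + 1)))" using R0(4) L by (intro mult_left_mono) auto
    also have "\<dots> = 1 / 8" using L by (simp add: divide_simps)
    finally show ?thesis .
  qed
  have lower: "ennreal (2 * (c + 1) * Z\<^sup>2) \<le> act H \<phi> s t1"
  proof -
    have sub: "{s..<t1} \<subseteq> {s0..<t1}" "{s..t1} \<subseteq> {s0..t1}" using st by auto
    have "ennreal (Z\<^sup>2 / (2 * M * (9 / (2 * a) + 192 / a) * R)) \<le> act H \<phi> s t1"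
    proof (rule act_lower_bound[OF mM(2) M cont F(2) st(1,2) t1pos(2) _ t1(2) R0U _ Z_def Z _ R_def LR])
      show "{s..<t1} \<inter> F = {}" using noF sub(1) by blast
      show "norm (\<phi> \<alpha> - p) \<le> R0" if "\<alpha> \<in> {s..t1}" for \<alpha> using close that sub(2) by blast
      show "norm (offset (\<phi> \<alpha>)) \<le> Z" if "\<alpha> \<in> {s..t1}" for \<alpha> using s(2) that sub(2) unfolding Z_def by blast
    qed
    moreover have "2 * (c + 1) * Z\<^sup>2 \<le> Z\<^sup>2 / (c' * R)"
    proof -
      have "c' * R \<le> c' * (1 / (2 * c' * (c + 1)))" using R R0(5) c' by (intro mult_left_mono) auto
      also have "\<dots> = 1 / (2 * (c + 1))" using c' by simp
      finally have "2 * (c + 1) * (c' * R) \<le> 2 * (c + 1) * (1 / (2 * (c + 1)))" using c by (intro mult_left_mono) auto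
      also have "\<dots> = 1" using c by simp
      finally have "2 * (c + 1) * (c' * R) * Z\<^sup>2 \<le> 1 * Z\<^sup>2" by (rule mult_right_mono) simp
      then have "2 * (c + 1) * Z\<^sup>2 * (c' * R) \<le> Z\<^sup>2" by (simp add: mult_ac)
      then show ?thesis using c' Rpos by (simp add: le_divide_eq)
    qed
    ultimately show ?thesis unfolding c'_def by (meson ennreal_leI order_trans)
  qed
  have "s < 1" using st t1pos by simp
  have "\<exists>\<sigma>. admissible_path Dt s 1 \<sigma> \<and> \<sigma> s = \<phi> s \<and> \<sigma> 1 = B U1 \<and> act H \<sigma> s 1 \<le> ennreal (c * (norm (offset (\<phi> s)))\<^sup>2)"
    unfolding c_def
    by (rule act_upper_bound[OF mM(1) m U1(1,2) _ _ _ Kd(1) \<open>s < 1\<close>, of "\<phi> s" R]) (use R R0 U1 R_def in auto)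
  then obtain \<sigma>2 where \<sigma>2: "admissible_path Dt s 1 \<sigma>2" "\<sigma>2 s = \<phi> s" "\<sigma>2 1 = B U1" "act H \<sigma>2 s 1 \<le> ennreal (c * Z\<^sup>2)"
    unfolding Z_def by blast
  \<comment> \<open>The rectifiable approximation may add \<open>Z\<^sup>2\<close> to the action; the gap between the two bounds is larger.\<close>
  have "Z\<^sup>2 > 0" using Z by simp
  from rectifiable_approximation[OF \<open>open D\<close> Dt(1) loc H \<phi>(1) im(1) order_refl st(1) less_imp_le[OF \<open>s < 1\<close>] this]
  obtain \<sigma>1 where \<sigma>1: "admissible_path Dt 0 s \<sigma>1" "\<sigma>1 0 = \<phi> 0" "\<sigma>1 s = \<phi> s" "act H \<sigma>1 0 s \<le> act H \<phi> 0 s + ennreal (Z\<^sup>2)"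
    by blast
  define \<sigma> where "\<sigma> = (\<lambda>t. if t \<le> s then \<sigma>1 t else \<sigma>2 t)"
  have "admissible_path Dt 0 1 \<sigma>"
    unfolding \<sigma>_def by (rule admissible_path_join[OF \<sigma>1(1) \<sigma>2(1) _ st(1) less_imp_le[OF \<open>s < 1\<close>]]) (simp add: \<sigma>1 \<sigma>2)
  moreover have "\<sigma> 0 = \<phi> 0" "\<sigma> 1 = B U1" using \<sigma>1(2) \<sigma>2(3) st(1) \<open>s < 1\<close> by (auto simp: \<sigma>_def)
  moreover have "B U1 \<in> A\<^sub>2" using BA U1 by simp
  ultimately have "S \<gamma> \<le> act H \<sigma> 0 1" using im(2) by (intro weak_minimizer_le_act[OF min S _ Dt(1)]) simp_all
  also have "\<dots> = act H \<sigma>1 0 s + act H \<sigma>2 s 1"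
    unfolding \<sigma>_def by (rule act_join[OF st(1) less_imp_le[OF \<open>s < 1\<close>]])
  also have "\<dots> \<le> (act H \<phi> 0 s + ennreal (Z\<^sup>2)) + ennreal (c * Z\<^sup>2)" using \<sigma>1(4) \<sigma>2(4) by (rule add_mono)
  also have "\<dots> = act H \<phi> 0 s + ennreal ((c + 1) * Z\<^sup>2)"
    using c by (simp add: add.assoc distrib_right add.commute flip: ennreal_plus)
  finally have up: "S \<gamma> \<le> act H \<phi> 0 s + ennreal ((c + 1) * Z\<^sup>2)" .
  have Seq: "S \<gamma> = act H \<phi> 0 s + act H \<phi> s 1" unfolding S\<phi> using st(1) \<open>s < 1\<close> by (intro act_split) auto
  have "act H \<phi> s t1 \<le> act H \<phi> s 1" using act_split[of s t1 1 H \<phi>] st(2) t1pos by simp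
  with lower have "act H \<phi> 0 s + ennreal (2 * (c + 1) * Z\<^sup>2) \<le> act H \<phi> 0 s + act H \<phi> s 1"
    by (intro add_left_mono) (rule order_trans)
  then have low: "act H \<phi> 0 s + ennreal (2 * (c + 1) * Z\<^sup>2) \<le> S \<gamma>" unfolding Seq .
  have "act H \<phi> 0 s \<le> S \<gamma>" unfolding Seq by simp
  then have "act H \<phi> 0 s \<noteq> \<infinity>" using fin by (auto simp: top_unique)
  moreover have "act H \<phi> 0 s + ennreal (2 * (c + 1) * Z\<^sup>2) \<le> act H \<phi> 0 s + ennreal ((c + 1) * Z\<^sup>2)"
    using low up by (rule order_trans)
  ultimately have "ennreal (2 * (c + 1) * Z\<^sup>2) \<le> ennreal ((c + 1) * Z\<^sup>2)" by (simp add: ennreal_add_left_cancel_le)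
  then have "2 * (c + 1) * Z\<^sup>2 \<le> (c + 1) * Z\<^sup>2" by (rule ennreal_le_iff[THEN iffD1, rotated]) (use c in simp)
  moreover have "(c + 1) * Z\<^sup>2 > 0" using c \<open>Z\<^sup>2 > 0\<close> by (intro mult_pos_pos) auto
  ultimately show False by linarith
qed

theorem corollary2:
  fixes D Dt A\<^sub>1 A\<^sub>2 :: "(real ^ 'n::finite) set"
    and S :: "'n curve \<Rightarrow> ennreal"
    and \<gamma> :: "'n curve"
    and x :: "real ^ 'n"
    and b :: "real ^ 'n \<Rightarrow> real ^ 'n"
    and \<psi> :: "real ^ 'n \<Rightarrow> real \<Rightarrow> real ^ 'n"
  assumes "open D" and "connected D"
    and "Dt \<subseteq> D" and "connected Dt" and "closedin (top_of_set D) Dt"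
    and "locally_rect_connected D Dt"
    and "S \<in> actions0 D"
    and "A\<^sub>2 \<subseteq> Dt" and "closedin (top_of_set D) A\<^sub>2"
    and "A\<^sub>1 \<subseteq> Dt - A\<^sub>2"
    and "weak_minimizer D Dt S A\<^sub>1 A\<^sub>2 \<gamma>"
    and "first_hitting_point \<gamma> A\<^sub>2 x"
    and "natural_drift D S b" and "is_flow D b \<psi>"
  shows "(x \<in> interior Dt \<and> (\<exists>\<tau>>0. \<psi> x ` {-\<tau><..<\<tau>} \<subseteq> A\<^sub>2) \<longrightarrow> critical_point D S x) \<and>
         (A\<^sub>2 \<subseteq> interior Dt \<and> flow_invariant \<psi> A\<^sub>2 \<longrightarrow>
            x \<in> interior Dt \<and> (\<exists>\<tau>>0. \<psi> x ` {-\<tau><..<\<tau>} \<subseteq> A\<^sub>2))"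
proof (intro conjI impI)
  have xA: "x \<in> A\<^sub>2" using assms(12) unfolding first_hitting_point_def by auto
  then have xD: "x \<in> D" using assms(3,8) by blast
  obtain H where H: "hamiltonian D H" "induces D H S" "\<forall>x\<in>D. GDERIV (H x) 0 :> b x" and C1: "C1_field_on D b"
    using assms(13) unfolding natural_drift_def by (elim conjE exE) (rule that)
  have b: "GDERIV (H x) 0 :> b x" if "x \<in> D" for x using H(3) that by (rule bspec)
  have H0: "H x 0 = 0" if "x \<in> D" for x by (rule hamiltonian_zero_at_zero[OF assms(1,7) H(1,2) that])
  {
    assume "x \<in> interior Dt \<and> (\<exists>\<tau>>0. \<psi> x ` {-\<tau><..<\<tau>} \<subseteq> A\<^sub>2)"
    then obtain \<tau> where \<tau>: "x \<in> interior Dt" "\<tau> > 0" "\<psi> x ` {-\<tau><..<\<tau>} \<subseteq> A\<^sub>2" by blast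
    have "b x = 0"
      by (rule drift_vanishes_at_first_hit[OF assms(1,3,4,6) H(1) H0 b H(2) C1 assms(14,8,10,11,12) \<tau>])
    then show "critical_point D S x"
      by (intro critical_point_if_drift_zero[OF assms(1,7) H(1,2) b xD])
  }
  {
    assume inv: "A\<^sub>2 \<subseteq> interior Dt \<and> flow_invariant \<psi> A\<^sub>2"
    then show "x \<in> interior Dt" using xA by blast
    have "\<psi> x ` {-1<..<1} \<subseteq> A\<^sub>2" using inv xA unfolding flow_invariant_def by blast
    then show "\<exists>\<tau>>0. \<psi> x ` {-\<tau><..<\<tau>} \<subseteq> A\<^sub>2" by (intro exI[of _ 1]) simp
  }
qed

end
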